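(* Let $u\in L^2(\mathbb{R}^N\times\mathbb{R})$ be a solution of $$Yu(x,t)=g(x,t),\qquad (x,t)\in\mathbb{R}^N\times\mathbb{R},$$ with $g\in L^2(\mathbb{R}^N\times\mathbb{R})$. Let $\beta\ge 1$ and $\gamma\ge 0$ satisfy $0\le 1-\gamma\le\beta$, and assume that $$D_0^{\max\{\beta,\gamma\}}u\in L^2(\mathbb{R}^N\times\mathbb{R})\quad\text{and}\quad D_0^{\gamma}g\in L^2(\mathbb{R}^N\times\mathbb{R}).$$ Set $$s=\frac{\beta}{1-\gamma+\beta},\qquad\text{and } s=1 \text{ if } 1-\gamma=\beta=0.$$ Then $D_1^{s}u\in L^2(\mathbb{R}^{N+1})$, and the estimate $$\|D_1^{s}u\|_2\le C(N,B,\beta)\,\|D_0^{\beta}u\|_2^{1-s}\,\|D_0^{\gamma}g\|_2^{s}$$ holds, where $C(N,B,\beta)$ is a constant depending only on $N$, $B$ and $\beta$.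
   Context: Let $N,m_0,m_1$ be integers with $m_0\ge m_1\ge 1$ and $m_0+m_1=N$. Coordinates (a basis) on $\mathbb{R}^N$ are chosen so that the constant real $N\times N$ matrix $B=(b_{ij})$ has the block form $$B=\begin{pmatrix}\mathbb{O}&\mathbb{O}\\ B_1&\mathbb{O}\end{pmatrix},$$ where $B_1$ is an $m_1\times m_0$ matrix of rank $m_1$ and $\mathbb{O}$ denotes zero blocks (of sizes $m_0\times m_0$, $m_0\times m_1$ and $m_1\times m_1$). Write $x=(x^{(0)},x^{(1)})\in\mathbb{R}^N$ with $x^{(0)}\in\mathbb{R}^{m_0}$ and $x^{(1)}\in\mathbb{R}^{m_1}$. The transport operator $Y$ is $$Yu(x,t)=\sum_{i,j=1}^N b_{ij}x_j\,\partial_{x_i}u(x,t)-\partial_t u(x,t),$$ understood in the sense of distributions on $\mathbb{R}^{N+1}=\mathbb{R}^N\times\mathbb{R}$. Let $\Delta_{m_0}$ and $\Delta_{m_1}$ denote the Laplacians with respect to the variables $x^{(0)}$ and $x^{(1)}$ respectively. For a real exponent $r\ge 0$, set $D_0^{r}u=(-\Delta_{m_0})^{r/2}u$ and $D_1^{r}u=(-\Delta_{m_1})^{r/2}u$ (fractional powers defined via the Fourier transform in $x^{(0)}$, respectively $x^{(1)}$). $\|\cdot\|_2$ is the norm of $L^2(\mathbb{R}^{N+1})$. *)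

theory Defs
  imports "HOL-Analysis.Analysis"
begin

text \<open>Functions on \<open>R^N \<times> R\<close> are complex-valued functions on \<open>(real ^ 'n) \<times> real\<close>;
  elements of \<open>L\<^sup>2\<close> are Borel representatives of their almost-everywhere classes.\<close>

subsection \<open>The space \<open>L\<^sup>2\<close>\<close>

definition L2 :: "('a::euclidean_space \<Rightarrow> complex) \<Rightarrow> bool" where
  "L2 f \<longleftrightarrow> f \<in> borel_measurable lborel \<and> integrable lborel (\<lambda>z. (cmod (f z))\<^sup>2)"

definition L2norm :: "('a::euclidean_space \<Rightarrow> complex) \<Rightarrow> real" where
  "L2norm f = sqrt (LINT z|lborel. (cmod (f z))\<^sup>2)"

text \<open>The conjunct \<open>L2\<close> matters: \<open>L2norm\<close> is \<open>0\<close> on functions that are not square integrable.\<close>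

definition tendsto_L2 :: "(nat \<Rightarrow> 'a::euclidean_space \<Rightarrow> complex) \<Rightarrow> ('a \<Rightarrow> complex) \<Rightarrow> bool" where
  "tendsto_L2 h f \<longleftrightarrow>
     (\<forall>n. L2 (\<lambda>z. h n z - f z)) \<and> (\<lambda>n. L2norm (\<lambda>z. h n z - f z)) \<longlonglongrightarrow> 0"

subsection \<open>Test functions and the transport operator\<close>

definition pderiv_dir :: "'a::euclidean_space \<Rightarrow> ('a \<Rightarrow> complex) \<Rightarrow> 'a \<Rightarrow> complex" where
  "pderiv_dir b f z = frechet_derivative f (at z) b"

primrec Ck :: "nat \<Rightarrow> ('a::euclidean_space \<Rightarrow> complex) \<Rightarrow> bool" where
  "Ck 0 f \<longleftrightarrow> continuous_on UNIV f"
| "Ck (Suc k) f \<longleftrightarrow> (\<forall>z. f differentiable (at z)) \<and> (\<forall>b\<in>Basis. Ck k (pderiv_dir b f))"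

definition test_function :: "('a::euclidean_space \<Rightarrow> complex) \<Rightarrow> bool" where
  "test_function \<phi> \<longleftrightarrow> (\<forall>k. Ck k \<phi>) \<and> compact (closure {z. \<phi> z \<noteq> 0})"

text \<open>The value at \<open>\<phi>\<close> of the distribution \<open>Y u = (\<Sum>i j. b\<^sub>i\<^sub>j x\<^sub>j \<partial>\<^bsub>x\<^sub>i\<^esub> u) - \<partial>\<^sub>t u\<close>: all
  derivatives, and the polynomial coefficients, are moved onto the test function.\<close>

definition Y_distr ::
  "real ^ 'n ^ 'n \<Rightarrow> ((real ^ 'n::finite) \<times> real \<Rightarrow> complex) \<Rightarrow> ((real ^ 'n) \<times> real \<Rightarrow> complex) \<Rightarrow> complex"
  where
  "Y_distr B u \<phi> = (LINT z|lborel. u z *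
     (pderiv_dir (0, 1) \<phi> z
      - (\<Sum>i\<in>UNIV. \<Sum>j\<in>UNIV. pderiv_dir (axis i 1, 0) (\<lambda>w. (B $ i $ j * fst w $ j) *\<^sub>R \<phi> w) z)))"

definition solves_Y ::
  "real ^ 'n ^ 'n \<Rightarrow> ((real ^ 'n::finite) \<times> real \<Rightarrow> complex) \<Rightarrow> ((real ^ 'n) \<times> real \<Rightarrow> complex) \<Rightarrow> bool"
  where
  "solves_Y B u g \<longleftrightarrow> (\<forall>\<phi>. test_function \<phi> \<longrightarrow> Y_distr B u \<phi> = (LINT z|lborel. g z * \<phi> z))"

text \<open>Coordinates of \<open>R^N\<close> are indexed by \<open>'m0 + 'm1\<close>: \<open>Inl\<close> gives the components of \<open>x\<^sup>(\<^sup>0\<^sup>)\<close>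
  and \<open>Inr\<close> those of \<open>x\<^sup>(\<^sup>1\<^sup>)\<close>. In \<open>real ^ 'm0 ^ 'm1\<close> the rows are indexed by \<open>'m1\<close>, so the
  only nonzero block is the lower left one.\<close>

definition block_matrix ::
  "real ^ 'm0 ^ 'm1 \<Rightarrow> real ^ ('m0::finite + 'm1::finite) ^ ('m0 + 'm1)" where
  "block_matrix B1 = (\<chi> i j. case (i, j) of (Inr k, Inl l) \<Rightarrow> B1 $ k $ l | _ \<Rightarrow> 0)"

subsection \<open>Partial Fourier transform and fractional Laplacian in a block of variables\<close>

text \<open>A block of the variables \<open>x\<close> is selected by an injection \<open>\<iota>\<close> of its index type into that
  of \<open>x\<close>; below \<open>\<iota>\<close> is \<open>Inl\<close> or \<open>Inr\<close>.\<close>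

definition block :: "('m \<Rightarrow> 'n) \<Rightarrow> real ^ 'n::finite \<Rightarrow> real ^ 'm::finite" where
  "block \<iota> x = (\<chi> i. x $ \<iota> i)"

definition set_block :: "('m \<Rightarrow> 'n) \<Rightarrow> real ^ 'm::finite \<Rightarrow> real ^ 'n::finite \<Rightarrow> real ^ 'n" where
  "set_block \<iota> y x = (\<chi> k. if k \<in> range \<iota> then y $ inv \<iota> k else x $ k)"

definition partial_fourier_integral ::
  "('m::finite \<Rightarrow> 'n::finite) \<Rightarrow> ((real ^ 'n) \<times> real \<Rightarrow> complex) \<Rightarrow> (real ^ 'n) \<times> real \<Rightarrow> complex" where
  "partial_fourier_integral \<iota> f z =
     complex_of_real ((2 * pi) powr (- real CARD('m) / 2)) *
     (LINT y|lborel. cis (- (block \<iota> (fst z) \<bullet> y)) * f (set_block \<iota> y (fst z), snd z))"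

text \<open>The (unitary) partial Fourier transform on \<open>L\<^sup>2\<close>, as the \<open>L\<^sup>2\<close>-limit of the integrals of
  the truncations \<open>f 1\<^bsub>|z| \<le> n\<^esub>\<close>, which are both integrable and square integrable. It is
  determined up to a null set.\<close>

definition is_partial_fourier ::
  "('m::finite \<Rightarrow> 'n::finite) \<Rightarrow> ((real ^ 'n) \<times> real \<Rightarrow> complex) \<Rightarrow> ((real ^ 'n) \<times> real \<Rightarrow> complex) \<Rightarrow> bool"
  where
  "is_partial_fourier \<iota> f F \<longleftrightarrow> L2 F \<and>
     tendsto_L2 (\<lambda>n. partial_fourier_integral \<iota> (\<lambda>z. indicator (cball 0 (real n)) z *\<^sub>R f z)) F"

definition partial_fourier ::
  "('m::finite \<Rightarrow> 'n::finite) \<Rightarrow> ((real ^ 'n) \<times> real \<Rightarrow> complex) \<Rightarrow> (real ^ 'n) \<times> real \<Rightarrow> complex" where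
  "partial_fourier \<iota> f = (SOME F. is_partial_fourier \<iota> f F)"

text \<open>For \<open>u\<close> in \<open>L\<^sup>2\<close>: \<open>v\<close> is in \<open>L\<^sup>2\<close> and equals \<open>(-\<Delta>)\<^bsup>r/2\<^esup> u\<close>, with \<open>\<Delta>\<close> the Laplacian in the
  variables of the block \<open>\<iota>\<close>, whose Fourier symbol is \<open>-|\<xi>|\<^sup>2\<close>.\<close>

definition is_frac ::
  "('m::finite \<Rightarrow> 'n::finite) \<Rightarrow> real \<Rightarrow> ((real ^ 'n) \<times> real \<Rightarrow> complex) \<Rightarrow> ((real ^ 'n) \<times> real \<Rightarrow> complex) \<Rightarrow> bool"
  where
  "is_frac \<iota> r u v \<longleftrightarrow> L2 v \<and>
     (AE z in lborel. partial_fourier \<iota> v z =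
        complex_of_real (norm (block \<iota> (fst z)) powr r) * partial_fourier \<iota> u z)"

text \<open>\<open>frac_in_L2 \<iota> r u\<close> says that \<open>D\<^sup>r u\<close> is in \<open>L\<^sup>2\<close>; only then is \<open>frac \<iota> r u\<close> meaningful,
  and it is then determined up to a null set.\<close>

definition frac_in_L2 ::
  "('m::finite \<Rightarrow> 'n::finite) \<Rightarrow> real \<Rightarrow> ((real ^ 'n) \<times> real \<Rightarrow> complex) \<Rightarrow> bool" where
  "frac_in_L2 \<iota> r u \<longleftrightarrow> (\<exists>v. is_frac \<iota> r u v)"

definition frac ::
  "('m::finite \<Rightarrow> 'n::finite) \<Rightarrow> real \<Rightarrow> ((real ^ 'n) \<times> real \<Rightarrow> complex) \<Rightarrow> (real ^ 'n) \<times> real \<Rightarrow> complex" where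
  "frac \<iota> r u = (SOME v. is_frac \<iota> r u v)"

abbreviation D0_in_L2 ::
  "real \<Rightarrow> ((real ^ ('m0::finite + 'm1::finite)) \<times> real \<Rightarrow> complex) \<Rightarrow> bool" where
  "D0_in_L2 \<equiv> frac_in_L2 (Inl :: 'm0 \<Rightarrow> 'm0 + 'm1)"

abbreviation D1_in_L2 ::
  "real \<Rightarrow> ((real ^ ('m0::finite + 'm1::finite)) \<times> real \<Rightarrow> complex) \<Rightarrow> bool" where
  "D1_in_L2 \<equiv> frac_in_L2 (Inr :: 'm1 \<Rightarrow> 'm0 + 'm1)"

abbreviation D0 ::
  "real \<Rightarrow> ((real ^ ('m0::finite + 'm1::finite)) \<times> real \<Rightarrow> complex) \<Rightarrow> (real ^ ('m0 + 'm1)) \<times> real \<Rightarrow> complex"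
  where
  "D0 \<equiv> frac (Inl :: 'm0 \<Rightarrow> 'm0 + 'm1)"

abbreviation D1 ::
  "real \<Rightarrow> ((real ^ ('m0::finite + 'm1::finite)) \<times> real \<Rightarrow> complex) \<Rightarrow> (real ^ ('m0 + 'm1)) \<times> real \<Rightarrow> complex"
  where
  "D1 \<equiv> frac (Inr :: 'm1 \<Rightarrow> 'm0 + 'm1)"

subsection \<open>Exponents\<close>

definition gain :: "real \<Rightarrow> real \<Rightarrow> real" where
  "gain \<beta> \<gamma> = (if 1 - \<gamma> = 0 \<and> \<beta> = 0 then 1 else \<beta> / (1 - \<gamma> + \<beta>))"

text \<open>Powers \<open>a\<^sup>p\<close> of \<open>a \<ge> 0\<close> with \<open>a\<^sup>0 = 1\<close> throughout, whereas \<open>0 powr 0 = 0\<close>.\<close>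

definition rpow :: "real \<Rightarrow> real \<Rightarrow> real" where
  "rpow a p = (if p = 0 then 1 else a powr p)"

end

theory Submission
  imports Defs "HOL-Probability.Probability"
begin

text \<open>Fourier transformation in \<open>x\<close>, with dual variables \<open>\<zeta>\<close> and \<open>\<eta>\<close>, turns the equation into transport
  along the flow \<open>(\<zeta>, \<eta>, t) \<mapsto> (\<zeta> - \<tau> w, \<eta>, t - \<tau>)\<close>, where \<open>w = B\<^sub>1\<^sup>T \<eta>\<close>. The function
  \<open>r = \<zeta> \<bullet> w / \<bar>w\<bar>\<^sup>2\<close> decreases with unit speed along this flow, so that, \<open>c\<close> and \<open>e\<close> being the transforms
  of \<open>u\<close> and \<open>g\<close>, testing the equation for \<open>c\<close> with \<open>\<bar>w\<bar>\<^bsup>2s\<^esup> r c\<close> bounds \<open>A\<^sup>2 = \<integral> \<bar>w\<bar>\<^bsup>2s\<^esup> \<bar>c\<bar>\<^sup>2\<close> by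
  \<open>2 \<integral> \<bar>w\<bar>\<^bsup>2s\<^esup> \<bar>r\<bar> \<bar>c\<bar> \<bar>e\<bar>\<close>. As \<open>\<bar>r\<bar> \<bar>w\<bar> \<le> \<bar>\<zeta>\<bar>\<close>, Hoelder's inequality with \<open>\<theta> = (1 - \<gamma>) / \<beta>\<close> gives
  \<open>A\<^sup>2 \<le> 2 A\<^bsup>1 - \<theta>\<^esup> X\<^bsup>\<theta>\<^esup> Y\<close>, where \<open>X\<close> and \<open>Y\<close> are the norms of \<open>D\<^sub>0\<^bsup>\<beta>\<^esup> u\<close> and \<open>D\<^sub>0\<^bsup>\<gamma>\<^esup> g\<close>. This
  is the estimate, since \<open>s = 1 / (1 + \<theta>)\<close> and \<open>\<bar>\<eta>\<bar> \<le> K \<bar>w\<bar>\<close> because \<open>B\<^sub>1\<close> has full rank.\<close>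

section \<open>The space \<open>L\<^sup>2\<close>\<close>

text \<open>The obstacle is regularity. \<open>u\<close> and \<open>g\<close> are merely square
  integrable, and the function used to test the equation on the Fourier side is neither smooth nor
  of bounded support, so the distributional equation does not accept it. The equation is therefore
  first integrated along the flow; the resulting Duhamel identity holds almost everywhere, can be
  paired with any L2 function, and passes to the Fourier side by duality. The derivative in the
  energy argument becomes a finite difference over a time \<delta>, and \<delta> tends to 0
  afterwards. A cut-off \<epsilon> \<le> |w| \<le> R keeps the multiplier |w|^(2s) r below a
  multiple of |\<zeta>|; as \<beta> \<ge> 1, its product with c is then in L2, and the quantity to
  be bounded is finite. The bounds are uniform in the cut-off. Time is never transformed. D0 and D1
  are given by partial transforms in different blocks, so weights have to be carried from one to the
  other, which rests on commutation of the partial transforms with each other and with multipliers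
  in the other block.\<close>

lemma L2_measurable [measurable_dest]: "L2 f \<Longrightarrow> f \<in> borel_measurable borel"
  by (simp add: L2_def)

lemma L2_iff_nn_integral:
  "L2 f \<longleftrightarrow> f \<in> borel_measurable borel \<and> (\<integral>\<^sup>+z. ennreal ((cmod (f z))\<^sup>2) \<partial>lborel) < \<infinity>"
  by (auto simp: L2_def integrable_iff_bounded)

lemma L2_nn_integral:
  assumes "L2 f"
  shows "(\<integral>\<^sup>+z. ennreal ((cmod (f z))\<^sup>2) \<partial>lborel) = ennreal ((L2norm f)\<^sup>2)"
  using assms unfolding L2_def L2norm_def
  by (subst nn_integral_eq_integral) auto

lemma L2norm_nonneg [simp]: "L2norm f \<ge> 0"
  by (simp add: L2norm_def)

lemma L2norm_power2: "(L2norm f)\<^sup>2 = (LINT z|lborel. (cmod (f z))\<^sup>2)"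
  by (simp add: L2norm_def)

lemma L2I:
  assumes "f \<in> borel_measurable borel" "(\<integral>\<^sup>+z. ennreal ((cmod (f z))\<^sup>2) \<partial>lborel) \<le> ennreal (C\<^sup>2)" "C \<ge> 0"
  shows "L2 f" "L2norm f \<le> C"
proof -
  show *: "L2 f"
    using assms by (auto simp: L2_iff_nn_integral less_top intro: le_less_trans)
  have "(L2norm f)\<^sup>2 \<le> C\<^sup>2"
    using assms(2) by (simp add: L2_nn_integral[OF *])
  then show "L2norm f \<le> C"
    using assms(3) by (rule power2_le_imp_le)
qed

lemma L2_bound:
  assumes "L2 f" "g \<in> borel_measurable borel" "AE z in lborel. cmod (g z) \<le> C * cmod (f z)" "C \<ge> 0"
  shows "L2 g" "L2norm g \<le> C * L2norm f"
proof -
  have "(\<integral>\<^sup>+z. ennreal ((cmod (g z))\<^sup>2) \<partial>lborel) \<le> (\<integral>\<^sup>+z. ennreal (C\<^sup>2) * ennreal ((cmod (f z))\<^sup>2) \<partial>lborel)"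
    using assms(3) by (intro nn_integral_mono_AE)
      (auto elim!: eventually_mono simp flip: ennreal_mult power_mult_distrib intro!: ennreal_leI power_mono)
  also have "\<dots> = ennreal ((C * L2norm f)\<^sup>2)"
    using assms(1) by (subst nn_integral_cmult)
      (auto simp: L2_nn_integral power_mult_distrib ennreal_mult)
  finally show "L2 g" "L2norm g \<le> C * L2norm f"
    using assms by (auto intro: L2I)
qed

lemma L2_cong_AE:
  assumes "L2 f" "g \<in> borel_measurable borel" "AE z in lborel. g z = f z"
  shows "L2 g" "L2norm g = L2norm f"
proof -
  show "L2 g"
    by (rule L2_bound(1)[OF assms(1,2), of 1]) (use assms(3) in auto)
  show "L2norm g = L2norm f"
    unfolding L2norm_def using assms by (intro arg_cong[of _ _ sqrt] integral_cong_AE) auto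
qed

lemma borel_measurable_cnj [measurable]: "cnj \<in> borel_measurable borel"
  by (intro borel_measurable_continuous_onI continuous_intros)

lemma L2_cnj: "L2 f \<Longrightarrow> L2 (\<lambda>z. cnj (f z))"
  by (rule L2_bound(1)[of f _ 1]) auto

lemma L2norm_cnj [simp]: "L2norm (\<lambda>z. cnj (f z)) = L2norm f"
  by (simp add: L2norm_def)

lemma L2_add:
  assumes "L2 f" "L2 g"
  shows "L2 (\<lambda>z. f z + g z)"
  unfolding L2_def
proof
  show "(\<lambda>z. f z + g z) \<in> borel_measurable lborel" using assms by auto
  show "integrable lborel (\<lambda>z. (cmod (f z + g z))\<^sup>2)"
  proof (rule Bochner_Integration.integrable_bound)
    show "integrable lborel (\<lambda>z. 2 * (cmod (f z))\<^sup>2 + 2 * (cmod (g z))\<^sup>2)"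
      using assms by (auto simp: L2_def)
    show "(\<lambda>z. (cmod (f z + g z))\<^sup>2) \<in> borel_measurable lborel" using assms by measurable
    have "(cmod (a + b))\<^sup>2 \<le> 2 * (cmod a)\<^sup>2 + 2 * (cmod b)\<^sup>2" for a b
    proof -
      have "(cmod (a + b))\<^sup>2 \<le> (cmod a + cmod b)\<^sup>2"
        by (intro power_mono norm_triangle_ineq) auto
      also have "\<dots> \<le> 2 * (cmod a)\<^sup>2 + 2 * (cmod b)\<^sup>2"
        using zero_le_power2[of "cmod a - cmod b"] by (simp add: power2_eq_square algebra_simps)
      finally show ?thesis .
    qed
    then show "AE z in lborel. norm ((cmod (f z + g z))\<^sup>2) \<le> norm (2 * (cmod (f z))\<^sup>2 + 2 * (cmod (g z))\<^sup>2)"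
      by (auto simp: abs_of_nonneg)
  qed
qed

lemma L2_cmult:
  assumes "L2 f"
  shows "L2 (\<lambda>z. c * f z)"
  by (rule L2_bound(1)[OF assms, of _ "cmod c"]) (use assms in \<open>auto simp: norm_mult\<close>)

lemma L2_diff: "L2 f \<Longrightarrow> L2 g \<Longrightarrow> L2 (\<lambda>z. f z - g z)"
  using L2_add[of f "\<lambda>z. (-1) * g z"] L2_cmult[of g "-1"] by simp

lemma L2_mult_bounded:
  assumes "L2 f" "h \<in> borel_measurable borel" "\<And>z. cmod (h z) \<le> C"
  shows "L2 (\<lambda>z. h z * f z)"
proof -
  have "C \<ge> 0" using assms(3)[of undefined] norm_ge_zero order_trans by blast
  then show ?thesis
    by (intro L2_bound(1)[OF assms(1), of _ C])
       (use assms in \<open>auto simp: norm_mult intro!: mult_right_mono\<close>)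
qed

lemma L2_indicator:
  assumes "L2 f" "S \<in> sets borel"
  shows "L2 (\<lambda>z. indicator S z *\<^sub>R f z)"
  by (rule L2_bound(1)[OF assms(1), of _ 1])
    (use assms in \<open>auto simp: indicator_def\<close>)

lemma ennreal_power2_le_imp_le:
  assumes "a\<^sup>2 \<le> (ennreal c)\<^sup>2" "c \<ge> 0"
  shows "a \<le> ennreal c"
proof (cases a)
  case (real r)
  then show ?thesis using assms
    by (auto simp: ennreal_power intro!: ennreal_leI intro: power2_le_imp_le)
next
  case top
  then show ?thesis using assms
    by (simp add: ennreal_power top_unique)
qed

lemma L2_indicator_one:
  assumes "A \<in> sets borel" "emeasure lborel A < \<infinity>"
  shows "L2 (indicator A)"
proof -
  have "(cmod (indicator A z))\<^sup>2 = indicator A z" for z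
    by (auto simp: indicator_def)
  then show ?thesis
    using assms by (simp add: L2_def)
qed

text \<open>The Cauchy-Schwarz inequality is used in its nonnegative form, since integrability of
  the product is part of the claim.\<close>

lemma L2_mult_bound:
  assumes "L2 f" "L2 g"
  shows "integrable lborel (\<lambda>z. f z * g z)"
    and "(LINT z|lborel. cmod (f z) * cmod (g z)) \<le> L2norm f * L2norm g"
    and "integrable lborel (\<lambda>z. cmod (f z) * cmod (g z))"
proof -
  have [measurable]: "f \<in> borel_measurable borel" "g \<in> borel_measurable borel"
    using assms by auto
  have "(\<integral>\<^sup>+z. ennreal (cmod (f z) * cmod (g z)) \<partial>lborel)\<^sup>2
      = (\<integral>\<^sup>+z. ennreal (cmod (f z)) * ennreal (cmod (g z)) \<partial>lborel)\<^sup>2"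
    by (simp add: ennreal_mult)
  also have "\<dots> \<le> (\<integral>\<^sup>+z. ennreal (cmod (f z)) ^ 2 \<partial>lborel) * (\<integral>\<^sup>+z. ennreal (cmod (g z)) ^ 2 \<partial>lborel)"
    by (intro Cauchy_Schwarz_nn_integral) auto
  also have "\<dots> = ennreal ((L2norm f * L2norm g)\<^sup>2)"
    by (simp add: ennreal_power L2_nn_integral assms power_mult_distrib ennreal_mult)
  also have "\<dots> = (ennreal (L2norm f * L2norm g))\<^sup>2"
    by (simp add: ennreal_power)
  finally have *: "(\<integral>\<^sup>+z. ennreal (cmod (f z) * cmod (g z)) \<partial>lborel) \<le> ennreal (L2norm f * L2norm g)"
    by (rule ennreal_power2_le_imp_le) simp
  show "integrable lborel (\<lambda>z. f z * g z)"
    unfolding integrable_iff_bounded using * by (auto simp: norm_mult intro: le_less_trans)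
  show i: "integrable lborel (\<lambda>z. cmod (f z) * cmod (g z))"
    unfolding integrable_iff_bounded using * by (auto simp: norm_mult abs_mult intro: le_less_trans)
  show "(LINT z|lborel. cmod (f z) * cmod (g z)) \<le> L2norm f * L2norm g"
    using * by (subst (asm) nn_integral_eq_integral[OF i]) simp_all
qed

lemma L2_Cauchy_Schwarz:
  assumes "L2 f" "L2 g"
  shows "cmod (LINT z|lborel. f z * g z) \<le> L2norm f * L2norm g"
proof -
  have "cmod (LINT z|lborel. f z * g z) \<le> (LINT z|lborel. cmod (f z * g z))"
    by (rule integral_norm_bound)
  then show ?thesis
    using L2_mult_bound(2)[OF assms] by (simp add: norm_mult)
qed

lemma L2norm_triangle:
  assumes "L2 f" "L2 g"
  shows "L2norm (\<lambda>z. f z + g z) \<le> L2norm f + L2norm g"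
proof (rule power2_le_imp_le)
  have i: "integrable lborel (\<lambda>z. (cmod (f z))\<^sup>2)" "integrable lborel (\<lambda>z. (cmod (g z))\<^sup>2)"
    "integrable lborel (\<lambda>z. 2 * (cmod (f z) * cmod (g z)))"
    using assms L2_mult_bound(3)[OF assms] by (auto simp: L2_def)
  have "(L2norm (\<lambda>z. f z + g z))\<^sup>2 \<le> (LINT z|lborel. (cmod (f z))\<^sup>2 + (cmod (g z))\<^sup>2 + 2 * (cmod (f z) * cmod (g z)))"
    unfolding L2norm_power2
  proof (rule integral_mono)
    show "integrable lborel (\<lambda>z. (cmod (f z + g z))\<^sup>2)" using L2_add[OF assms] by (simp add: L2_def)
    show "(cmod (f z + g z))\<^sup>2 \<le> (cmod (f z))\<^sup>2 + (cmod (g z))\<^sup>2 + 2 * (cmod (f z) * cmod (g z))" for z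
      using power_mono[OF norm_triangle_ineq[of "f z" "g z"], of 2] by (simp add: power2_sum)
  qed (use i in auto)
  also have "\<dots> = (L2norm f)\<^sup>2 + (L2norm g)\<^sup>2 + 2 * (LINT z|lborel. cmod (f z) * cmod (g z))"
    using i by (simp add: L2norm_power2)
  also have "\<dots> \<le> (L2norm f + L2norm g)\<^sup>2"
    using L2_mult_bound(2)[OF assms] by (simp add: power2_sum)
  finally show "(L2norm (\<lambda>z. f z + g z))\<^sup>2 \<le> (L2norm f + L2norm g)\<^sup>2" .
qed simp

lemma L2norm_minus_commute: "L2norm (\<lambda>z. f z - g z) = L2norm (\<lambda>z. g z - f z)"
  by (simp add: L2norm_def norm_minus_commute)

lemma L2norm_triangle_diff:
  assumes "L2 f" "L2 g" "L2 h"
  shows "L2norm (\<lambda>z. f z - h z) \<le> L2norm (\<lambda>z. f z - g z) + L2norm (\<lambda>z. g z - h z)"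
  using L2norm_triangle[OF L2_diff[OF assms(1,2)] L2_diff[OF assms(2,3)]] by simp

lemma L2norm_eq_0_AE:
  assumes "L2 f" "L2norm f = 0"
  shows "AE z in lborel. f z = 0"
proof -
  have "(\<integral>\<^sup>+z. ennreal ((cmod (f z))\<^sup>2) \<partial>lborel) = 0"
    using assms by (simp add: L2_nn_integral)
  then show ?thesis
    using assms(1) by (subst (asm) nn_integral_0_iff_AE) auto
qed

text \<open>Riesz-Fischer: a fast subsequence converges pointwise almost everywhere, and Fatou's
  lemma bounds the distance from each term to the pointwise limit.\<close>

lemma L2_complete:
  assumes f: "\<And>n. L2 (f n)"
    and Cauchy: "\<And>e. e > 0 \<Longrightarrow> \<exists>N. \<forall>m\<ge>N. \<forall>n\<ge>N. L2norm (\<lambda>z. f m z - f n z) < e"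
  shows "\<exists>F. L2 F \<and> (\<lambda>n. L2norm (\<lambda>z. f n z - F z)) \<longlonglongrightarrow> 0"
proof -
  have [measurable]: "f n \<in> borel_measurable borel" for n using f by auto
  have "\<forall>k. \<exists>N. \<forall>m\<ge>N. \<forall>n\<ge>N. L2norm (\<lambda>z. f m z - f n z) < (1/2) ^ k"
    using Cauchy by simp
  then obtain N where N: "\<And>k m n. m \<ge> N k \<Longrightarrow> n \<ge> N k \<Longrightarrow> L2norm (\<lambda>z. f m z - f n z) < (1/2) ^ k"
    by metis
  \<comment> \<open>The partial sums make the indices monotone and at least \<open>N k\<close>; the
    extra \<open>k\<close> forces them to infinity.\<close>
  define r where "r k = (\<Sum>j\<le>k. N j) + k" for k
  have rN: "r k \<ge> N k" for k
    using member_le_sum[of k "{..k}" N] by (simp add: r_def)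
  have r_mono: "r k \<le> r (Suc k)" for k by (simp add: r_def)
  have r_ge: "r k \<ge> k" for k by (simp add: r_def)
  define d where "d k z = f (r (Suc k)) z - f (r k) z" for k z
  have [measurable]: "d k \<in> borel_measurable borel" for k unfolding d_def by simp
  have L2d: "L2 (d k)" for k unfolding d_def by (intro L2_diff f)
  have d: "L2norm (d k) \<le> (1/2) ^ k" for k
    unfolding d_def using N[of k "r (Suc k)" "r k"] rN[of k] r_mono[of k] by simp
  have "(\<integral>\<^sup>+z. (\<Sum>k. ennreal (2 ^ k * (cmod (d k z))\<^sup>2)) \<partial>lborel) = (\<Sum>k. ennreal (2 ^ k * (L2norm (d k))\<^sup>2))"
    by (subst nn_integral_suminf) (auto simp: ennreal_mult nn_integral_cmult L2_nn_integral L2d)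
  also have "\<dots> \<le> (\<Sum>k. ennreal ((1/2) ^ k))"
  proof (intro suminf_le ennreal_leI)
    fix k
    have "2 ^ k * (L2norm (d k))\<^sup>2 \<le> 2 ^ k * ((1/2) ^ k)\<^sup>2"
      using d[of k] by (intro mult_left_mono power_mono) auto
    also have "\<dots> = (1/2) ^ k"
      by (simp add: power2_eq_square power_divide)
    finally show "2 ^ k * (L2norm (d k))\<^sup>2 \<le> (1/2) ^ k" .
  qed auto
  also have "\<dots> = ennreal 2"
    using suminf_geometric[of "1/2::real"] by (subst suminf_ennreal2) auto
  finally have "(\<integral>\<^sup>+z. (\<Sum>k. ennreal (2 ^ k * (cmod (d k z))\<^sup>2)) \<partial>lborel) \<noteq> \<infinity>"
    by (auto simp: top_unique)
  then have "AE z in lborel. (\<Sum>k. ennreal (2 ^ k * (cmod (d k z))\<^sup>2)) \<noteq> \<infinity>"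
    by (intro nn_integral_PInf_AE) auto
  then have conv: "AE z in lborel. convergent (\<lambda>k. f (r k) z)"
  proof (eventually_elim)
    case (elim z)
    then have "summable (\<lambda>k. 2 ^ k * (cmod (d k z))\<^sup>2)"
      by (intro summable_suminf_not_top) auto
    then have s: "summable (\<lambda>k. (1/2) ^ k + 2 ^ k * (cmod (d k z))\<^sup>2)"
      by (intro summable_add summable_geometric) auto
    have "summable (\<lambda>k. d k z)"
    proof (rule summable_comparison_test'[OF s])
      fix k :: nat
      \<comment> \<open>The weight 2^k in the series of squares is affordable because the squared
        norms of \<open>d k\<close> are at most 4^-k. The modulus of \<open>d k z\<close> is
        \<open>(1 / sqrt 2) ^ k\<close> times \<open>a\<close>, hence at most the sum of their
        squares, and both squares are summable.\<close>
      define a where "a = (sqrt 2) ^ k * cmod (d k z)"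
      have a: "a\<^sup>2 = 2 ^ k * (cmod (d k z))\<^sup>2"
        by (simp add: a_def power_mult_distrib power_mult[symmetric] mult.commute[of k])
           (simp add: power_mult)
      have b: "((1 / sqrt 2) ^ k)\<^sup>2 = (1/2::real) ^ k"
        by (simp add: power_mult[symmetric] mult.commute[of k]) (simp add: power_mult power_divide)
      have "cmod (d k z) = (1 / sqrt 2) ^ k * a"
        by (simp add: a_def power_divide)
      also have "\<dots> \<le> ((1 / sqrt 2) ^ k)\<^sup>2 + a\<^sup>2"
        using zero_le_power2[of "(1 / sqrt 2) ^ k - a"] zero_le_power2[of "(1 / sqrt 2) ^ k"] zero_le_power2[of a]
        unfolding power2_diff by linarith
      finally show "norm (d k z) \<le> (1/2) ^ k + 2 ^ k * (cmod (d k z))\<^sup>2"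
        unfolding a b .
    qed
    then have "convergent (\<lambda>n. \<Sum>k<n. d k z)"
      by (simp add: summable_iff_convergent)
    moreover have "(\<Sum>k<n. d k z) = f (r n) z - f (r 0) z" for n
      using sum_lessThan_telescope[of "\<lambda>k. f (r k) z" n] by (simp add: d_def)
    ultimately have "convergent (\<lambda>n. f (r n) z - f (r 0) z + f (r 0) z)"
      using convergent_add[OF _ convergent_const] by fastforce
    then show ?case by simp
  qed
  define F where "F z = lim (\<lambda>k. f (r k) z)" for z
  have [measurable]: "F \<in> borel_measurable borel" unfolding F_def by measurable
  \<comment> \<open>Fatou's lemma along the subsequence: since \<open>r j \<ge> j\<close>, every
    \<open>j \<ge> N k\<close> gives an index at which the Cauchy bound against \<open>f m\<close>
    applies.\<close>
  have est: "(\<integral>\<^sup>+z. ennreal ((cmod (f m z - F z))\<^sup>2) \<partial>lborel) \<le> ennreal (((1/2) ^ k)\<^sup>2)" if "m \<ge> N k" for m k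
  proof -
    have "(\<integral>\<^sup>+z. ennreal ((cmod (f m z - F z))\<^sup>2) \<partial>lborel)
        \<le> (\<integral>\<^sup>+z. liminf (\<lambda>j. ennreal ((cmod (f m z - f (r j) z))\<^sup>2)) \<partial>lborel)"
    proof (rule nn_integral_mono_AE)
      show "AE z in lborel. ennreal ((cmod (f m z - F z))\<^sup>2) \<le> liminf (\<lambda>j. ennreal ((cmod (f m z - f (r j) z))\<^sup>2))"
        using conv
      proof eventually_elim
        case (elim z)
        then have "(\<lambda>j. f (r j) z) \<longlonglongrightarrow> F z"
          unfolding F_def by (simp add: convergent_LIMSEQ_iff)
        then have "(\<lambda>j. ennreal ((cmod (f m z - f (r j) z))\<^sup>2)) \<longlonglongrightarrow> ennreal ((cmod (f m z - F z))\<^sup>2)"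
          by (intro tendsto_intros)
        from lim_imp_Liminf[OF sequentially_bot this] show ?case by simp
      qed
    qed
    also have "\<dots> \<le> liminf (\<lambda>j. \<integral>\<^sup>+z. ennreal ((cmod (f m z - f (r j) z))\<^sup>2) \<partial>lborel)"
      by (intro nn_integral_liminf) auto
    also have "\<dots> \<le> ennreal (((1/2) ^ k)\<^sup>2)"
    proof (rule Liminf_le)
      have "(\<integral>\<^sup>+z. ennreal ((cmod (f m z - f (r j) z))\<^sup>2) \<partial>lborel) \<le> ennreal (((1/2) ^ k)\<^sup>2)" if "j \<ge> N k" for j
        using N[of k m "r j"] \<open>m \<ge> N k\<close> that r_ge[of j]
        by (subst L2_nn_integral) (auto intro!: L2_diff f ennreal_leI power_mono)
      then show "\<forall>\<^sub>F j in sequentially. (\<integral>\<^sup>+z. ennreal ((cmod (f m z - f (r j) z))\<^sup>2) \<partial>lborel) \<le> ennreal (((1/2) ^ k)\<^sup>2)"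
        by (auto simp: eventually_sequentially)
    qed simp
    finally show ?thesis .
  qed
  have L2diff: "L2 (\<lambda>z. f m z - F z)" and le: "L2norm (\<lambda>z. f m z - F z) \<le> (1/2) ^ k" if "m \<ge> N k" for m k
    using L2I[OF _ est[OF that]] by auto
  have "L2 F"
    using L2_diff[OF f L2diff[of 0 "N 0"], of "N 0"] by simp
  moreover have "(\<lambda>n. L2norm (\<lambda>z. f n z - F z)) \<longlonglongrightarrow> 0"
  proof (rule LIMSEQ_I)
    fix e :: real assume "e > 0"
    then obtain k where "(1/2) ^ k < e" using real_arch_pow_inv[of e "1/2"] by auto
    then show "\<exists>no. \<forall>n\<ge>no. norm (L2norm (\<lambda>z. f n z - F z) - 0) < e"
      using le[where k=k] by (auto intro!: exI[of _ "N k"] intro: le_less_trans)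
  qed
  ultimately show ?thesis by blast
qed

lemma tendsto_L2_inner:
  assumes "\<And>n. L2 (f n)" "L2 F" "(\<lambda>n. L2norm (\<lambda>z. f n z - F z)) \<longlonglongrightarrow> 0" "L2 h"
  shows "(\<lambda>n. LINT z|lborel. f n z * h z) \<longlonglongrightarrow> (LINT z|lborel. F z * h z)"
proof (rule Lim_null[THEN iffD2], rule Lim_null_comparison[OF always_eventually, rule_format])
  show "cmod ((LINT z|lborel. f n z * h z) - (LINT z|lborel. F z * h z)) \<le> L2norm (\<lambda>z. f n z - F z) * L2norm h" for n
    using L2_Cauchy_Schwarz[OF L2_diff[OF assms(1)[of n] assms(2)] assms(4)] L2_mult_bound(1)[OF assms(1,4)] L2_mult_bound(1)[OF assms(2,4)]
    by (simp add: left_diff_distrib)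
  show "(\<lambda>n. L2norm (\<lambda>z. f n z - F z) * L2norm h) \<longlonglongrightarrow> 0"
    using tendsto_mult_right[OF assms(3), of "L2norm h"] by simp
qed

lemma tendsto_L2_norm:
  assumes "\<And>n. L2 (f n)" "L2 F" "(\<lambda>n. L2norm (\<lambda>z. f n z - F z)) \<longlonglongrightarrow> 0"
  shows "(\<lambda>n. L2norm (f n)) \<longlonglongrightarrow> L2norm F"
proof (rule Lim_null[THEN iffD2], rule Lim_null_comparison[OF always_eventually, rule_format])
  show "norm (L2norm (f n) - L2norm F) \<le> L2norm (\<lambda>z. f n z - F z)" for n
    using L2norm_triangle[OF L2_diff[OF assms(1)[of n] assms(2)] assms(2)]
      L2norm_triangle[OF L2_diff[OF assms(2) assms(1)[of n]] assms(1)[of n]]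
      L2norm_minus_commute[of F "f n"] by auto
qed (rule assms(3))

lemma tendsto_L2_truncation:
  fixes f :: "'a::euclidean_space \<Rightarrow> complex"
  assumes "L2 f" and S: "\<And>n. S n \<in> sets borel" and ev: "\<And>z. eventually (\<lambda>n. z \<in> S n) sequentially"
  shows "(\<lambda>n. L2norm (\<lambda>z. indicator (S n) z *\<^sub>R f z - f z)) \<longlonglongrightarrow> 0"
proof -
  have [measurable]: "f \<in> borel_measurable borel" "\<And>n. S n \<in> sets borel" using assms by auto
  have "(\<lambda>n. LINT z|lborel. (cmod (indicator (S n) z *\<^sub>R f z - f z))\<^sup>2) \<longlonglongrightarrow> (LINT z::'a|lborel. 0)"
  proof (rule integral_dominated_convergence[where w="\<lambda>z. (cmod (f z))\<^sup>2"])
    show "integrable lborel (\<lambda>z. (cmod (f z))\<^sup>2)" using assms by (simp add: L2_def)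
    show "AE z in lborel. (\<lambda>n. (cmod (indicator (S n) z *\<^sub>R f z - f z))\<^sup>2) \<longlonglongrightarrow> 0"
    proof (rule AE_I2)
      fix z show "(\<lambda>n. (cmod (indicator (S n) z *\<^sub>R f z - f z))\<^sup>2) \<longlonglongrightarrow> 0"
        by (rule tendsto_eventually) (use ev[of z] in \<open>auto elim!: eventually_mono\<close>)
    qed
    show "AE z in lborel. norm ((cmod (indicator (S n) z *\<^sub>R f z - f z))\<^sup>2) \<le> (cmod (f z))\<^sup>2" for n
      by (auto simp: indicator_def)
  qed auto
  then show ?thesis
    unfolding L2norm_def using tendsto_real_sqrt by fastforce
qed

text \<open>Boxes are an intersection-stable generator of the Borel sets, so a Dynkin argument
  extends the vanishing of the integrals to all Borel sets. Integrability is assumed on boxes only,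
  hence the localisation to the countably many boxes \<open>Q n\<close>.\<close>

lemma AE_zero_if_box_integrals_zero:
  fixes f :: "'a::euclidean_space \<Rightarrow> complex"
  assumes int: "\<And>a b. integrable lborel (\<lambda>z. indicator (box a b) z *\<^sub>R f z)"
    and zero: "\<And>a b. (LINT z|lborel. indicator (box a b) z *\<^sub>R f z) = 0"
  shows "AE z in lborel. f z = 0"
proof -
  define Q :: "nat \<Rightarrow> 'a set" where "Q n = box (- (real n *\<^sub>R One)) (real n *\<^sub>R One)" for n
  have "AE z in lborel. indicator (Q n) z *\<^sub>R f z = 0" for n
  proof (rule sigma_finite_measure.density_zero[OF sigma_finite_lborel])
    let ?g = "\<lambda>z. indicator (Q n) z *\<^sub>R f z"
    show g: "integrable lborel ?g" unfolding Q_def by (rule int)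
    fix A :: "'a set" assume "A \<in> sets lborel"
    then have A: "A \<in> sigma_sets UNIV (range (\<lambda>(a, b). box a b))"
      by (simp add: borel_eq_box)
    have sets: "B \<in> sets lborel" if "B \<in> sigma_sets UNIV (range (\<lambda>(a, b). box a b :: 'a set))" for B
      using that by (simp add: borel_eq_box)
    have "Int_stable (range (\<lambda>(a, b). box a b :: 'a set))"
      by (auto simp: Int_stable_def box_Int_box)
    moreover have "range (\<lambda>(a, b). box a b :: 'a set) \<subseteq> Pow UNIV" by simp
    ultimately show "set_lebesgue_integral lborel A ?g = 0"
      using A
    proof (induction rule: sigma_sets_induct_disjoint)
      case (basic A)
      then obtain a b where "A = box a b" by auto
      then have "A \<inter> Q n \<in> range (\<lambda>(a, b). box a b)"
        unfolding Q_def by (auto simp: box_Int_box)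
      then obtain c d where "A \<inter> Q n = box c d" by auto
      then have "(\<lambda>z. indicator A z *\<^sub>R ?g z) = (\<lambda>z. indicator (box c d) z *\<^sub>R f z)"
        by (metis (no_types, lifting) indicator_inter_arith scaleR_scaleR)
      then show ?case using zero[of c d] unfolding set_lebesgue_integral_def by simp
    next
      case empty
      then show ?case by (simp add: set_lebesgue_integral_def)
    next
      case (compl A)
      have "indicator (UNIV - A) z *\<^sub>R ?g z = ?g z - indicator A z *\<^sub>R ?g z" for z
        by (auto simp: indicator_def)
      then have "set_lebesgue_integral lborel (UNIV - A) ?g = (LINT z|lborel. ?g z) - set_lebesgue_integral lborel A ?g"
        unfolding set_lebesgue_integral_def using g integrable_mult_indicator[OF sets[OF compl(1)] g]
        by simp
      also have "(LINT z|lborel. ?g z) = 0" unfolding Q_def by (rule zero)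
      finally show ?case using compl by simp
    next
      case (union A)
      have "set_lebesgue_integral lborel (\<Union>i. A i) ?g = (\<Sum>i. set_lebesgue_integral lborel (A i) ?g)"
      proof (rule lebesgue_integral_countable_add)
        show "A i \<in> sets lborel" for i using union sets by auto
        show "A i \<inter> A j = {}" if "i \<noteq> j" for i j using union that by (auto simp: disjoint_family_on_def)
        show "set_integrable lborel (\<Union>i. A i) ?g"
          unfolding set_integrable_def using union sets by (intro integrable_mult_indicator g) auto
      qed
      then show ?case using union by simp
    qed
  qed
  then have "AE z in lborel. \<forall>n. indicator (Q n) z *\<^sub>R f z = 0"
    by (subst AE_all_countable) blast
  then show ?thesis
  proof eventually_elim
    case (elim z)
    have "z \<in> (\<Union>n. Q n)" unfolding Q_def UN_box_eq_UNIV by simp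
    then obtain n where "z \<in> Q n" by auto
    with elim[rule_format, of n] show ?case by simp
  qed
qed

lemma L2_eqI_box:
  assumes "L2 f" "L2 g"
    and "\<And>a b. (LINT z|lborel. f z * indicator (box a b) z) = (LINT z|lborel. g z * indicator (box a b) z)"
  shows "AE z in lborel. f z = g z"
proof -
  have ind: "L2 (indicator (box a b) :: 'a \<Rightarrow> complex)" for a b
    by (intro L2_indicator_one) (use emeasure_lborel_box_finite[of a b] in auto)
  have i: "integrable lborel (\<lambda>z. f z * indicator (box a b) z)" "integrable lborel (\<lambda>z. g z * indicator (box a b) z)" for a b
    using L2_mult_bound(1) assms ind by blast+
  have eq: "indicator (box a b) z *\<^sub>R (f z - g z) = f z * indicator (box a b) z - g z * indicator (box a b) z" for a b z
    by (auto simp: indicator_def)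
  have "AE z in lborel. f z - g z = 0"
    by (rule AE_zero_if_box_integrals_zero) (use i assms(3) in \<open>auto simp: eq\<close>)
  then show ?thesis by simp
qed

section \<open>Product measures and measure-preserving maps\<close>

lemma borel_measurable_cis [measurable]: "cis \<in> borel_measurable borel"
  by (intro borel_measurable_continuous_onI continuous_intros)

lemma borel_measurable_fst_borel [measurable]:
    "(fst :: 'a::euclidean_space \<times> 'b::euclidean_space \<Rightarrow> 'a) \<in> borel_measurable borel"
  and borel_measurable_snd_borel [measurable]:
    "(snd :: 'a::euclidean_space \<times> 'b::euclidean_space \<Rightarrow> 'b) \<in> borel_measurable borel"
  by (intro borel_measurable_continuous_onI continuous_intros)+

lemma integrable_lborel_times:
  fixes f :: "'a::euclidean_space \<Rightarrow> complex" and g :: "'b::euclidean_space \<Rightarrow> complex"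
  assumes f: "integrable lborel f" and g: "integrable lborel g"
  shows "integrable lborel (\<lambda>p. f (fst p) * g (snd p))"
proof -
  have [measurable]: "f \<in> borel_measurable borel" "g \<in> borel_measurable borel"
    using borel_measurable_integrable[OF f] borel_measurable_integrable[OF g] by auto
  have "integrable (lborel \<Otimes>\<^sub>M lborel) (\<lambda>p. f (fst p) * g (snd p))"
  proof (rule lborel_pair.Fubini_integrable)
    show "integrable lborel (\<lambda>x. LINT y|lborel. norm (f (fst (x, y)) * g (snd (x, y))))"
      using f by (simp add: norm_mult)
    show "AE x in lborel. integrable lborel (\<lambda>y. f (fst (x, y)) * g (snd (x, y)))"
      using g by simp
  qed simp
  then show ?thesis by (simp add: lborel_prod)
qed

lemma lborel_Fubini:
  fixes F :: "'a::euclidean_space \<times> 'b::euclidean_space \<Rightarrow> 'c::{banach,second_countable_topology}"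
  assumes "integrable lborel F"
  shows "(LINT x|lborel. LINT y|lborel. F (x, y)) = integral\<^sup>L lborel F"
    and "(LINT y|lborel. LINT x|lborel. F (x, y)) = integral\<^sup>L lborel F"
    and "AE x in lborel. integrable lborel (\<lambda>y. F (x, y))"
    and "AE y in lborel. integrable lborel (\<lambda>x. F (x, y))"
    and "integrable lborel (\<lambda>x. LINT y|lborel. F (x, y))"
    and "integrable lborel (\<lambda>y. LINT x|lborel. F (x, y))"
proof -
  have *: "integrable (lborel \<Otimes>\<^sub>M lborel) (case_prod (\<lambda>x y. F (x, y)))"
    using assms by (simp add: lborel_prod)
  show "(LINT x|lborel. LINT y|lborel. F (x, y)) = integral\<^sup>L lborel F"
    using lborel_pair.integral_fst[OF *] by (simp add: lborel_prod)
  show "(LINT y|lborel. LINT x|lborel. F (x, y)) = integral\<^sup>L lborel F"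
    using lborel_pair.integral_snd[OF *] by (simp add: lborel_prod)
  show "AE x in lborel. integrable lborel (\<lambda>y. F (x, y))"
    using lborel_pair.AE_integrable_fst[OF *] .
  show "AE y in lborel. integrable lborel (\<lambda>x. F (x, y))"
    using lborel_pair.AE_integrable_snd[OF *] .
  show "integrable lborel (\<lambda>x. LINT y|lborel. F (x, y))"
    using lborel_pair.integrable_fst[OF *] .
  show "integrable lborel (\<lambda>y. LINT x|lborel. F (x, y))"
    using lborel_pair.integrable_snd[OF *] .
qed

lemma lborel_nn_Fubini:
  fixes F :: "'a::euclidean_space \<times> 'b::euclidean_space \<Rightarrow> ennreal"
  assumes "F \<in> borel_measurable borel"
  shows "(\<integral>\<^sup>+x. \<integral>\<^sup>+y. F (x, y) \<partial>lborel \<partial>lborel) = integral\<^sup>N lborel F"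
    and "(\<integral>\<^sup>+y. \<integral>\<^sup>+x. F (x, y) \<partial>lborel \<partial>lborel) = integral\<^sup>N lborel F"
proof -
  have *: "F \<in> borel_measurable (lborel \<Otimes>\<^sub>M lborel)" using assms by (simp add: lborel_prod)
  show "(\<integral>\<^sup>+x. \<integral>\<^sup>+y. F (x, y) \<partial>lborel \<partial>lborel) = integral\<^sup>N lborel F"
    using lborel.nn_integral_fst[OF *] by (simp add: lborel_prod)
  show "(\<integral>\<^sup>+y. \<integral>\<^sup>+x. F (x, y) \<partial>lborel \<partial>lborel) = integral\<^sup>N lborel F"
    using lborel_pair.nn_integral_snd[of F] * by (simp add: lborel_prod)
qed

section \<open>Measure-preserving changes of variables\<close>

definition measure_preserving_lborel :: "('a::euclidean_space \<Rightarrow> 'b::euclidean_space) \<Rightarrow> bool" where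
  "measure_preserving_lborel T \<longleftrightarrow> T \<in> borel_measurable borel \<and> distr lborel borel T = lborel"

context
  fixes T :: "'a::euclidean_space \<Rightarrow> 'b::euclidean_space"
  assumes T: "measure_preserving_lborel T"
begin

lemma mp_measurable: "T \<in> borel_measurable borel"
  using T by (simp add: measure_preserving_lborel_def)

lemma mp_distr: "distr lborel borel T = lborel"
  using T by (simp add: measure_preserving_lborel_def)

lemma mp_nn_integral: "f \<in> borel_measurable borel \<Longrightarrow> (\<integral>\<^sup>+x. f (T x) \<partial>lborel) = (\<integral>\<^sup>+x. f x \<partial>lborel)"
  using mp_measurable by (subst mp_distr[symmetric]) (simp add: nn_integral_distr)

lemma mp_integral:
  fixes f :: "'b \<Rightarrow> 'c::{banach,second_countable_topology}"
  shows "f \<in> borel_measurable borel \<Longrightarrow> (LINT x|lborel. f (T x)) = integral\<^sup>L lborel f"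
  using mp_measurable by (subst mp_distr[symmetric]) (simp add: integral_distr)

lemma mp_integrable:
  fixes f :: "'b \<Rightarrow> 'c::{banach,second_countable_topology}"
  shows "f \<in> borel_measurable borel \<Longrightarrow> integrable lborel (\<lambda>x. f (T x)) \<longleftrightarrow> integrable lborel f"
  using mp_measurable by (subst mp_distr[symmetric]) (simp add: integrable_distr_eq)

lemma mp_AE: "Measurable.pred borel P \<Longrightarrow> (AE x in lborel. P (T x)) \<longleftrightarrow> (AE x in lborel. P x)"
  using mp_measurable by (subst mp_distr[symmetric]) (simp add: AE_distr_iff)

text \<open>In contrast to \<open>mp_AE\<close>, the predicate may be non-measurable; the
  exceptional set is enlarged to a Borel null set before it is pulled back.\<close>

lemma mp_AE_dest:
  assumes "AE x in lborel. P x" shows "AE x in lborel. P (T x)"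
proof -
  obtain N where N: "{x. \<not> P x} \<subseteq> N" "N \<in> sets borel" "emeasure lborel N = 0"
    using AE_E[OF assms] by auto
  then have "AE x in lborel. x \<notin> N" by (intro AE_not_in) auto
  then have "AE x in lborel. T x \<notin> N" using N(2) by (subst mp_AE) auto
  then show ?thesis using N(1) by (auto elim!: eventually_mono)
qed

lemma mp_L2:
  assumes "L2 f" shows "L2 (\<lambda>x. f (T x))"
proof -
  have [measurable]: "f \<in> borel_measurable borel" using assms by auto
  show ?thesis
    using assms measurable_compose[OF mp_measurable, of f borel] mp_nn_integral[of "\<lambda>x. ennreal ((cmod (f x))\<^sup>2)"]
    by (simp add: L2_iff_nn_integral)
qed

lemma mp_L2norm: "f \<in> borel_measurable borel \<Longrightarrow> L2norm (\<lambda>x. f (T x)) = L2norm f"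
  unfolding L2norm_def by (subst mp_integral) auto

end

section \<open>The Fourier transform of integrable functions\<close>

text \<open>Lebesgue measure is the image of a product measure indexed by the basis, so separable
  integrands factor. This reduces Gaussian integrals to the normal law on the line.\<close>

lemma lborel_prod_Basis:
  fixes f :: "'a::euclidean_space \<Rightarrow> real \<Rightarrow> complex"
  assumes f: "\<And>b. b \<in> Basis \<Longrightarrow> integrable lborel (f b)"
  shows "(LINT x|lborel. (\<Prod>b\<in>Basis. f b (x \<bullet> b))) = (\<Prod>b\<in>Basis. (LINT x|lborel. f b x))"
    and "integrable lborel (\<lambda>x. \<Prod>b\<in>Basis. f b (x \<bullet> b))"
proof -
  interpret product_sigma_finite "\<lambda>_::'a. lborel :: real measure" ..
  have [measurable]: "f b \<in> borel_measurable borel" if "b \<in> Basis" for b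
    using borel_measurable_integrable[OF f[OF that]] by simp
  have eq: "(\<Prod>b\<in>Basis. f b ((\<Sum>c\<in>Basis. x c *\<^sub>R c) \<bullet> b)) = (\<Prod>b\<in>Basis. f b (x b))" for x :: "'a \<Rightarrow> real"
    by (intro prod.cong refl) simp
  show "(LINT x|lborel. (\<Prod>b\<in>Basis. f b (x \<bullet> b))) = (\<Prod>b\<in>Basis. (LINT x|lborel. f b x))"
    by (subst lborel_eq) (simp add: integral_distr eq product_integral_prod f)
  show "integrable lborel (\<lambda>x. \<Prod>b\<in>Basis. f b (x \<bullet> b))"
    by (subst lborel_eq) (simp add: integrable_distr_eq eq product_integrable_prod f)
qed

section \<open>Gaussians and their Fourier transforms\<close>

lemma norm_power2_Basis: "(norm (x::'a::euclidean_space))\<^sup>2 = (\<Sum>b\<in>Basis. (x \<bullet> b)\<^sup>2)"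
  by (metis (no_types, lifting) euclidean_inner power2_eq_square power2_norm_eq_inner sum.cong)

text \<open>The product form lets its properties be read off the standard normal law on the line;
  \<open>gauss_eq\<close> recovers the radial form.\<close>

definition gauss :: "'a::euclidean_space \<Rightarrow> real" where
  "gauss x = (\<Prod>b\<in>Basis. std_normal_density (x \<bullet> b))"

lemma gauss_nonneg: "gauss x \<ge> 0"
  unfolding gauss_def by (intro prod_nonneg) auto

lemma gauss_eq: "gauss (x::'a::euclidean_space) = (2 * pi) powr (- real DIM('a) / 2) * exp (- (norm x)\<^sup>2 / 2)"
proof -
  have "exp (- (norm x)\<^sup>2 / 2) = (\<Prod>b\<in>Basis. exp (- (x \<bullet> b)\<^sup>2 / 2))"
    by (simp add: norm_power2_Basis exp_sum[symmetric] sum_negf sum_divide_distrib)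
  moreover have "(2 * pi) powr (- real DIM('a) / 2) = (1 / sqrt (2 * pi)) ^ DIM('a)"
  proof -
    have "1 / sqrt (2 * pi) = (2 * pi) powr (- (1/2))"
      by (simp only: powr_minus_divide powr_half_sqrt pi_ge_zero mult_nonneg_nonneg zero_le_numeral)
    then have "(1 / sqrt (2 * pi)) ^ DIM('a) = ((2 * pi) powr (- (1/2))) powr real DIM('a)"
      by (simp only: powr_realpow) (simp add: powr_realpow)
    also have "\<dots> = (2 * pi) powr (- (1/2) * real DIM('a))"
      by (rule powr_powr)
    finally show ?thesis by simp
  qed
  ultimately show ?thesis
    by (simp add: gauss_def std_normal_density_def prod_dividef power_divide)
qed

lemma gauss_measurable [measurable]: "gauss \<in> borel_measurable borel"
  unfolding gauss_def by measurable

lemma integrable_gauss: "integrable lborel (gauss :: 'a::euclidean_space \<Rightarrow> real)"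
  and integral_gauss: "(LINT x|lborel. gauss (x::'a)) = 1"
proof -
  have i: "integrable lborel (\<lambda>x. complex_of_real (std_normal_density x))" by auto
  have "integrable lborel (\<lambda>x::'a. complex_of_real (gauss x))"
    using lborel_prod_Basis(2)[of "\<lambda>_::'a. \<lambda>x. complex_of_real (std_normal_density x)"] i
    by (simp add: gauss_def)
  then show "integrable lborel (gauss :: 'a \<Rightarrow> real)"
    by (simp add: complex_of_real_integrable_eq)
  have "(LINT x|lborel. complex_of_real (gauss (x::'a))) = (\<Prod>b\<in>(Basis::'a set). complex_of_real (LINT x|lborel. std_normal_density x))"
    using lborel_prod_Basis(1)[of "\<lambda>_::'a. \<lambda>x. complex_of_real (std_normal_density x)"] i
    by (simp add: gauss_def)
  then show "(LINT x|lborel. gauss (x::'a)) = 1"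
    by simp
qed

text \<open>Each coordinate contributes one factor, the characteristic function of the standard
  normal law.\<close>

lemma fourier_gauss:
  "(LINT x|lborel. complex_of_real (gauss (x::'a::euclidean_space)) * cis (\<xi> \<bullet> x)) = complex_of_real (exp (- (norm \<xi>)\<^sup>2 / 2))"
proof -
  define f where "f b x = complex_of_real (std_normal_density x) * cis ((\<xi> \<bullet> b) * x)" for b :: 'a and x
  have i: "integrable lborel (f b)" for b
  proof (rule Bochner_Integration.integrable_bound)
    show "integrable lborel std_normal_density" by auto
    show "f b \<in> borel_measurable lborel" unfolding f_def by simp
  qed (auto simp: f_def norm_mult)
  have 1: "(LINT x|lborel. f b x) = complex_of_real (exp (- (\<xi> \<bullet> b)\<^sup>2 / 2))" for b
  proof -
    have "(LINT x|lborel. f b x) = char std_normal_distribution (\<xi> \<bullet> b)"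
      unfolding char_def f_def
      by (subst integral_density) (auto simp: cis_conv_exp scaleR_conv_of_real mult_ac)
    then show ?thesis by (simp add: char_std_normal_distribution)
  qed
  have "cis (\<xi> \<bullet> x) = (\<Prod>b\<in>Basis. cis ((\<xi> \<bullet> b) * (x \<bullet> b)))" for x
    by (simp add: cis_conv_exp exp_sum[symmetric] euclidean_inner[of \<xi> x] sum_distrib_left)
  then have "complex_of_real (gauss x) * cis (\<xi> \<bullet> x) = (\<Prod>b\<in>Basis. f b (x \<bullet> b))" for x
    by (simp add: gauss_def f_def prod.distrib)
  then have "(LINT x|lborel. complex_of_real (gauss x) * cis (\<xi> \<bullet> x)) = (\<Prod>b\<in>Basis. complex_of_real (exp (- (\<xi> \<bullet> b)\<^sup>2 / 2)))"
    using lborel_prod_Basis(1)[of f] i by (simp add: 1)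
  also have "\<dots> = complex_of_real (exp (\<Sum>b\<in>Basis. - (\<xi> \<bullet> b)\<^sup>2 / 2))"
    by (simp add: exp_sum)
  also have "(\<Sum>b\<in>Basis. - (\<xi> \<bullet> b)\<^sup>2 / 2) = - (norm \<xi>)\<^sup>2 / 2"
    by (simp add: norm_power2_Basis sum_negf flip: sum_divide_distrib)
  finally show ?thesis .
qed

lemma lborel_integral_affine:
  fixes f :: "'a::euclidean_space \<Rightarrow> 'b::{banach,second_countable_topology}"
  assumes "c > 0" "f \<in> borel_measurable borel"
  shows "(LINT y|lborel. f y) = c ^ DIM('a) *\<^sub>R (LINT v|lborel. f (t + c *\<^sub>R v))"
    and "integrable lborel f \<longleftrightarrow> integrable lborel (\<lambda>v. f (t + c *\<^sub>R v))"
proof -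
  let ?M = "density (distr lborel borel (\<lambda>x::'a. t + c *\<^sub>R x)) (\<lambda>_. ennreal (\<bar>c\<bar> ^ DIM('a)))"
  have M: "lborel = ?M" using assms by (intro lborel_affine) simp
  have "(LINT y|?M. f y) = c ^ DIM('a) *\<^sub>R (LINT v|lborel. f (t + c *\<^sub>R v))"
    using assms by (simp add: integral_density integral_distr)
  then show "(LINT y|lborel. f y) = c ^ DIM('a) *\<^sub>R (LINT v|lborel. f (t + c *\<^sub>R v))"
    unfolding M[symmetric] .
  have "integrable ?M f \<longleftrightarrow> integrable lborel (\<lambda>v. c ^ DIM('a) *\<^sub>R f (t + c *\<^sub>R v))"
    using assms by (simp add: integrable_density integrable_distr_eq)
  also have "\<dots> \<longleftrightarrow> integrable lborel (\<lambda>v. f (t + c *\<^sub>R v))"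
    using assms integrable_scaleR_right[of "c ^ DIM('a)" lborel "\<lambda>v. f (t + c *\<^sub>R v)"]
      integrable_scaleR_right[of "1 / c ^ DIM('a)" lborel "\<lambda>v. c ^ DIM('a) *\<^sub>R f (t + c *\<^sub>R v)"] by auto
  finally have "integrable ?M f \<longleftrightarrow> integrable lborel (\<lambda>v. f (t + c *\<^sub>R v))" .
  then show "integrable lborel f \<longleftrightarrow> integrable lborel (\<lambda>v. f (t + c *\<^sub>R v))"
    unfolding M[symmetric] .
qed

lemma lborel_nn_integral_affine:
  fixes f :: "'a::euclidean_space \<Rightarrow> ennreal"
  assumes "c > 0" "f \<in> borel_measurable borel"
  shows "(\<integral>\<^sup>+y. f y \<partial>lborel) = ennreal (c ^ DIM('a)) * (\<integral>\<^sup>+v. f (t + c *\<^sub>R v) \<partial>lborel)"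
proof -
  let ?M = "density (distr lborel borel (\<lambda>x::'a. t + c *\<^sub>R x)) (\<lambda>_. ennreal (\<bar>c\<bar> ^ DIM('a)))"
  have M: "lborel = ?M" using assms by (intro lborel_affine) simp
  have "(\<integral>\<^sup>+y. f y \<partial>?M) = ennreal (c ^ DIM('a)) * (\<integral>\<^sup>+v. f (t + c *\<^sub>R v) \<partial>lborel)"
    using assms by (simp add: nn_integral_density nn_integral_distr nn_integral_cmult)
  then show ?thesis unfolding M[symmetric] .
qed

text \<open>The density of the centred normal law with standard deviation \<open>1 / k\<close>: an
  approximate identity as \<open>k\<close> grows.\<close>

definition gauss_kernel :: "real \<Rightarrow> 'a::euclidean_space \<Rightarrow> real" where
  "gauss_kernel k v = k ^ DIM('a) * gauss (k *\<^sub>R v)"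

lemma gauss_kernel_measurable [measurable]: "gauss_kernel k \<in> borel_measurable borel"
  unfolding gauss_kernel_def by measurable

lemma gauss_kernel_nonneg: "k > 0 \<Longrightarrow> gauss_kernel k v \<ge> 0"
  by (simp add: gauss_kernel_def gauss_nonneg)

lemma gauss_kernel_commute: "gauss_kernel k (x - y) = gauss_kernel k (y - x)"
  by (simp add: gauss_kernel_def gauss_eq norm_minus_commute)

text \<open>Rescaling by \<open>k\<close> turns the damping factor into a multiple of
  \<open>gauss\<close>, whose transform is known. Damping at scale \<open>k\<close> in frequency is
  thus smoothing at scale \<open>1 / k\<close> in space.\<close>

lemma fourier_exp:
  fixes v :: "'a::euclidean_space"
  assumes k: "k > 0"
  shows "(LINT \<xi>|lborel. complex_of_real (exp (- (norm \<xi>)\<^sup>2 / (2 * k\<^sup>2))) * cis (\<xi> \<bullet> v))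
    = complex_of_real ((2 * pi) powr real DIM('a) * gauss_kernel k v)"
    and "integrable lborel (\<lambda>\<xi>::'a. exp (- (norm \<xi>)\<^sup>2 / (2 * k\<^sup>2)))"
proof -
  let ?c = "(2 * pi) powr (real DIM('a) / 2)"
  have g: "exp (- (norm \<xi>)\<^sup>2 / 2) = ?c * gauss \<xi>" for \<xi> :: 'a
    by (simp add: gauss_eq powr_add[symmetric] mult.assoc[symmetric])
  have e: "exp (- (norm (0 + k *\<^sub>R \<xi>))\<^sup>2 / (2 * k\<^sup>2)) = ?c * gauss \<xi>" for \<xi> :: 'a
    using k by (simp add: power_mult_distrib g[symmetric])
  show "integrable lborel (\<lambda>\<xi>::'a. exp (- (norm \<xi>)\<^sup>2 / (2 * k\<^sup>2)))"
    using integrable_gauss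
    by (subst lborel_integral_affine(2)[OF k, of _ 0]) (simp_all only: e, simp_all)
  have "(LINT \<xi>|lborel. complex_of_real (exp (- (norm \<xi>)\<^sup>2 / (2 * k\<^sup>2))) * cis (\<xi> \<bullet> v))
    = k ^ DIM('a) *\<^sub>R (LINT \<xi>|lborel. complex_of_real (?c * gauss \<xi>) * cis ((k *\<^sub>R v) \<bullet> \<xi>))"
    by (subst lborel_integral_affine(1)[OF k, of _ 0]) (simp_all only: e, simp_all add: inner_commute)
  also have "\<dots> = k ^ DIM('a) *\<^sub>R (?c *\<^sub>R (LINT \<xi>|lborel. complex_of_real (gauss \<xi>) * cis ((k *\<^sub>R v) \<bullet> \<xi>)))"
    by (simp add: mult.assoc scaleR_conv_of_real)
  also have "\<dots> = complex_of_real (k ^ DIM('a) * ?c * exp (- (norm (k *\<^sub>R v))\<^sup>2 / 2))"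
    by (subst fourier_gauss) (simp add: scaleR_conv_of_real)
  also have "k ^ DIM('a) * ?c * exp (- (norm (k *\<^sub>R v))\<^sup>2 / 2) = (?c * ?c) * gauss_kernel k v"
    unfolding g gauss_kernel_def by simp
  also have "?c * ?c = (2 * pi) powr real DIM('a)"
    by (simp add: powr_add[symmetric])
  finally show "(LINT \<xi>|lborel. complex_of_real (exp (- (norm \<xi>)\<^sup>2 / (2 * k\<^sup>2))) * cis (\<xi> \<bullet> v))
    = complex_of_real ((2 * pi) powr real DIM('a) * gauss_kernel k v)" .
qed

section \<open>Plancherel's inequality and Parseval's identity by Gaussian damping\<close>

definition fourier :: "('a::euclidean_space \<Rightarrow> complex) \<Rightarrow> 'a \<Rightarrow> complex" where
  "fourier f \<xi> = complex_of_real ((2 * pi) powr (- real DIM('a) / 2)) *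
     (LINT y|lborel. cis (- (\<xi> \<bullet> y)) * f y)"

lemma fourier_measurable [measurable]:
  assumes [measurable]: "f \<in> borel_measurable borel"
  shows "fourier f \<in> borel_measurable borel"
  unfolding fourier_def by measurable

lemma fourier_duality:
  fixes f h :: "'a::euclidean_space \<Rightarrow> complex"
  assumes f: "integrable lborel f" and h: "integrable lborel h"
  shows "(LINT \<xi>|lborel. fourier f \<xi> * h \<xi>) = (LINT y|lborel. f y * fourier h y)"
proof -
  have [measurable]: "f \<in> borel_measurable borel" "h \<in> borel_measurable borel"
    using borel_measurable_integrable[OF f] borel_measurable_integrable[OF h] by auto
  let ?F = "\<lambda>p. cis (- (fst p \<bullet> snd p)) * (h (fst p) * f (snd p))"
  have i: "integrable lborel ?F"
    by (rule Bochner_Integration.integrable_bound[OF integrable_lborel_times[OF h f]]) (auto simp: norm_mult)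
  let ?c = "complex_of_real ((2 * pi) powr (- real DIM('a) / 2))"
  have "(LINT \<xi>|lborel. fourier f \<xi> * h \<xi>) = ?c * (LINT \<xi>|lborel. LINT y|lborel. ?F (\<xi>, y))"
    by (simp add: fourier_def mult_ac flip: integral_mult_right_zero integral_mult_left_zero)
  also have "\<dots> = ?c * (LINT y|lborel. LINT \<xi>|lborel. ?F (\<xi>, y))"
    using lborel_Fubini(1,2)[OF i] by simp
  also have "\<dots> = (LINT y|lborel. f y * fourier h y)"
    by (simp add: fourier_def mult_ac inner_commute flip: integral_mult_right_zero integral_mult_left_zero)
  finally show ?thesis .
qed

text \<open>The Gaussian factor makes the integrand absolutely integrable in the frequency and both
  space variables together, so Fubini's theorem applies, and the frequency integral produces the
  kernel. The L2 bound and the Parseval identity below are limits of this formula.\<close>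

lemma fourier_regularized:
  fixes f h :: "'a::euclidean_space \<Rightarrow> complex"
  assumes f: "integrable lborel f" and h: "integrable lborel h" and k: "k > 0"
  defines "K \<equiv> \<lambda>p. f (fst p) * cnj (h (snd p)) * complex_of_real (gauss_kernel k (snd p - fst p))"
  shows "(LINT \<xi>|lborel. complex_of_real (exp (- (norm \<xi>)\<^sup>2 / (2 * k\<^sup>2))) * (fourier f \<xi> * cnj (fourier h \<xi>)))
      = integral\<^sup>L lborel K" (is ?eq)
    and "integrable lborel K" (is ?int)
proof -
  have [measurable]: "f \<in> borel_measurable borel" "h \<in> borel_measurable borel"
    using borel_measurable_integrable[OF f] borel_measurable_integrable[OF h] by auto
  define e where "e \<xi> = complex_of_real (exp (- (norm \<xi>)\<^sup>2 / (2 * k\<^sup>2)))" for \<xi> :: 'a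
  have [measurable]: "e \<in> borel_measurable borel" unfolding e_def by measurable
  have ie: "integrable lborel e" unfolding e_def using fourier_exp(2)[OF k] by auto
  have ch: "integrable lborel (\<lambda>y. cnj (h y))" using h by simp
  define c where "c = (2 * pi) powr (- real DIM('a) / 2)"
  \<comment> \<open>The normalising factors of the two transforms cancel the power of
    \<open>2 * pi\<close> from \<open>fourier_exp\<close>.\<close>
  have c: "c * c * (2 * pi) powr real DIM('a) = 1"
    unfolding c_def by (simp flip: powr_add)
  let ?fh = "\<lambda>p. f (fst p) * cnj (h (snd p))"
  have ifh: "integrable lborel ?fh" using integrable_lborel_times[OF f ch] .
  let ?G = "\<lambda>q. cis (fst q \<bullet> (snd (snd q) - fst (snd q))) * (e (fst q) * ?fh (snd q))"
  have iG: "integrable lborel ?G"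
    by (rule Bochner_Integration.integrable_bound[OF integrable_lborel_times[OF ie ifh]]) (auto simp: norm_mult)
  have prod: "fourier f \<xi> * cnj (fourier h \<xi>) = c * c * (LINT p|lborel. cis (\<xi> \<bullet> (snd p - fst p)) * ?fh p)" for \<xi>
  proof -
    have i1: "integrable lborel (\<lambda>x. cis (- (\<xi> \<bullet> x)) * f x)" "integrable lborel (\<lambda>y. cis (\<xi> \<bullet> y) * cnj (h y))"
      by (rule Bochner_Integration.integrable_bound[OF f]; simp add: norm_mult)
         (rule Bochner_Integration.integrable_bound[OF ch]; simp add: norm_mult)
    have cn: "cnj (fourier h \<xi>) = c * (LINT y|lborel. cis (\<xi> \<bullet> y) * cnj (h y))"
      unfolding fourier_def c_def by (simp add: cis_cnj flip: Bochner_Integration.integral_cnj)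
    have "(LINT x|lborel. cis (- (\<xi> \<bullet> x)) * f x) * (LINT y|lborel. cis (\<xi> \<bullet> y) * cnj (h y))
      = (LINT x|lborel. LINT y|lborel. (cis (- (\<xi> \<bullet> x)) * f x) * (cis (\<xi> \<bullet> y) * cnj (h y)))"
      by simp
    also have "\<dots> = (LINT p|lborel. (cis (- (\<xi> \<bullet> fst p)) * f (fst p)) * (cis (\<xi> \<bullet> snd p) * cnj (h (snd p))))"
      using lborel_Fubini(1)[OF integrable_lborel_times[OF i1]] by simp
    also have "\<dots> = (LINT p|lborel. cis (\<xi> \<bullet> (snd p - fst p)) * ?fh p)"
    proof (intro Bochner_Integration.integral_cong refl)
      fix p :: "'a \<times> 'a"
      have "cis (- (\<xi> \<bullet> fst p)) * cis (\<xi> \<bullet> snd p) = cis (\<xi> \<bullet> (snd p - fst p))"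
        by (simp add: cis_mult inner_diff_right)
      then show "(cis (- (\<xi> \<bullet> fst p)) * f (fst p)) * (cis (\<xi> \<bullet> snd p) * cnj (h (snd p))) = cis (\<xi> \<bullet> (snd p - fst p)) * ?fh p"
        by (metis (no_types, opaque_lifting) mult.assoc mult.commute)
    qed
    finally have *: "(LINT x|lborel. cis (- (\<xi> \<bullet> x)) * f x) * (LINT y|lborel. cis (\<xi> \<bullet> y) * cnj (h y))
      = (LINT p|lborel. cis (\<xi> \<bullet> (snd p - fst p)) * ?fh p)" .
    show ?thesis unfolding *[symmetric] cn by (simp add: fourier_def c_def)
  qed
  have inner: "(LINT \<xi>|lborel. ?G (\<xi>, p)) = (2 * pi) powr real DIM('a) * K p" for p
  proof -
    have "(LINT \<xi>|lborel. ?G (\<xi>, p)) = ?fh p * (LINT \<xi>|lborel. e \<xi> * cis (\<xi> \<bullet> (snd p - fst p)))"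
      by (simp add: mult_ac flip: integral_mult_right_zero)
    then show ?thesis
      unfolding e_def fourier_exp(1)[OF k] by (simp add: K_def)
  qed
  have "integrable lborel (\<lambda>p. complex_of_real ((2 * pi) powr real DIM('a)) * K p)"
    using lborel_Fubini(6)[OF iG] unfolding inner by simp
  then have "integrable lborel (\<lambda>p. complex_of_real (c * c) * (complex_of_real ((2 * pi) powr real DIM('a)) * K p))"
    by (rule integrable_mult_right)
  also have "(\<lambda>p. complex_of_real (c * c) * (complex_of_real ((2 * pi) powr real DIM('a)) * K p)) = K"
    unfolding mult.assoc[symmetric] of_real_mult[symmetric] c by simp
  finally show ?int .
  have "(LINT \<xi>|lborel. e \<xi> * (fourier f \<xi> * cnj (fourier h \<xi>)))
      = c * c * (LINT \<xi>|lborel. LINT p|lborel. ?G (\<xi>, p))"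
    unfolding prod by (simp add: mult_ac flip: integral_mult_right_zero)
  also have "\<dots> = c * c * (LINT p|lborel. LINT \<xi>|lborel. ?G (\<xi>, p))"
    using lborel_Fubini(1,2)[OF iG] by simp
  also have "\<dots> = complex_of_real (c * c * (2 * pi) powr real DIM('a)) * integral\<^sup>L lborel K"
    unfolding inner by simp
  finally show ?eq unfolding c e_def by simp
qed

lemma nn_integral_gauss_kernel:
  assumes k: "k > 0"
  shows "(\<integral>\<^sup>+y. ennreal (gauss_kernel k (y - x)) \<partial>lborel) = 1"
    and "(\<integral>\<^sup>+y. ennreal (gauss_kernel k (x - y)) \<partial>lborel) = 1"
proof -
  have "(\<integral>\<^sup>+y. ennreal (gauss_kernel k (y - x)) \<partial>lborel)
    = ennreal ((1/k) ^ DIM('a)) * (\<integral>\<^sup>+v. ennreal (k ^ DIM('a)) * ennreal (gauss (v::'a)) \<partial>lborel)"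
    using k by (subst lborel_nn_integral_affine[of "1/k" _ x])
      (auto simp: gauss_kernel_def ennreal_mult gauss_nonneg)
  also have "\<dots> = ennreal ((1/k) ^ DIM('a)) * ennreal (k ^ DIM('a)) * (\<integral>\<^sup>+v. ennreal (gauss (v::'a)) \<partial>lborel)"
    by (simp add: nn_integral_cmult mult.assoc)
  also have "(\<integral>\<^sup>+v. ennreal (gauss (v::'a)) \<partial>lborel) = 1"
    by (subst nn_integral_eq_integral) (auto simp: integrable_gauss integral_gauss gauss_nonneg)
  also have "ennreal ((1/k) ^ DIM('a)) * ennreal (k ^ DIM('a)) = 1"
    using k by (simp flip: ennreal_mult power_mult_distrib)
  finally show 1: "(\<integral>\<^sup>+y. ennreal (gauss_kernel k (y - x)) \<partial>lborel) = 1" by simp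
  show "(\<integral>\<^sup>+y. ennreal (gauss_kernel k (x - y)) \<partial>lborel) = 1"
    by (subst gauss_kernel_commute) (rule 1)
qed

lemma fourier_bounded:
  fixes f :: "'a::euclidean_space \<Rightarrow> complex"
  shows "cmod (fourier f \<xi>) \<le> (2 * pi) powr (- real DIM('a) / 2) * (LINT x|lborel. cmod (f x))"
  using integral_norm_bound[of lborel "\<lambda>y. cis (- (\<xi> \<bullet> y)) * f y"]
  by (simp add: fourier_def norm_mult mult_left_mono)

lemma exp_gauss_tendsto_1: "(\<lambda>n. exp (- a / (2 * (real (Suc n))\<^sup>2))) \<longlonglongrightarrow> 1"
proof -
  have "(\<lambda>n. exp (- a / 2 * (inverse (real (Suc n)))\<^sup>2)) \<longlonglongrightarrow> exp (- a / 2 * 0\<^sup>2)"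
    by (intro tendsto_intros LIMSEQ_inverse_real_of_nat)
  moreover have eq: "- a / 2 * (inverse (real (Suc n)))\<^sup>2 = - a / (2 * (real (Suc n))\<^sup>2)" for n
    by (simp only: power_inverse divide_inverse inverse_mult_distrib mult.assoc)
  ultimately show ?thesis by (simp only: eq exp_zero power2_eq_square mult_zero_right mult_zero_left)
qed

text \<open>Splitting |f(x) f(y)| into half the sum of the squares leaves a kernel of total mass 1
  in either variable, which bounds the damped norm uniformly; Fatou's lemma removes the damping.
  Equality is obtained later, for the partial transform, from inversion.\<close>

lemma fourier_L2_le:
  fixes f :: "'a::euclidean_space \<Rightarrow> complex"
  assumes f: "integrable lborel f" and L2: "L2 f"
  shows "L2 (fourier f)" "L2norm (fourier f) \<le> L2norm f"
proof -
  have [measurable]: "f \<in> borel_measurable borel" using L2 by auto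
  define e where "e n \<xi> = exp (- (norm \<xi>)\<^sup>2 / (2 * (real (Suc n))\<^sup>2))" for n and \<xi> :: 'a
  have [measurable]: "e n \<in> borel_measurable borel" for n unfolding e_def by measurable
  have e_lim: "(\<lambda>n. e n \<xi>) \<longlonglongrightarrow> 1" for \<xi>
    unfolding e_def by (rule exp_gauss_tendsto_1)
  have est: "(\<integral>\<^sup>+\<xi>. ennreal (e n \<xi> * (cmod (fourier f \<xi>))\<^sup>2) \<partial>lborel) \<le> ennreal ((L2norm f)\<^sup>2)" for n
  proof -
    define k where "k = real (Suc n)"
    have k: "k > 0" by (simp add: k_def)
    define B where "B = (2 * pi) powr (- real DIM('a) / 2) * (LINT x|lborel. cmod (f x))"
    have B: "cmod (fourier f \<xi>) \<le> B" for \<xi> unfolding B_def by (rule fourier_bounded)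
    have ie: "integrable lborel (e n)"
      using fourier_exp(2)[OF k] by (simp add: e_def[abs_def] k_def)
    have i: "integrable lborel (\<lambda>\<xi>. e n \<xi> * (cmod (fourier f \<xi>))\<^sup>2)"
    proof (rule Bochner_Integration.integrable_bound)
      show "integrable lborel (\<lambda>\<xi>. e n \<xi> * B\<^sup>2)" using ie by simp
      show "AE \<xi> in lborel. norm (e n \<xi> * (cmod (fourier f \<xi>))\<^sup>2) \<le> norm (e n \<xi> * B\<^sup>2)"
        using B by (auto simp: abs_mult intro!: mult_left_mono power_mono)
    qed measurable
    let ?K = "\<lambda>p. f (fst p) * cnj (f (snd p)) * complex_of_real (gauss_kernel k (snd p - fst p))"
    have "complex_of_real (LINT \<xi>|lborel. e n \<xi> * (cmod (fourier f \<xi>))\<^sup>2) = integral\<^sup>L lborel ?K"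
      unfolding fourier_regularized(1)[OF f f k, symmetric]
      by (simp add: complex_norm_square[symmetric] k_def e_def flip: integral_complex_of_real)
    then have "(LINT \<xi>|lborel. e n \<xi> * (cmod (fourier f \<xi>))\<^sup>2) \<le> cmod (integral\<^sup>L lborel ?K)"
      by (metis abs_ge_self norm_of_real)
    also have "\<dots> \<le> (LINT p|lborel. cmod (?K p))"
      by (rule integral_norm_bound)
    finally have "(\<integral>\<^sup>+\<xi>. ennreal (e n \<xi> * (cmod (fourier f \<xi>))\<^sup>2) \<partial>lborel) \<le> ennreal (LINT p|lborel. cmod (?K p))"
      using i by (subst nn_integral_eq_integral) (auto simp: e_def intro!: ennreal_leI)
    also have "\<dots> = (\<integral>\<^sup>+p. ennreal (cmod (?K p)) \<partial>lborel)"
      using fourier_regularized(2)[OF f f k] by (subst nn_integral_eq_integral) auto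
    also have "\<dots> \<le> (\<integral>\<^sup>+p. ennreal ((cmod (f (fst p)))\<^sup>2 / 2) * ennreal (gauss_kernel k (snd p - fst p))
        + ennreal ((cmod (f (snd p)))\<^sup>2 / 2) * ennreal (gauss_kernel k (snd p - fst p)) \<partial>lborel)"
    proof (rule nn_integral_mono)
      fix p :: "'a \<times> 'a"
      have "cmod (f (fst p)) * cmod (f (snd p)) \<le> (cmod (f (fst p)))\<^sup>2 / 2 + (cmod (f (snd p)))\<^sup>2 / 2"
        using zero_le_power2[of "cmod (f (fst p)) - cmod (f (snd p))"] by (simp add: power2_diff)
      then have "cmod (?K p) \<le> ((cmod (f (fst p)))\<^sup>2 / 2 + (cmod (f (snd p)))\<^sup>2 / 2) * gauss_kernel k (snd p - fst p)"
        using k by (simp add: norm_mult gauss_kernel_nonneg mult_right_mono)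
      then show "ennreal (cmod (?K p)) \<le> ennreal ((cmod (f (fst p)))\<^sup>2 / 2) * ennreal (gauss_kernel k (snd p - fst p))
        + ennreal ((cmod (f (snd p)))\<^sup>2 / 2) * ennreal (gauss_kernel k (snd p - fst p))"
        using k by (simp add: gauss_kernel_nonneg distrib_right flip: ennreal_mult ennreal_plus)
    qed
    also have "\<dots> = (\<integral>\<^sup>+p. ennreal ((cmod (f (fst p)))\<^sup>2 / 2) * ennreal (gauss_kernel k (snd p - fst p)) \<partial>lborel)
        + (\<integral>\<^sup>+p. ennreal ((cmod (f (snd p)))\<^sup>2 / 2) * ennreal (gauss_kernel k (snd p - fst p)) \<partial>lborel)"
      by (intro nn_integral_add) measurable
    also have "(\<integral>\<^sup>+p. ennreal ((cmod (f (fst p)))\<^sup>2 / 2) * ennreal (gauss_kernel k (snd p - fst p)) \<partial>lborel)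
        = (\<integral>\<^sup>+x. ennreal ((cmod (f x))\<^sup>2 / 2) \<partial>lborel)"
      by (subst lborel_nn_Fubini(1)[symmetric])
         (auto simp: nn_integral_cmult nn_integral_gauss_kernel[OF k])
    also have "(\<integral>\<^sup>+p. ennreal ((cmod (f (snd p)))\<^sup>2 / 2) * ennreal (gauss_kernel k (snd p - fst p)) \<partial>lborel)
        = (\<integral>\<^sup>+x. ennreal ((cmod (f x))\<^sup>2 / 2) \<partial>lborel)"
      by (subst lborel_nn_Fubini(2)[symmetric])
         (auto simp: nn_integral_cmult nn_integral_gauss_kernel[OF k])
    also have "(\<integral>\<^sup>+x. ennreal ((cmod (f x))\<^sup>2 / 2) \<partial>lborel) + (\<integral>\<^sup>+x. ennreal ((cmod (f x))\<^sup>2 / 2) \<partial>lborel)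
        = (\<integral>\<^sup>+x. ennreal ((cmod (f x))\<^sup>2) \<partial>lborel)"
      by (subst nn_integral_add[symmetric]) (auto simp flip: ennreal_plus)
    also have "\<dots> = ennreal ((L2norm f)\<^sup>2)" by (rule L2_nn_integral[OF L2])
    finally show ?thesis .
  qed
  have "(\<integral>\<^sup>+\<xi>. ennreal ((cmod (fourier f \<xi>))\<^sup>2) \<partial>lborel)
      = (\<integral>\<^sup>+\<xi>. liminf (\<lambda>n. ennreal (e n \<xi> * (cmod (fourier f \<xi>))\<^sup>2)) \<partial>lborel)"
  proof (intro nn_integral_cong lim_imp_Liminf[symmetric])
    show "(\<lambda>n. ennreal (e n \<xi> * (cmod (fourier f \<xi>))\<^sup>2)) \<longlonglongrightarrow> ennreal ((cmod (fourier f \<xi>))\<^sup>2)" for \<xi>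
      using tendsto_mult_right[OF e_lim, where c="(cmod (fourier f \<xi>))\<^sup>2"] by (intro tendsto_ennrealI) simp
  qed simp
  also have "\<dots> \<le> liminf (\<lambda>n. \<integral>\<^sup>+\<xi>. ennreal (e n \<xi> * (cmod (fourier f \<xi>))\<^sup>2) \<partial>lborel)"
    by (intro nn_integral_liminf) measurable
  also have "\<dots> \<le> ennreal ((L2norm f)\<^sup>2)"
    using est by (intro Liminf_le) auto
  finally show "L2 (fourier f)" "L2norm (fourier f) \<le> L2norm f"
    by (auto intro: L2I)
qed

text \<open>After the substitution y = x + v / k the indicator is evaluated at points tending to x,
  and it is continuous there because x is off the frontier.\<close>

lemma integral_indicator_box_gauss_kernel_tendsto:
  fixes x :: "'a::euclidean_space"
  assumes "x \<notin> frontier (box a b)"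
  shows "(\<lambda>n. LINT y|lborel. indicator (box a b) y * gauss_kernel (real (Suc n)) (y - x)) \<longlonglongrightarrow> indicator (box a b) x"
proof -
  define k where "k n = real (Suc n)" for n
  have k: "k n > 0" for n by (simp add: k_def)
  have eq: "(LINT y|lborel. indicator (box a b) y * gauss_kernel (k n) (y - x))
      = (LINT v|lborel. indicator (box a b) (x + (1 / k n) *\<^sub>R v) * gauss v)" for n
  proof -
    have "(LINT y|lborel. indicator (box a b) y * gauss_kernel (k n) (y - x))
      = (1 / k n) ^ DIM('a) *\<^sub>R (LINT v|lborel. indicator (box a b) (x + (1 / k n) *\<^sub>R v) * gauss_kernel (k n) ((1 / k n) *\<^sub>R v))"
      using k by (subst lborel_integral_affine(1)[of "1 / k n" _ x]) auto
    also have "\<dots> = (1 / k n) ^ DIM('a) * (k n ^ DIM('a) * (LINT v|lborel. indicator (box a b) (x + (1 / k n) *\<^sub>R v) * gauss v))"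
      using k[of n] by (simp add: gauss_kernel_def mult_ac flip: integral_mult_right_zero)
    also have "\<dots> = (LINT v|lborel. indicator (box a b) (x + (1 / k n) *\<^sub>R v) * gauss v)"
      using k[of n] by (simp add: power_divide)
    finally show ?thesis .
  qed
  have "(\<lambda>n. LINT v|lborel. indicator (box a b) (x + (1 / k n) *\<^sub>R v) * gauss v)
      \<longlonglongrightarrow> (LINT v|lborel. indicator (box a b) x * gauss (v::'a))"
  proof (rule integral_dominated_convergence[where w=gauss])
    show "integrable lborel (gauss :: 'a \<Rightarrow> real)" by (rule integrable_gauss)
    show "AE v in lborel. (\<lambda>n. indicator (box a b) (x + (1 / k n) *\<^sub>R v) * gauss v) \<longlonglongrightarrow> indicator (box a b) x * gauss v"
    proof (intro AE_I2 tendsto_mult_right)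
      fix v
      have "(\<lambda>n. x + inverse (k n) *\<^sub>R v) \<longlonglongrightarrow> x + 0 *\<^sub>R v"
        unfolding k_def by (intro tendsto_intros LIMSEQ_inverse_real_of_nat)
      then have lim: "(\<lambda>n. x + (1 / k n) *\<^sub>R v) \<longlonglongrightarrow> x" by (simp add: inverse_eq_divide)
      show "(\<lambda>n. indicat_real (box a b) (x + (1 / k n) *\<^sub>R v)) \<longlonglongrightarrow> indicator (box a b) x"
      proof (cases "x \<in> box a b")
        case True
        then have "\<forall>\<^sub>F n in sequentially. x + (1 / k n) *\<^sub>R v \<in> box a b"
          using lim open_box topological_tendstoD by blast
        then show ?thesis using True by (intro tendsto_eventually) (auto elim!: eventually_mono)
      next
        case False
        with assms have "x \<in> - closure (box a b)"
          by (simp add: frontier_def interior_open[OF open_box])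
        then have "\<forall>\<^sub>F n in sequentially. x + (1 / k n) *\<^sub>R v \<in> - closure (box a b)"
          using lim by (intro topological_tendstoD) auto
        then have "\<forall>\<^sub>F n in sequentially. x + (1 / k n) *\<^sub>R v \<notin> box a b"
          by eventually_elim (use closure_subset in blast)
        then show ?thesis using False by (intro tendsto_eventually) (auto elim!: eventually_mono)
      qed
    qed
    show "AE v in lborel. norm (indicator (box a b) (x + (1 / k n) *\<^sub>R v) * gauss v) \<le> gauss v" for n
      by (auto simp: indicator_def gauss_nonneg)
  qed measurable
  then show ?thesis
    unfolding eq[symmetric] by (simp add: integral_gauss k_def)
qed

text \<open>Boxes suffice as second arguments for inversion, because box integrals determine a
  function. Both sides of \<open>fourier_regularized\<close> converge: the damping tends to 1, and
  the smoothed indicator tends to the indicator off the frontier, which is a null set.\<close>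

lemma fourier_parseval_box:
  fixes f :: "'a::euclidean_space \<Rightarrow> complex"
  assumes f: "integrable lborel f" and L2f: "L2 f"
  shows "(LINT \<xi>|lborel. fourier f \<xi> * cnj (fourier (indicator (box a b)) \<xi>)) = (LINT x|lborel. f x * indicator (box a b) x)"
proof -
  have [measurable]: "f \<in> borel_measurable borel" using L2f by auto
  define h :: "'a \<Rightarrow> complex" where "h = indicator (box a b)"
  have [measurable]: "h \<in> borel_measurable borel" unfolding h_def by simp
  have fin: "emeasure lborel (box a b) < \<infinity>" by (rule emeasure_lborel_box_finite)
  have L2h: "L2 h" unfolding h_def using fin by (intro L2_indicator_one) auto
  have "integrable lborel (\<lambda>x. complex_of_real (indicator (box a b) x))" using fin by auto
  also have "(\<lambda>x. complex_of_real (indicator (box a b) x)) = h" by (auto simp: h_def indicator_def)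
  finally have h: "integrable lborel h" .
  have cnj_h: "cnj (h y) = h y" "h y = complex_of_real (indicator (box a b) y)" for y by (auto simp: h_def indicator_def)
  define e where "e n \<xi> = complex_of_real (exp (- (norm \<xi>)\<^sup>2 / (2 * (real (Suc n))\<^sup>2)))" for n and \<xi> :: 'a
  have [measurable]: "e n \<in> borel_measurable borel" for n unfolding e_def by measurable
  have lim1: "(\<lambda>n. LINT \<xi>|lborel. e n \<xi> * (fourier f \<xi> * cnj (fourier h \<xi>))) \<longlonglongrightarrow> (LINT \<xi>|lborel. fourier f \<xi> * cnj (fourier h \<xi>))"
  proof (rule integral_dominated_convergence[where w="\<lambda>\<xi>. cmod (fourier f \<xi>) * cmod (fourier h \<xi>)"])
    show "integrable lborel (\<lambda>\<xi>. cmod (fourier f \<xi>) * cmod (fourier h \<xi>))"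
      by (intro L2_mult_bound fourier_L2_le f h L2f L2h)
    show "AE \<xi> in lborel. (\<lambda>n. e n \<xi> * (fourier f \<xi> * cnj (fourier h \<xi>))) \<longlonglongrightarrow> fourier f \<xi> * cnj (fourier h \<xi>)"
    proof (rule AE_I2)
      fix \<xi> :: 'a
      have "(\<lambda>n. e n \<xi>) \<longlonglongrightarrow> complex_of_real 1"
        unfolding e_def by (intro tendsto_of_real exp_gauss_tendsto_1)
      from tendsto_mult_right[OF this, of "fourier f \<xi> * cnj (fourier h \<xi>)"]
      show "(\<lambda>n. e n \<xi> * (fourier f \<xi> * cnj (fourier h \<xi>))) \<longlonglongrightarrow> fourier f \<xi> * cnj (fourier h \<xi>)" by simp
    qed
    show "AE \<xi> in lborel. norm (e n \<xi> * (fourier f \<xi> * cnj (fourier h \<xi>))) \<le> cmod (fourier f \<xi>) * cmod (fourier h \<xi>)" for n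
      by (auto simp: e_def norm_mult intro!: mult_left_le_one_le)
  qed measurable
  have eq: "(LINT \<xi>|lborel. e n \<xi> * (fourier f \<xi> * cnj (fourier h \<xi>)))
      = (LINT x|lborel. f x * complex_of_real (LINT y|lborel. indicator (box a b) y * gauss_kernel (real (Suc n)) (y - x)))" for n
  proof -
    have k: "real (Suc n) > 0" by simp
    show ?thesis
      unfolding e_def fourier_regularized(1)[OF f h k]
      by (subst lborel_Fubini(1)[OF fourier_regularized(2)[OF f h k], symmetric])
         (simp add: mult.assoc cnj_h flip: integral_complex_of_real)
  qed
  have lim2: "(\<lambda>n. LINT x|lborel. f x * complex_of_real (LINT y|lborel. indicator (box a b) y * gauss_kernel (real (Suc n)) (y - x)))
     \<longlonglongrightarrow> (LINT x|lborel. f x * complex_of_real (indicator (box a b) x))"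
  proof (rule integral_dominated_convergence[where w="\<lambda>x. cmod (f x)"])
    have "box a b \<in> lmeasurable" "negligible (frontier (box a b))"
      by (auto simp: negligible_convex_frontier)
    then have "frontier (box a b) \<in> null_sets lebesgue" by (simp add: negligible_iff_null_sets)
    then have "frontier (box a b) \<in> null_sets lborel"
      by (simp add: null_sets_completion_iff)
    then have "AE x in lborel. x \<notin> frontier (box a b)" by (rule AE_not_in)
    then show "AE x in lborel. (\<lambda>n. f x * complex_of_real (LINT y|lborel. indicator (box a b) y * gauss_kernel (real (Suc n)) (y - x)))
        \<longlonglongrightarrow> f x * complex_of_real (indicator (box a b) x)"
      by eventually_elim (intro tendsto_intros integral_indicator_box_gauss_kernel_tendsto)
    show "AE x in lborel. norm (f x * complex_of_real (LINT y|lborel. indicator (box a b) y * gauss_kernel (real (Suc n)) (y - x))) \<le> cmod (f x)" for n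
    proof (rule AE_I2)
      fix x :: 'a
      let ?g = "\<lambda>y. gauss_kernel (real (Suc n)) (y - x)"
      have nn: "?g y \<ge> 0" for y by (rule gauss_kernel_nonneg) simp
      have "(\<integral>\<^sup>+y. ennreal (?g y) \<partial>lborel) = 1" by (rule nn_integral_gauss_kernel) simp
      then have ig: "integrable lborel ?g" "integral\<^sup>L lborel ?g = 1"
        using nn by (auto simp: integrable_iff_bounded integral_eq_nn_integral)
      have "norm (LINT y|lborel. indicator (box a b) y * ?g y) \<le> (LINT y|lborel. norm (indicator (box a b) y * ?g y))"
        by (rule integral_norm_bound)
      also have "\<dots> \<le> integral\<^sup>L lborel ?g"
        using nn by (intro integral_mono' ig(1)) (auto simp: indicator_def)
      finally have "norm (LINT y|lborel. indicator (box a b) y * ?g y) \<le> 1" unfolding ig(2) .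
      then show "norm (f x * complex_of_real (LINT y|lborel. indicator (box a b) y * ?g y)) \<le> cmod (f x)"
        by (simp add: norm_mult mult_right_le_one_le)
    qed
  qed (use f in auto)
  have "(LINT \<xi>|lborel. fourier f \<xi> * cnj (fourier h \<xi>)) = (LINT x|lborel. f x * complex_of_real (indicator (box a b) x))"
    using lim1 lim2 unfolding eq by (rule LIMSEQ_unique)
  then show ?thesis
    unfolding h_def[symmetric] cnj_h(2)[symmetric] .
qed

section \<open>The partial Fourier transform on \<open>L\<^sup>2\<close>\<close>

definition fourier_fst :: "('a::euclidean_space \<times> 'b::euclidean_space \<Rightarrow> complex) \<Rightarrow> 'a \<times> 'b \<Rightarrow> complex" where
  "fourier_fst f p = fourier (\<lambda>y. f (y, snd p)) (fst p)"

text \<open>Bounded support in the first variable makes almost all slices integrable, so that the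
  Fourier integral makes sense on them. Unlike bounded support in all variables, this condition
  survives a transform in another variable, which iterated transforms need.\<close>

definition L2_strip :: "('a::euclidean_space \<times> 'b::euclidean_space \<Rightarrow> complex) \<Rightarrow> bool" where
  "L2_strip f \<longleftrightarrow> L2 f \<and> (\<exists>R. \<forall>x z. norm x > R \<longrightarrow> f (x, z) = 0)"

definition L2_bdd :: "('a::euclidean_space \<Rightarrow> complex) \<Rightarrow> bool" where
  "L2_bdd f \<longleftrightarrow> L2 f \<and> (\<exists>R. \<forall>p. norm p > R \<longrightarrow> f p = 0)"

lemma L2_bdd_L2: "L2_bdd f \<Longrightarrow> L2 f"
  by (simp add: L2_bdd_def)

lemma L2_strip_L2: "L2_strip f \<Longrightarrow> L2 f"
  by (simp add: L2_strip_def)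

lemma L2_bdd_imp_strip: "L2_bdd f \<Longrightarrow> L2_strip f"
  unfolding L2_bdd_def L2_strip_def
  by (metis (no_types, lifting) fst_conv le_less_trans not_le norm_fst_le order_le_less_trans)

lemma L2_bdd_indicator:
  assumes "bounded S" "S \<in> sets borel"
  shows "L2_bdd (indicator S)"
proof -
  obtain R where "\<And>x. x \<in> S \<Longrightarrow> norm x \<le> R" using assms(1) by (auto simp: bounded_iff)
  then show ?thesis
    unfolding L2_bdd_def using assms L2_indicator_one[of S] emeasure_bounded_finite[OF assms(1)]
    by (auto simp: indicator_def not_le[symmetric])
qed

lemma L2_bdd_truncation:
  assumes "L2 f" "bounded S" "S \<in> sets borel"
  shows "L2_bdd (\<lambda>z. indicator S z *\<^sub>R f z)"
proof -
  obtain R where "\<And>x. x \<in> S \<Longrightarrow> norm x \<le> R" using assms(2) by (auto simp: bounded_iff)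
  then show ?thesis
    unfolding L2_bdd_def using assms L2_indicator[OF assms(1,3)]
    by (auto simp: indicator_def not_le[symmetric])
qed

lemma L2_strip_diff:
  assumes "L2_strip f" "L2_strip g"
  shows "L2_strip (\<lambda>z. f z - g z)"
proof -
  obtain R where "\<And>x z. norm x > R \<Longrightarrow> f (x, z) = 0"
    using assms(1) by (auto simp: L2_strip_def)
  moreover obtain S where "\<And>x z. norm x > S \<Longrightarrow> g (x, z) = 0"
    using assms(2) by (auto simp: L2_strip_def)
  ultimately show ?thesis
    using assms L2_diff unfolding L2_strip_def by (auto intro!: exI[of _ "max R S"])
qed

text \<open>Fubini's theorem puts almost every slice in L2, and on a ball square integrable
  functions are integrable.\<close>

lemma L2_strip_slice:
  fixes f :: "'a::euclidean_space \<times> 'b::euclidean_space \<Rightarrow> complex"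
  assumes "L2_strip f"
  shows "AE z in lborel. integrable lborel (\<lambda>x. f (x, z)) \<and> L2 (\<lambda>x. f (x, z))"
proof -
  have L2: "L2 f" using assms by (rule L2_strip_L2)
  then have [measurable]: "f \<in> borel_measurable borel" by auto
  obtain R where R: "\<And>x z. norm x > R \<Longrightarrow> f (x, z) = 0" using assms by (auto simp: L2_strip_def)
  have "AE z in lborel. integrable lborel (\<lambda>x. (cmod (f (x, z)))\<^sup>2)"
    using L2 by (intro lborel_Fubini(4)) (simp add: L2_def)
  then show ?thesis
  proof eventually_elim
    case (elim z)
    then have s: "L2 (\<lambda>x. f (x, z))" by (simp add: L2_def)
    have "L2 (indicator (cball 0 R) :: 'a \<Rightarrow> complex)"
      by (intro L2_bdd_L2 L2_bdd_indicator) auto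
    from L2_mult_bound(1)[OF this s]
    have "integrable lborel (\<lambda>x. indicator (cball 0 R) x * f (x, z))" .
    also have "(\<lambda>x. indicator (cball 0 R) x * f (x, z)) = (\<lambda>x. f (x, z))"
      using R by (auto simp: indicator_def fun_eq_iff not_le)
    finally show ?case using s by simp
  qed
qed

lemma fourier_fst_measurable [measurable]:
  fixes f :: "'a::euclidean_space \<times> 'b::euclidean_space \<Rightarrow> complex"
  assumes [measurable]: "f \<in> borel_measurable borel"
  shows "fourier_fst f \<in> borel_measurable borel"
  unfolding fourier_fst_def fourier_def by measurable

lemma fourier_fst_L2:
  fixes f :: "'a::euclidean_space \<times> 'b::euclidean_space \<Rightarrow> complex"
  assumes "L2_strip f"
  shows "L2 (fourier_fst f)" "L2norm (fourier_fst f) \<le> L2norm f"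
proof -
  have L2: "L2 f" using assms by (rule L2_strip_L2)
  then have [measurable]: "f \<in> borel_measurable borel" by auto
  have m: "(\<lambda>p. ennreal ((cmod (fourier_fst f p))\<^sup>2)) \<in> borel_measurable borel" by measurable
  have "(\<integral>\<^sup>+p. ennreal ((cmod (fourier_fst f p))\<^sup>2) \<partial>lborel)
      = (\<integral>\<^sup>+z. \<integral>\<^sup>+\<xi>. ennreal ((cmod (fourier (\<lambda>y. f (y, z)) \<xi>))\<^sup>2) \<partial>lborel \<partial>lborel)"
    using lborel_nn_Fubini(2)[OF m] by (simp add: fourier_fst_def)
  also have "\<dots> \<le> (\<integral>\<^sup>+z. \<integral>\<^sup>+x. ennreal ((cmod (f (x, z)))\<^sup>2) \<partial>lborel \<partial>lborel)"
  proof (rule nn_integral_mono_AE)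
    show "AE z in lborel. (\<integral>\<^sup>+\<xi>. ennreal ((cmod (fourier (\<lambda>y. f (y, z)) \<xi>))\<^sup>2) \<partial>lborel)
        \<le> (\<integral>\<^sup>+x. ennreal ((cmod (f (x, z)))\<^sup>2) \<partial>lborel)"
      using L2_strip_slice[OF assms]
    proof eventually_elim
      case (elim z)
      then show ?case
        using fourier_L2_le[of "\<lambda>x. f (x, z)"] by (simp add: L2_nn_integral ennreal_leI power_mono)
    qed
  qed
  also have "\<dots> = ennreal ((L2norm f)\<^sup>2)"
    unfolding L2_nn_integral[OF L2, symmetric] by (rule lborel_nn_Fubini(2)) auto
  finally show "L2 (fourier_fst f)" "L2norm (fourier_fst f) \<le> L2norm f"
    by (auto intro: L2I)
qed

lemma AE_lborel_prodI:
  fixes P :: "'a::euclidean_space \<times> 'b::euclidean_space \<Rightarrow> bool"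
  assumes [measurable]: "Measurable.pred borel P" and ae: "AE z in lborel. AE x in lborel. P (x, z)"
  shows "AE p in lborel. P p"
proof -
  have m: "{p \<in> space (lborel \<Otimes>\<^sub>M lborel). P p} \<in> sets (lborel \<Otimes>\<^sub>M lborel :: ('a \<times> 'b) measure)"
    unfolding lborel_prod by measurable
  have "AE x in lborel. AE z in lborel. P (x, z)"
    using lborel_pair.AE_commute[of "\<lambda>x z. P (x, z)"] m ae by simp
  with m have "AE p in lborel \<Otimes>\<^sub>M lborel. P p"
    by (intro lborel_pair.AE_pair_measure)
  then show ?thesis unfolding lborel_prod .
qed

text \<open>Only almost everywhere: on exceptional slices the integrals of \<open>f\<close> and
  \<open>g\<close> may fail to exist and then take the default value 0.\<close>

lemma fourier_fst_diff:
  fixes f g :: "'a::euclidean_space \<times> 'b::euclidean_space \<Rightarrow> complex"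
  assumes f: "L2_strip f" and g: "L2_strip g"
  shows "AE p in lborel. fourier_fst (\<lambda>z. f z - g z) p = fourier_fst f p - fourier_fst g p"
proof -
  have [measurable]: "f \<in> borel_measurable borel" "g \<in> borel_measurable borel"
    using L2_measurable[OF L2_strip_L2[OF f]] L2_measurable[OF L2_strip_L2[OF g]] by auto
  have *: "AE z in lborel. \<forall>\<xi>. fourier_fst (\<lambda>z. f z - g z) (\<xi>, z) = fourier_fst f (\<xi>, z) - fourier_fst g (\<xi>, z)"
    using L2_strip_slice[OF f] L2_strip_slice[OF g]
  proof eventually_elim
    case (elim z)
    have "integrable lborel (\<lambda>y. cis (- (\<xi> \<bullet> y)) * f (y, z))" "integrable lborel (\<lambda>y. cis (- (\<xi> \<bullet> y)) * g (y, z))" for \<xi>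
      using elim
      by (auto intro: Bochner_Integration.integrable_bound[of _ "\<lambda>y. f (y, z)"] Bochner_Integration.integrable_bound[of _ "\<lambda>y. g (y, z)"]
          simp: norm_mult)
    then show ?case
      by (simp add: fourier_fst_def fourier_def right_diff_distrib)
  qed
  have "AE z in lborel. AE \<xi> in lborel. fourier_fst (\<lambda>z. f z - g z) (\<xi>, z) = fourier_fst f (\<xi>, z) - fourier_fst g (\<xi>, z)"
    using * by eventually_elim simp
  then show ?thesis by (intro AE_lborel_prodI) measurable
qed

lemma fourier_fst_duality:
  fixes f h :: "'a::euclidean_space \<times> 'b::euclidean_space \<Rightarrow> complex"
  assumes f: "L2_strip f" and h: "L2_strip h"
  shows "(LINT p|lborel. fourier_fst f p * h p) = (LINT p|lborel. f p * fourier_fst h p)"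
proof -
  note L2 = L2_strip_L2[OF f] L2_strip_L2[OF h] fourier_fst_L2(1)[OF f] fourier_fst_L2(1)[OF h]
  have "(LINT p|lborel. fourier_fst f p * h p) = (LINT z|lborel. LINT \<xi>|lborel. fourier_fst f (\<xi>, z) * h (\<xi>, z))"
    by (rule lborel_Fubini(2)[symmetric]) (intro L2_mult_bound L2)
  also have "\<dots> = (LINT z|lborel. LINT \<xi>|lborel. f (\<xi>, z) * fourier_fst h (\<xi>, z))"
  proof (rule integral_cong_AE)
    show "AE z in lborel. (LINT \<xi>|lborel. fourier_fst f (\<xi>, z) * h (\<xi>, z)) = (LINT \<xi>|lborel. f (\<xi>, z) * fourier_fst h (\<xi>, z))"
      using L2_strip_slice[OF f] L2_strip_slice[OF h]
      by eventually_elim (simp add: fourier_fst_def fourier_duality)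
    show "(\<lambda>z. LINT \<xi>|lborel. fourier_fst f (\<xi>, z) * h (\<xi>, z)) \<in> borel_measurable lborel"
      "(\<lambda>z. LINT \<xi>|lborel. f (\<xi>, z) * fourier_fst h (\<xi>, z)) \<in> borel_measurable lborel"
      by (rule borel_measurable_integrable, rule lborel_Fubini(6), intro L2_mult_bound L2)+
  qed
  also have "\<dots> = (LINT p|lborel. f p * fourier_fst h p)"
    by (rule lborel_Fubini(2)) (intro L2_mult_bound L2)
  finally show ?thesis .
qed

text \<open>Testing against square-integrable functions of bounded support characterises the transform,
  which avoids limits in most arguments below.\<close>

definition is_FT :: "('a::euclidean_space \<times> 'b::euclidean_space \<Rightarrow> complex) \<Rightarrow> ('a \<times> 'b \<Rightarrow> complex) \<Rightarrow> bool" where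
  "is_FT f F \<longleftrightarrow> L2 f \<and> L2 F \<and>
     (\<forall>h. L2_bdd h \<longrightarrow> (LINT p|lborel. F p * h p) = (LINT p|lborel. f p * fourier_fst h p))"

lemma is_FT_L2: "is_FT f F \<Longrightarrow> L2 f" "is_FT f F \<Longrightarrow> L2 F"
  by (auto simp: is_FT_def)

lemma is_FT_test: "is_FT f F \<Longrightarrow> L2_bdd h \<Longrightarrow> (LINT p|lborel. F p * h p) = (LINT p|lborel. f p * fourier_fst h p)"
  by (auto simp: is_FT_def)

lemma is_FT_fourier_fst: "L2_strip f \<Longrightarrow> is_FT f (fourier_fst f)"
  unfolding is_FT_def using L2_strip_L2 fourier_fst_L2(1) fourier_fst_duality L2_bdd_imp_strip by blast

lemma is_FT_cong:
  assumes "is_FT f F" "L2 f'" "L2 F'" "AE z in lborel. f z = f' z" "AE z in lborel. F z = F' z"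
  shows "is_FT f' F'"
  unfolding is_FT_def
proof (intro conjI allI impI)
  fix h :: "'a \<times> 'b \<Rightarrow> complex" assume h: "L2_bdd h"
  have [measurable]: "f \<in> borel_measurable borel" "F \<in> borel_measurable borel" "f' \<in> borel_measurable borel" "F' \<in> borel_measurable borel"
    "h \<in> borel_measurable borel"
    using is_FT_L2[OF assms(1)] assms(2,3) L2_bdd_L2[OF h] by auto
  have "(LINT p|lborel. F' p * h p) = (LINT p|lborel. F p * h p)"
    using assms(5) by (intro integral_cong_AE) auto
  also have "\<dots> = (LINT p|lborel. f p * fourier_fst h p)" by (rule is_FT_test[OF assms(1) h])
  also have "\<dots> = (LINT p|lborel. f' p * fourier_fst h p)"
    using assms(4) by (intro integral_cong_AE) auto
  finally show "(LINT p|lborel. F' p * h p) = (LINT p|lborel. f' p * fourier_fst h p)" .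
qed (use assms in auto)

lemma is_FT_unique:
  assumes "is_FT f F" "is_FT f G"
  shows "AE z in lborel. F z = G z"
proof (rule L2_eqI_box)
  fix a b :: "'a \<times> 'b"
  have "L2_bdd (indicator (box a b) :: 'a \<times> 'b \<Rightarrow> complex)" by (intro L2_bdd_indicator) auto
  then show "(LINT z|lborel. F z * indicator (box a b) z) = (LINT z|lborel. G z * indicator (box a b) z)"
    using assms by (simp add: is_FT_test)
qed (use assms is_FT_L2 in auto)

text \<open>The L2 bound makes the transforms of the truncations a Cauchy sequence, and the duality
  relation passes to the limit. The truncating sets are left general so as to cover preimages of
  balls under a change of coordinates.\<close>

lemma is_FT_truncation_ex:
  fixes f :: "'a::euclidean_space \<times> 'b::euclidean_space \<Rightarrow> complex"
  assumes f: "L2 f" and S: "\<And>n. bounded (S n)" "\<And>n. S n \<in> sets borel" "\<And>z. eventually (\<lambda>n. z \<in> S n) sequentially"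
  shows "\<exists>F. is_FT f F \<and> (\<lambda>n. L2norm (\<lambda>z. fourier_fst (\<lambda>z. indicator (S n) z *\<^sub>R f z) z - F z)) \<longlonglongrightarrow> 0"
proof -
  define fn where "fn n z = indicator (S n) z *\<^sub>R f z" for n z
  have fn_bdd: "L2_bdd (fn n)" for n unfolding fn_def by (intro L2_bdd_truncation f S)
  note fn_strip = L2_bdd_imp_strip[OF fn_bdd]
  have lim: "(\<lambda>n. L2norm (\<lambda>z. fn n z - f z)) \<longlonglongrightarrow> 0"
    unfolding fn_def by (intro tendsto_L2_truncation f S)
  have le: "L2norm (\<lambda>z. fourier_fst (fn m) z - fourier_fst (fn n) z) \<le> L2norm (\<lambda>z. fn m z - f z) + L2norm (\<lambda>z. fn n z - f z)" for m n
  proof -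
    have "L2norm (\<lambda>z. fourier_fst (fn m) z - fourier_fst (fn n) z) = L2norm (fourier_fst (\<lambda>z. fn m z - fn n z))"
      by (rule L2_cong_AE(2))
         (use fourier_fst_diff[OF fn_strip fn_strip, of m n] fourier_fst_L2(1)[OF L2_strip_diff[OF fn_strip fn_strip, of m n]]
            L2_measurable[OF fourier_fst_L2(1)[OF fn_strip]] in auto)
    also have "\<dots> \<le> L2norm (\<lambda>z. fn m z - fn n z)"
      by (intro fourier_fst_L2 L2_strip_diff fn_strip)
    also have "\<dots> \<le> L2norm (\<lambda>z. fn m z - f z) + L2norm (\<lambda>z. f z - fn n z)"
      by (intro L2norm_triangle_diff L2_bdd_L2[OF fn_bdd] f)
    finally show ?thesis by (simp add: L2norm_minus_commute[of f "fn n"])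
  qed
  have "\<exists>F. L2 F \<and> (\<lambda>n. L2norm (\<lambda>z. fourier_fst (fn n) z - F z)) \<longlonglongrightarrow> 0"
  proof (rule L2_complete)
    show "L2 (fourier_fst (fn n))" for n by (intro fourier_fst_L2 fn_strip)
    fix e :: real assume "e > 0"
    then obtain N where N: "\<And>n. n \<ge> N \<Longrightarrow> L2norm (\<lambda>z. fn n z - f z) < e / 2"
      using LIMSEQ_D[OF lim, of "e/2"] by auto
    have "L2norm (\<lambda>z. fourier_fst (fn m) z - fourier_fst (fn n) z) < e" if "m \<ge> N" "n \<ge> N" for m n
      using le[of m n] N[OF that(1)] N[OF that(2)] by simp
    then show "\<exists>N. \<forall>m\<ge>N. \<forall>n\<ge>N. L2norm (\<lambda>z. fourier_fst (fn m) z - fourier_fst (fn n) z) < e"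
      by blast
  qed
  then obtain F where F: "L2 F" "(\<lambda>n. L2norm (\<lambda>z. fourier_fst (fn n) z - F z)) \<longlonglongrightarrow> 0" by blast
  have "is_FT f F"
    unfolding is_FT_def
  proof (intro conjI allI impI f F(1))
    fix h :: "'a \<times> 'b \<Rightarrow> complex" assume h: "L2_bdd h"
    note hs = L2_bdd_imp_strip[OF h]
    have "(\<lambda>n. LINT p|lborel. fourier_fst (fn n) p * h p) \<longlonglongrightarrow> (LINT p|lborel. F p * h p)"
      by (intro tendsto_L2_inner fourier_fst_L2 fn_strip F L2_bdd_L2 h)
    moreover have "(\<lambda>n. LINT p|lborel. fn n p * fourier_fst h p) \<longlonglongrightarrow> (LINT p|lborel. f p * fourier_fst h p)"
      by (intro tendsto_L2_inner fourier_fst_L2 hs f L2_bdd_L2 fn_bdd lim)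
    ultimately show "(LINT p|lborel. F p * h p) = (LINT p|lborel. f p * fourier_fst h p)"
      unfolding fourier_fst_duality[OF fn_strip hs] by (rule LIMSEQ_unique)
  qed
  then show ?thesis using F unfolding fn_def by blast
qed

text \<open>By uniqueness, any transform is the limit constructed in
  \<open>is_FT_truncation_ex\<close>.\<close>

lemma is_FT_truncation:
  assumes F: "is_FT f F" and S: "\<And>n. bounded (S n)" "\<And>n. S n \<in> sets borel" "\<And>z. eventually (\<lambda>n. z \<in> S n) sequentially"
  shows "(\<lambda>n. L2norm (\<lambda>z. fourier_fst (\<lambda>z. indicator (S n) z *\<^sub>R f z) z - F z)) \<longlonglongrightarrow> 0"
proof -
  have f: "L2 f" using F by (rule is_FT_L2)
  obtain G where G: "is_FT f G" "(\<lambda>n. L2norm (\<lambda>z. fourier_fst (\<lambda>z. indicator (S n) z *\<^sub>R f z) z - G z)) \<longlonglongrightarrow> 0"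
    using is_FT_truncation_ex[OF f S] by blast
  have "L2norm (\<lambda>z. fourier_fst (\<lambda>z. indicator (S n) z *\<^sub>R f z) z - F z)
      = L2norm (\<lambda>z. fourier_fst (\<lambda>z. indicator (S n) z *\<^sub>R f z) z - G z)" for n
  proof (rule L2_cong_AE(2))
    have L2: "L2 (fourier_fst (\<lambda>z. indicator (S n) z *\<^sub>R f z))"
      by (intro fourier_fst_L2 L2_bdd_imp_strip L2_bdd_truncation f S)
    then show "L2 (\<lambda>z. fourier_fst (\<lambda>z. indicator (S n) z *\<^sub>R f z) z - G z)"
      by (intro L2_diff is_FT_L2(2)[OF G(1)])
    show "(\<lambda>z. fourier_fst (\<lambda>z. indicator (S n) z *\<^sub>R f z) z - F z) \<in> borel_measurable borel"
      using L2_diff[OF L2 is_FT_L2(2)[OF F]] by (rule L2_measurable)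
  qed (use is_FT_unique[OF F G(1)] in auto)
  then show ?thesis using G(2) by simp
qed

section \<open>Duality, inversion and multipliers for the partial transform\<close>

lemma eventually_mem_cball: "eventually (\<lambda>n. z \<in> cball 0 (real n)) sequentially"
  for z :: "'a::real_normed_vector"
  using eventually_ge_at_top[of "nat \<lceil>norm z\<rceil>"] by eventually_elim (simp add: nat_le_iff ceiling_le_iff)

lemma is_FT_ex:
  assumes "L2 f" shows "\<exists>F. is_FT f F"
proof -
  show ?thesis
    using is_FT_truncation_ex[OF assms, of "\<lambda>n. cball 0 (real n)"] eventually_mem_cball by auto
qed

lemma is_FT_approx:
  assumes "is_FT f F"
  obtains fn where "\<And>n. L2_bdd (fn n)" "(\<lambda>n. L2norm (\<lambda>z. fn n z - f z)) \<longlonglongrightarrow> 0"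
    "(\<lambda>n. L2norm (\<lambda>z. fourier_fst (fn n) z - F z)) \<longlonglongrightarrow> 0"
proof -
  note * = eventually_mem_cball
  show ?thesis
  proof (rule that[of "\<lambda>n z. indicator (cball 0 (real n)) z *\<^sub>R f z"])
    show "L2_bdd (\<lambda>z. indicator (cball 0 (real n)) z *\<^sub>R f z)" for n
      using is_FT_L2[OF assms] by (intro L2_bdd_truncation) auto
    show "(\<lambda>n. L2norm (\<lambda>z. indicator (cball 0 (real n)) z *\<^sub>R f z - f z)) \<longlonglongrightarrow> 0"
      using is_FT_L2[OF assms] * by (intro tendsto_L2_truncation) auto
    show "(\<lambda>n. L2norm (\<lambda>z. fourier_fst (\<lambda>z. indicator (cball 0 (real n)) z *\<^sub>R f z) z - F z)) \<longlonglongrightarrow> 0"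
      using * by (intro is_FT_truncation[OF assms]) auto
  qed
qed

text \<open>Approximating \<open>h\<close> by truncations lifts the restriction to test functions of
  bounded support in the definition of \<open>is_FT\<close>.\<close>

lemma is_FT_duality:
  assumes F: "is_FT f F" and H: "is_FT h H"
  shows "(LINT p|lborel. F p * h p) = (LINT p|lborel. f p * H p)"
proof -
  obtain hn where hn: "\<And>n. L2_bdd (hn n)" "(\<lambda>n. L2norm (\<lambda>z. hn n z - h z)) \<longlonglongrightarrow> 0"
    "(\<lambda>n. L2norm (\<lambda>z. fourier_fst (hn n) z - H z)) \<longlonglongrightarrow> 0"
    using is_FT_approx[OF H] by blast
  note L2 = is_FT_L2[OF F] is_FT_L2[OF H]
  have "(\<lambda>n. LINT p|lborel. hn n p * F p) \<longlonglongrightarrow> (LINT p|lborel. h p * F p)"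
    by (intro tendsto_L2_inner L2 L2_bdd_L2 hn)
  moreover have "(\<lambda>n. LINT p|lborel. fourier_fst (hn n) p * f p) \<longlonglongrightarrow> (LINT p|lborel. H p * f p)"
    by (intro tendsto_L2_inner L2 fourier_fst_L2 L2_bdd_imp_strip hn)
  moreover have "(LINT p|lborel. hn n p * F p) = (LINT p|lborel. fourier_fst (hn n) p * f p)" for n
    using is_FT_test[OF F hn(1)] by (simp add: mult.commute)
  ultimately have "(LINT p|lborel. h p * F p) = (LINT p|lborel. H p * f p)"
    using LIMSEQ_unique by simp
  then show ?thesis by (simp add: mult.commute)
qed

lemma is_FT_norm_le:
  assumes F: "is_FT f F"
  shows "L2norm F \<le> L2norm f"
proof -
  obtain fn where fn: "\<And>n. L2_bdd (fn n)" "(\<lambda>n. L2norm (\<lambda>z. fn n z - f z)) \<longlonglongrightarrow> 0"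
    "(\<lambda>n. L2norm (\<lambda>z. fourier_fst (fn n) z - F z)) \<longlonglongrightarrow> 0"
    using is_FT_approx[OF F] by blast
  show ?thesis
  proof (rule LIMSEQ_le)
    show "(\<lambda>n. L2norm (fourier_fst (fn n))) \<longlonglongrightarrow> L2norm F"
      by (intro tendsto_L2_norm fourier_fst_L2 L2_bdd_imp_strip fn is_FT_L2[OF F])
    show "(\<lambda>n. L2norm (fn n)) \<longlonglongrightarrow> L2norm f"
      by (intro tendsto_L2_norm L2_bdd_L2 fn is_FT_L2[OF F])
    show "\<exists>N. \<forall>n\<ge>N. L2norm (fourier_fst (fn n)) \<le> L2norm (fn n)"
      using fourier_fst_L2(2) L2_bdd_imp_strip fn(1) by blast
  qed
qed

lemma fourier_cmult: "fourier (\<lambda>y. c * f y) \<xi> = c * fourier f \<xi>"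
  unfolding fourier_def by (simp add: mult_ac flip: integral_mult_right_zero)

lemma box_Pair_times: "box (a1, a2) (b1, b2) = box a1 b1 \<times> box a2 b2"
  by (auto simp: box_def Basis_prod_def ball_Un)

text \<open>A box is a product, so on each slice its indicator is a constant times a box indicator
  in the transformed variable, and \<open>fourier_parseval_box\<close> applies.\<close>

lemma fourier_fst_parseval_box:
  fixes f :: "'a::euclidean_space \<times> 'b::euclidean_space \<Rightarrow> complex"
  assumes f: "L2_strip f"
  shows "(LINT p|lborel. fourier_fst f p * cnj (fourier_fst (indicator (box a b)) p)) = (LINT p|lborel. f p * indicator (box a b) p)"
proof -
  let ?h = "indicator (box a b) :: 'a \<times> 'b \<Rightarrow> complex"
  have h: "L2_bdd ?h" by (intro L2_bdd_indicator) auto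
  note L2 = L2_strip_L2[OF f] L2_bdd_L2[OF h] fourier_fst_L2(1)[OF f] fourier_fst_L2(1)[OF L2_bdd_imp_strip[OF h]]
  obtain a1 a2 b1 b2 where ab: "a = (a1, a2)" "b = (b1, b2)" by (metis surj_pair)
  have h_eq: "?h (x, z) = indicator (box a2 b2) z * indicator (box a1 b1) x" for x z
    unfolding ab box_Pair_times by (auto simp: indicator_def)
  have Fh: "fourier_fst ?h (\<xi>, z) = indicator (box a2 b2) z * fourier (indicator (box a1 b1)) \<xi>" for \<xi> z
    by (simp add: fourier_fst_def h_eq fourier_cmult)
  have "(LINT p|lborel. fourier_fst f p * cnj (fourier_fst ?h p)) = (LINT z|lborel. LINT \<xi>|lborel. fourier_fst f (\<xi>, z) * cnj (fourier_fst ?h (\<xi>, z)))"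
    by (rule lborel_Fubini(2)[symmetric]) (intro L2_mult_bound L2_cnj L2)
  also have "\<dots> = (LINT z|lborel. LINT x|lborel. f (x, z) * ?h (x, z))"
  proof (rule integral_cong_AE)
    show "AE z in lborel. (LINT \<xi>|lborel. fourier_fst f (\<xi>, z) * cnj (fourier_fst ?h (\<xi>, z))) = (LINT x|lborel. f (x, z) * ?h (x, z))"
      using L2_strip_slice[OF f]
    proof eventually_elim
      case (elim z)
      have "(LINT \<xi>|lborel. fourier_fst f (\<xi>, z) * cnj (fourier_fst ?h (\<xi>, z)))
        = indicator (box a2 b2) z * (LINT \<xi>|lborel. fourier (\<lambda>x. f (x, z)) \<xi> * cnj (fourier (indicator (box a1 b1)) \<xi>))"
        by (cases "z \<in> box a2 b2") (simp_all add: Fh fourier_fst_def[of f])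
      also have "\<dots> = indicator (box a2 b2) z * (LINT x|lborel. f (x, z) * indicator (box a1 b1) x)"
        using elim by (simp add: fourier_parseval_box)
      also have "\<dots> = (LINT x|lborel. f (x, z) * ?h (x, z))"
        by (simp add: h_eq mult_ac flip: integral_mult_right_zero)
      finally show ?case .
    qed
    show "(\<lambda>z. LINT \<xi>|lborel. fourier_fst f (\<xi>, z) * cnj (fourier_fst ?h (\<xi>, z))) \<in> borel_measurable lborel"
      by (rule borel_measurable_integrable, rule lborel_Fubini(6), intro L2_mult_bound L2_cnj L2)
    show "(\<lambda>z. LINT x|lborel. f (x, z) * ?h (x, z)) \<in> borel_measurable lborel"
      by (rule borel_measurable_integrable, rule lborel_Fubini(6), intro L2_mult_bound L2)
  qed
  also have "\<dots> = (LINT p|lborel. f p * ?h p)"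
    by (rule lborel_Fubini(2)) (intro L2_mult_bound L2)
  finally show ?thesis .
qed

text \<open>Conjugation turns the inverse transform into the transform itself. For functions on a
  strip, pairing with boxes and Parseval's identity identify the transform; the general case follows
  by approximation in the duality relation.\<close>

lemma is_FT_inversion:
  fixes f :: "'a::euclidean_space \<times> 'b::euclidean_space \<Rightarrow> complex"
  assumes F: "is_FT f F"
  shows "is_FT (\<lambda>z. cnj (F z)) (\<lambda>z. cnj (f z))"
proof -
  have strip: "is_FT (\<lambda>z. cnj (fourier_fst f z)) (\<lambda>z. cnj (f z))" if f: "L2_strip f" for f :: "'a \<times> 'b \<Rightarrow> complex"
  proof -
    have L2: "L2 (\<lambda>z. cnj (fourier_fst f z))" "L2 (\<lambda>z. cnj (f z))"
      by (intro L2_cnj fourier_fst_L2 f L2_strip_L2)+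
    obtain G where G: "is_FT (\<lambda>z. cnj (fourier_fst f z)) G" using is_FT_ex[OF L2(1)] by blast
    have "AE z in lborel. G z = cnj (f z)"
    proof (rule L2_eqI_box)
      fix a b :: "'a \<times> 'b"
      let ?h = "indicator (box a b) :: 'a \<times> 'b \<Rightarrow> complex"
      have h: "L2_bdd ?h" by (intro L2_bdd_indicator) auto
      have "(LINT z|lborel. G z * ?h z) = (LINT p|lborel. cnj (fourier_fst f p) * fourier_fst ?h p)"
        by (rule is_FT_test[OF G h])
      also have "\<dots> = cnj (LINT p|lborel. fourier_fst f p * cnj (fourier_fst ?h p))"
        by (simp flip: Bochner_Integration.integral_cnj)
      also have "\<dots> = cnj (LINT p|lborel. f p * ?h p)"
        by (simp add: fourier_fst_parseval_box[OF f])
      also have "\<dots> = (LINT z|lborel. cnj (f z) * ?h z)"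
      proof -
        have "(\<lambda>z. cnj (f z) * ?h z) = (\<lambda>z. cnj (f z * ?h z))"
          by (auto simp: indicator_def fun_eq_iff)
        then show ?thesis by (simp only: Bochner_Integration.integral_cnj)
      qed
      finally show "(LINT z|lborel. G z * ?h z) = (LINT z|lborel. cnj (f z) * ?h z)" .
    qed (use G L2 is_FT_L2 in auto)
    then show ?thesis by (intro is_FT_cong[OF G]) (use L2 in auto)
  qed
  obtain fn where fn: "\<And>n. L2_bdd (fn n)" "(\<lambda>n. L2norm (\<lambda>z. fn n z - f z)) \<longlonglongrightarrow> 0"
    "(\<lambda>n. L2norm (\<lambda>z. fourier_fst (fn n) z - F z)) \<longlonglongrightarrow> 0"
    using is_FT_approx[OF F] by blast
  note strip_fn = strip[OF L2_bdd_imp_strip[OF fn(1)]]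
  have cn: "L2norm (\<lambda>z. cnj (g z) - cnj (h z)) = L2norm (\<lambda>z. g z - h z)" for g h :: "'a \<times> 'b \<Rightarrow> complex"
    using L2norm_cnj[of "\<lambda>z. g z - h z"] by simp
  show ?thesis
    unfolding is_FT_def
  proof (intro conjI allI impI L2_cnj is_FT_L2[OF F])
    fix h :: "'a \<times> 'b \<Rightarrow> complex" assume h: "L2_bdd h"
    have "(\<lambda>n. LINT p|lborel. cnj (fn n p) * h p) \<longlonglongrightarrow> (LINT p|lborel. cnj (f p) * h p)"
      by (intro tendsto_L2_inner L2_cnj L2_bdd_L2 fn h is_FT_L2[OF F]) (simp add: cn fn)
    moreover have "(\<lambda>n. LINT p|lborel. cnj (fourier_fst (fn n) p) * fourier_fst h p) \<longlonglongrightarrow> (LINT p|lborel. cnj (F p) * fourier_fst h p)"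
      by (intro tendsto_L2_inner L2_cnj fourier_fst_L2 L2_bdd_imp_strip fn h is_FT_L2[OF F]) (simp add: cn fn)
    moreover have "(LINT p|lborel. cnj (fn n p) * h p) = (LINT p|lborel. cnj (fourier_fst (fn n) p) * fourier_fst h p)" for n
      by (rule is_FT_test[OF strip_fn h])
    ultimately show "(LINT p|lborel. cnj (f p) * h p) = (LINT p|lborel. cnj (F p) * fourier_fst h p)"
      using LIMSEQ_unique by simp
  qed
qed

text \<open>Inversion allows the norm inequality to be applied in the opposite direction as
  well.\<close>

lemma is_FT_norm:
  assumes "is_FT f F"
  shows "L2norm F = L2norm f"
  using is_FT_norm_le[OF assms] is_FT_norm_le[OF is_FT_inversion[OF assms]] by simp

lemma is_FT_surj:
  assumes "L2 F" shows "\<exists>f. is_FT f F"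
proof -
  obtain G where "is_FT (\<lambda>z. cnj (F z)) G" using is_FT_ex[OF L2_cnj[OF assms]] by blast
  from is_FT_inversion[OF this] show ?thesis by auto
qed

text \<open>The multiplier depends only on the variable that is not transformed, so it can be moved
  onto the test function; local boundedness keeps its product with a function of bounded support in
  L2.\<close>

lemma is_FT_multiplier:
  fixes m :: "'b::euclidean_space \<Rightarrow> complex" and f :: "'a::euclidean_space \<times> 'b \<Rightarrow> complex"
  assumes F: "is_FT f F" and m [measurable]: "m \<in> borel_measurable borel"
    and bdd: "\<And>R. \<exists>C. \<forall>z. norm z \<le> R \<longrightarrow> cmod (m z) \<le> C"
    and L2: "L2 (\<lambda>p. m (snd p) * f p)"
  shows "is_FT (\<lambda>p. m (snd p) * f p) (\<lambda>p. m (snd p) * F p)"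
proof -
  have [measurable]: "f \<in> borel_measurable borel" "F \<in> borel_measurable borel"
    using is_FT_L2[OF F] by auto
  obtain G where G: "is_FT (\<lambda>p. m (snd p) * f p) G" using is_FT_ex[OF L2] by blast
  have mh: "L2_bdd (\<lambda>p. m (snd p) * h p)" if h: "L2_bdd h" for h :: "'a \<times> 'b \<Rightarrow> complex"
  proof -
    have [measurable]: "h \<in> borel_measurable borel" using L2_bdd_L2[OF h] by auto
    obtain R where R: "\<And>p. norm p > R \<Longrightarrow> h p = 0" using h by (auto simp: L2_bdd_def)
    obtain C where C: "\<And>z. norm z \<le> R \<Longrightarrow> cmod (m z) \<le> C" using bdd by blast
    have "cmod (m (snd p) * h p) \<le> max C 0 * cmod (h p)" for p
    proof (cases "norm p > R")
      case False
      then have "norm (snd p) \<le> R" using norm_snd_le[of "snd p" "fst p"] by simp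
      then have "cmod (m (snd p)) \<le> max C 0" using C by fastforce
      then show ?thesis by (simp add: norm_mult mult_right_mono)
    qed (simp add: R)
    then have "L2 (\<lambda>p. m (snd p) * h p)"
      by (intro L2_bound(1)[OF L2_bdd_L2[OF h], of _ "max C 0"]) auto
    then show ?thesis using R by (auto simp: L2_bdd_def)
  qed
  have ind: "L2_bdd (indicator (box a b) :: 'a \<times> 'b \<Rightarrow> complex)" for a b :: "'a \<times> 'b"
    by (intro L2_bdd_indicator) auto
  have eq: "indicator (box a b) z *\<^sub>R (G z - m (snd z) * F z) = G z * indicator (box a b) z - F z * (m (snd z) * indicator (box a b) z)" for a b z
    by (auto simp: indicator_def)
  have i: "integrable lborel (\<lambda>z. G z * indicator (box a b) z)" "integrable lborel (\<lambda>z. F z * (m (snd z) * indicator (box a b) z))" for a b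
    by (intro L2_mult_bound is_FT_L2[OF G] is_FT_L2[OF F] L2_bdd_L2 ind mh)+
  \<comment> \<open>The product of \<open>m\<close> and \<open>F\<close> is not yet known to be in
    L2, so the criterion for locally integrable functions is used; membership in L2 then follows
    from the identity itself.\<close>
  have "AE z in lborel. G z - m (snd z) * F z = 0"
  proof (rule AE_zero_if_box_integrals_zero; unfold eq)
    fix a b :: "'a \<times> 'b"
    let ?h = "indicator (box a b) :: 'a \<times> 'b \<Rightarrow> complex"
    have "(LINT z|lborel. G z * ?h z) = (LINT z|lborel. m (snd z) * f z * fourier_fst ?h z)"
      by (rule is_FT_test[OF G ind])
    also have "\<dots> = (LINT z|lborel. f z * fourier_fst (\<lambda>p. m (snd p) * ?h p) z)"
      by (simp add: fourier_fst_def fourier_cmult mult_ac)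
    also have "\<dots> = (LINT z|lborel. F z * (m (snd z) * ?h z))"
      by (rule is_FT_test[OF F mh[OF ind], symmetric])
    finally show "(LINT z|lborel. G z * ?h z - F z * (m (snd z) * ?h z)) = 0"
      using i by simp
  qed (use i in auto)
  then have ae: "AE z in lborel. G z = m (snd z) * F z" by simp
  have "L2 (\<lambda>p. m (snd p) * F p)"
    by (rule L2_cong_AE(1)[OF is_FT_L2(2)[OF G]]) (use ae in auto)
  then show ?thesis
    by (rule is_FT_cong[OF G L2]) (use ae in auto)
qed

text \<open>Here square integrability is known on the transformed side; inversion exchanges the two
  sides of \<open>is_FT_multiplier\<close>.\<close>

lemma is_FT_multiplier_inverse:
  fixes m :: "'b::euclidean_space \<Rightarrow> complex" and f :: "'a::euclidean_space \<times> 'b \<Rightarrow> complex"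
  assumes F: "is_FT f F" and m [measurable]: "m \<in> borel_measurable borel"
    and bdd: "\<And>R. \<exists>C. \<forall>z. norm z \<le> R \<longrightarrow> cmod (m z) \<le> C"
    and L2: "L2 (\<lambda>p. m (snd p) * F p)"
  shows "is_FT (\<lambda>p. m (snd p) * f p) (\<lambda>p. m (snd p) * F p)"
proof -
  have "is_FT (\<lambda>p. cnj (m (snd p)) * cnj (F p)) (\<lambda>p. cnj (m (snd p)) * cnj (f p))"
    by (rule is_FT_multiplier[OF is_FT_inversion[OF F]]) (use bdd L2_cnj[OF L2] in auto)
  from is_FT_inversion[OF this] show ?thesis by simp
qed

section \<open>Rearranging coordinates\<close>

text \<open>\<open>J\<close> permutes coordinates, so the preimage of a box is a box with the same
  edge lengths in another order, and the measure is determined by its values on boxes.\<close>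

lemma measure_preserving_permute_Basis:
  fixes J :: "'a::euclidean_space \<Rightarrow> 'b::euclidean_space"
  assumes J: "linear J" "bij_betw J Basis Basis"
  shows "measure_preserving_lborel J"
proof -
  have inner: "J x \<bullet> J b = x \<bullet> b" if b: "b \<in> Basis" for x b
  proof -
    have "J x = (\<Sum>c\<in>Basis. (x \<bullet> c) *\<^sub>R J c)"
      by (subst (1) euclidean_representation[of x, symmetric]) (simp add: linear_sum[OF J(1)] linear_scale[OF J(1)])
    then have "J x \<bullet> J b = (\<Sum>c\<in>Basis. (x \<bullet> c) * (J c \<bullet> J b))"
      by (simp add: inner_sum_left)
    also have "\<dots> = (\<Sum>c\<in>Basis. if c = b then x \<bullet> c else 0)"
    proof (intro sum.cong refl)
      fix c :: 'a assume c: "c \<in> Basis"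
      have "J c \<in> Basis" "J b \<in> Basis" "J c = J b \<longleftrightarrow> c = b"
        using J(2) b c by (auto simp: bij_betw_def inj_on_eq_iff)
      then show "(x \<bullet> c) * (J c \<bullet> J b) = (if c = b then x \<bullet> c else 0)" by (simp add: inner_Basis)
    qed
    also have "\<dots> = x \<bullet> b" using b by simp
    finally show ?thesis .
  qed
  have meas: "J \<in> borel_measurable borel"
    using linear_continuous_on[of J UNIV] J(1) by (auto intro!: borel_measurable_continuous_onI simp: linear_conv_bounded_linear)
  have "lborel = distr lborel borel J"
  proof (rule lborel_eqI)
    fix l u :: 'b assume le: "\<And>b. b \<in> Basis \<Longrightarrow> l \<bullet> b \<le> u \<bullet> b"
    define l' u' where "l' = (\<Sum>b\<in>Basis. (l \<bullet> J b) *\<^sub>R b)" and "u' = (\<Sum>b\<in>Basis. (u \<bullet> J b) *\<^sub>R b)"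
    have lu: "l' \<bullet> b = l \<bullet> J b" "u' \<bullet> b = u \<bullet> J b" if "b \<in> Basis" for b
      using that by (simp_all add: l'_def u'_def)
    have img: "J ` Basis = Basis" using J(2) by (simp add: bij_betw_def)
    have "J -` box l u = box l' u'"
    proof (intro set_eqI)
      fix x
      have "x \<in> J -` box l u \<longleftrightarrow> (\<forall>b\<in>J ` Basis. l \<bullet> b < J x \<bullet> b \<and> J x \<bullet> b < u \<bullet> b)"
        unfolding img by (simp add: mem_box)
      also have "\<dots> \<longleftrightarrow> x \<in> box l' u'" by (simp add: mem_box lu inner)
      finally show "x \<in> J -` box l u \<longleftrightarrow> x \<in> box l' u'" .
    qed
    then have "emeasure (distr lborel borel J) (box l u) = emeasure lborel (box l' u')"
      using meas by (simp add: emeasure_distr)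
    also have "\<dots> = ennreal (\<Prod>b\<in>Basis. (u' - l') \<bullet> b)"
      using le J(2) by (intro emeasure_lborel_box) (auto simp: lu bij_betw_def)
    also have "(\<Prod>b\<in>Basis. (u' - l') \<bullet> b) = (\<Prod>b\<in>Basis. (u - l) \<bullet> J b)"
      by (intro prod.cong refl) (simp add: inner_diff_left lu)
    also have "\<dots> = (\<Prod>b\<in>Basis. (u - l) \<bullet> b)"
      using J(2) by (rule prod.reindex_bij_betw)
    finally show "emeasure (distr lborel borel J) (box l u) = ennreal (\<Prod>b\<in>Basis. (u - l) \<bullet> b)" .
  qed simp
  then show ?thesis using meas by (simp add: measure_preserving_lborel_def)
qed

lemma measure_preserving_compose:
  fixes f :: "'b::euclidean_space \<Rightarrow> 'c::euclidean_space" and g :: "'a::euclidean_space \<Rightarrow> 'b"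
  assumes f: "measure_preserving_lborel f" and g: "measure_preserving_lborel g"
  shows "measure_preserving_lborel (\<lambda>x. f (g x))"
proof -
  note [measurable] = mp_measurable[OF f] mp_measurable[OF g]
  have "distr lborel borel (\<lambda>x. f (g x)) = distr (distr lborel borel g) borel f"
    by (subst distr_distr) (auto simp: comp_def)
  also have "\<dots> = lborel" unfolding mp_distr[OF g] by (rule mp_distr[OF f])
  finally show ?thesis by (simp add: measure_preserving_lborel_def)
qed

section \<open>The transform in the second block\<close>

definition swap3 :: "'a \<times> ('b \<times> 'c) \<Rightarrow> 'b \<times> ('a \<times> 'c)" where
  "swap3 p = (fst (snd p), (fst p, snd (snd p)))"

lemma swap3_simps [simp]: "swap3 (a, (b, c)) = (b, (a, c))" "swap3 (swap3 p) = p"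
  "fst (swap3 p) = fst (snd p)" "fst (snd (swap3 p)) = fst p" "snd (snd (swap3 p)) = snd (snd p)"
  by (simp_all add: swap3_def)

lemma measure_preserving_swap3:
  "measure_preserving_lborel (swap3 :: 'a::euclidean_space \<times> ('b::euclidean_space \<times> 'c::euclidean_space) \<Rightarrow> _)"
proof (rule measure_preserving_permute_Basis)
  show "linear (swap3 :: 'a \<times> ('b \<times> 'c) \<Rightarrow> _)"
    by (rule linearI) (auto simp: swap3_def)
  show "bij_betw (swap3 :: 'a \<times> ('b \<times> 'c) \<Rightarrow> _) Basis Basis"
    by (rule bij_betwI[of _ _ _ swap3]) (auto simp: Basis_prod_def swap3_def zero_prod_def image_iff)
qed

lemma swap3_measurable [measurable]:
  "(swap3 :: 'a::euclidean_space \<times> ('b::euclidean_space \<times> 'c::euclidean_space) \<Rightarrow> _) \<in> borel_measurable borel"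
  using mp_measurable[OF measure_preserving_swap3] .

lemma norm_swap3 [simp]: "norm (swap3 p) = norm p"
  for p :: "'a::euclidean_space \<times> ('b::euclidean_space \<times> 'c::euclidean_space)"
  by (simp add: swap3_def norm_prod_def)

text \<open>Conjugation by \<open>swap3\<close> brings the second component to the front, so that
  the theory of \<open>is_FT\<close> carries over to transforms in that component.\<close>

definition is_FT2 :: "('a::euclidean_space \<times> ('b::euclidean_space \<times> 'c::euclidean_space) \<Rightarrow> complex) \<Rightarrow>
    ('a \<times> ('b \<times> 'c) \<Rightarrow> complex) \<Rightarrow> bool" where
  "is_FT2 f F \<longleftrightarrow> is_FT (\<lambda>p. f (swap3 p)) (\<lambda>p. F (swap3 p))"

lemma L2_swap3_iff:
  "L2 (\<lambda>p. f (swap3 p)) \<longleftrightarrow> L2 (f :: 'a::euclidean_space \<times> ('b::euclidean_space \<times> 'c::euclidean_space) \<Rightarrow> complex)"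
  using mp_L2[OF measure_preserving_swap3, of f] mp_L2[OF measure_preserving_swap3, of "\<lambda>p. f (swap3 p)"] by auto

lemma L2norm_swap3: "L2 f \<Longrightarrow> L2norm (\<lambda>p. f (swap3 p)) = L2norm f"
  for f :: "'a::euclidean_space \<times> ('b::euclidean_space \<times> 'c::euclidean_space) \<Rightarrow> complex"
  by (intro mp_L2norm measure_preserving_swap3) auto

lemma L2_bdd_swap3: "L2_bdd f \<Longrightarrow> L2_bdd (\<lambda>p. f (swap3 p))"
  for f :: "'a::euclidean_space \<times> ('b::euclidean_space \<times> 'c::euclidean_space) \<Rightarrow> complex"
  unfolding L2_bdd_def L2_swap3_iff by (metis norm_swap3)

lemma AE_swap3: "AE p in lborel. P p \<Longrightarrow> AE p in lborel. P (swap3 p)"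
  for P :: "'a::euclidean_space \<times> ('b::euclidean_space \<times> 'c::euclidean_space) \<Rightarrow> bool"
  by (rule mp_AE_dest[OF measure_preserving_swap3])

lemma is_FT2_L2: "is_FT2 f F \<Longrightarrow> L2 f" "is_FT2 f F \<Longrightarrow> L2 F"
  unfolding is_FT2_def using is_FT_L2[of "\<lambda>p. f (swap3 p)" "\<lambda>p. F (swap3 p)"] L2_swap3_iff by blast+

lemma is_FT2_ex: "L2 f \<Longrightarrow> \<exists>F. is_FT2 f F"
proof -
  assume "L2 f"
  then have "L2 (\<lambda>p. f (swap3 p))" by (simp add: L2_swap3_iff)
  then obtain F where "is_FT (\<lambda>p. f (swap3 p)) F" using is_FT_ex by blast
  then have "is_FT2 f (\<lambda>p. F (swap3 p))" by (simp add: is_FT2_def)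
  then show ?thesis by blast
qed

lemma is_FT2_norm: "is_FT2 f F \<Longrightarrow> L2norm F = L2norm f"
  using is_FT_norm[of "\<lambda>p. f (swap3 p)" "\<lambda>p. F (swap3 p)"] is_FT2_L2[of f F] L2norm_swap3[of f] L2norm_swap3[of F]
  by (simp add: is_FT2_def)

lemma is_FT2_unique: "is_FT2 f F \<Longrightarrow> is_FT2 f G \<Longrightarrow> AE z in lborel. F z = G z"
  using AE_swap3[OF is_FT_unique[of "\<lambda>p. f (swap3 p)" "\<lambda>p. F (swap3 p)" "\<lambda>p. G (swap3 p)"]]
  by (simp add: is_FT2_def)

lemma integral_swap3:
  fixes f :: "'a::euclidean_space \<times> ('b::euclidean_space \<times> 'c::euclidean_space) \<Rightarrow> complex"
  shows "f \<in> borel_measurable borel \<Longrightarrow> (LINT p|lborel. f (swap3 p)) = (LINT p|lborel. f p)"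
  by (rule mp_integral[OF measure_preserving_swap3])

lemma is_FT2_duality:
  assumes "is_FT2 f F" "is_FT2 h H"
  shows "(LINT p|lborel. F p * h p) = (LINT p|lborel. f p * H p)"
proof -
  have [measurable]: "f \<in> borel_measurable borel" "F \<in> borel_measurable borel" "h \<in> borel_measurable borel" "H \<in> borel_measurable borel"
    using is_FT2_L2[OF assms(1)] is_FT2_L2[OF assms(2)] by auto
  have "(LINT p|lborel. F p * h p) = (LINT p|lborel. F (swap3 p) * h (swap3 p))"
    by (rule integral_swap3[symmetric]) measurable
  also have "\<dots> = (LINT p|lborel. f (swap3 p) * H (swap3 p))"
    using assms unfolding is_FT2_def by (rule is_FT_duality)
  also have "\<dots> = (LINT p|lborel. f p * H p)"
    by (rule integral_swap3) measurable
  finally show ?thesis .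
qed

text \<open>The indicator of a box is a product, so for it the order of the two transforms visibly
  does not matter. Duality moves both transforms of \<open>u\<close> onto such indicators, and boxes
  determine the two sides.\<close>

lemma is_FT_commute:
  fixes u :: "'a::euclidean_space \<times> ('b::euclidean_space \<times> 'c::euclidean_space) \<Rightarrow> complex"
  assumes a: "is_FT u a" and b: "is_FT2 u b" and c: "is_FT b c" and d: "is_FT2 a d"
  shows "AE z in lborel. c z = d z"
proof (rule L2_eqI_box)
  fix l r :: "'a \<times> ('b \<times> 'c)"
  let ?h = "indicator (box l r) :: 'a \<times> ('b \<times> 'c) \<Rightarrow> complex"
  have h: "L2_bdd ?h" by (intro L2_bdd_indicator) auto
  obtain l1 l2 l3 r1 r2 r3 where lr: "l = (l1, (l2, l3))" "r = (r1, (r2, r3))" by (metis surj_pair)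
  have h_eq: "?h (x, (y, z)) = indicator (box l1 r1) x * (indicator (box l2 r2) y * indicator (box l3 r3) z)" for x y z
    unfolding lr box_Pair_times by (auto simp: indicator_def)
  define A where "A = fourier (indicator (box l1 r1))"
  define B where "B = fourier (indicator (box l2 r2))"
  \<comment> \<open>The transform of the box indicator in both blocks, to be reached once through
    \<open>h1\<close> and once through \<open>h2\<close>.\<close>
  define q where "q p = A (fst p) * (B (fst (snd p)) * indicator (box l3 r3) (snd (snd p)))" for p
  define h1 where "h1 = fourier_fst ?h"
  define h2 where "h2 p = fourier_fst (\<lambda>p. ?h (swap3 p)) (swap3 p)" for p
  have h1_eq: "h1 (x, (y, z)) = A x * (indicator (box l2 r2) y * indicator (box l3 r3) z)" for x y z
    using fourier_cmult[of "indicator (box l2 r2) y * indicator (box l3 r3) z" "indicator (box l1 r1)" x]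
    by (simp add: h1_def fourier_fst_def h_eq A_def mult.commute)
  have h2_eq: "h2 (x, (y, z)) = B y * (indicator (box l1 r1) x * indicator (box l3 r3) z)" for x y z
    using fourier_cmult[of "indicator (box l1 r1) x * indicator (box l3 r3) z" "indicator (box l2 r2)" y]
    by (simp add: h2_def fourier_fst_def h_eq B_def mult_ac)
  have L2h1: "L2 h1" unfolding h1_def by (intro fourier_fst_L2 L2_bdd_imp_strip h)
  have L2h2: "L2 h2" unfolding h2_def L2_swap3_iff by (intro fourier_fst_L2 L2_bdd_imp_strip L2_bdd_swap3 h)
  obtain R1 where R1: "\<And>x. x \<in> box l1 r1 \<Longrightarrow> norm x \<le> R1"
    using bounded_box[of l1 r1] by (auto simp: bounded_iff)
  obtain R2 where R2: "\<And>x. x \<in> box l2 r2 \<Longrightarrow> norm x \<le> R2"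
    using bounded_box[of l2 r2] by (auto simp: bounded_iff)
  \<comment> \<open>\<open>h1\<close> need not have bounded support, but its second component is
    still confined to a box; after the swap this is exactly what a strip requires.\<close>
  have "L2_strip (\<lambda>p. h1 (swap3 p))"
    unfolding L2_strip_def L2_swap3_iff
    using L2h1 R2 by (auto intro!: exI[of _ R2] simp: h1_eq indicator_def not_le[symmetric])
  from is_FT_fourier_fst[OF this] have "is_FT (\<lambda>p. h1 (swap3 p)) (fourier_fst (\<lambda>p. h1 (swap3 p)))" .
  moreover have "fourier_fst (\<lambda>p. h1 (swap3 p)) = (\<lambda>p. q (swap3 p))"
  proof
    fix p :: "'b \<times> ('a \<times> 'c)"
    obtain y x z where p: "p = (y, (x, z))" by (metis surj_pair)
    show "fourier_fst (\<lambda>p. h1 (swap3 p)) p = q (swap3 p)"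
      using fourier_cmult[of "A x * indicator (box l3 r3) z" "indicator (box l2 r2)" y]
      by (simp add: p fourier_fst_def h1_eq q_def B_def mult_ac)
  qed
  ultimately have q1: "is_FT2 h1 q" by (simp add: is_FT2_def)
  have "L2_strip h2"
    unfolding L2_strip_def using L2h2 R1 by (auto intro!: exI[of _ R1] simp: h2_eq indicator_def not_le[symmetric])
  from is_FT_fourier_fst[OF this] have "is_FT h2 (fourier_fst h2)" .
  moreover have "fourier_fst h2 = q"
  proof
    fix p :: "'a \<times> ('b \<times> 'c)"
    obtain y x z where p: "p = (x, (y, z))" by (metis surj_pair)
    show "fourier_fst h2 p = q p"
      using fourier_cmult[of "B y * indicator (box l3 r3) z" "indicator (box l1 r1)" x]
      by (simp add: p fourier_fst_def h2_eq q_def A_def mult_ac)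
  qed
  ultimately have q2: "is_FT h2 q" by simp
  have h2': "is_FT2 ?h h2"
    using is_FT_fourier_fst[OF L2_bdd_imp_strip[OF L2_bdd_swap3[OF h]]] by (simp add: is_FT2_def h2_def)
  have "(LINT z|lborel. c z * ?h z) = (LINT z|lborel. b z * h1 z)"
    unfolding h1_def by (rule is_FT_test[OF c h])
  also have "\<dots> = (LINT z|lborel. u z * q z)" by (rule is_FT2_duality[OF b q1])
  also have "\<dots> = (LINT z|lborel. a z * h2 z)" by (rule is_FT_duality[OF a q2, symmetric])
  also have "\<dots> = (LINT z|lborel. d z * ?h z)" by (rule is_FT2_duality[OF d h2', symmetric])
  finally show "(LINT z|lborel. c z * ?h z) = (LINT z|lborel. d z * ?h z)" .
qed (use c d is_FT_L2 is_FT2_L2 in auto)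

text \<open>\<open>is_partial_fourier\<close> is a limit of truncated integrals,
  \<open>is_FT\<close> a duality relation, and \<open>J\<close> brings the block selected by
  \<open>\<iota>\<close> to the front. The truncated integrals correspond under \<open>J\<close>, so
  uniqueness of L2 limits identifies the two notions.\<close>

lemma is_partial_fourier_iff_is_FT:
  fixes J :: "(real ^ 'm::finite) \<times> 'b::euclidean_space \<Rightarrow> (real ^ 'n::finite) \<times> real"
  assumes J: "measure_preserving_lborel J" and J': "measure_preserving_lborel J'"
    and inv: "\<And>p. J' (J p) = p" "\<And>z. J (J' z) = z"
    and bdd: "\<And>r. bounded (J -` cball 0 r)"
    and pfi: "\<And>f p. partial_fourier_integral \<iota> f (J p) = fourier_fst (\<lambda>p. f (J p)) p"
    and f: "L2 f"
  shows "is_partial_fourier \<iota> f F \<longleftrightarrow> is_FT (\<lambda>p. f (J p)) (\<lambda>p. F (J p))"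
proof -
  note [measurable] = mp_measurable[OF J] mp_measurable[OF J']
  define S where "S n = J -` cball 0 (real n)" for n
  have "J -` cball 0 (real n) \<in> sets borel" for n
    using measurable_sets[OF mp_measurable[OF J], of "cball 0 (real n)"] by simp
  then have S: "bounded (S n)" "S n \<in> sets borel" for n unfolding S_def using bdd by auto
  have S': "eventually (\<lambda>n. z \<in> S n) sequentially" for z
    unfolding S_def using eventually_mem_cball[of "J z"] by simp
  define fn where "fn n z = indicator (S n) z *\<^sub>R f (J z)" for n z
  have fJ: "L2 (\<lambda>p. f (J p))" by (rule mp_L2[OF J f])
  have L2n: "L2 (fourier_fst (fn n))" for n
    unfolding fn_def by (intro fourier_fst_L2 L2_bdd_imp_strip L2_bdd_truncation fJ S)
  have eq: "partial_fourier_integral \<iota> (\<lambda>z. indicator (cball 0 (real n)) z *\<^sub>R f z) (J p) = fourier_fst (fn n) p" for n p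
    unfolding pfi fn_def S_def by (simp add: indicator_def)
  have iff: "L2 g \<longleftrightarrow> L2 (\<lambda>p. g (J p))" for g
    using mp_L2[OF J, of g] mp_L2[OF J', of "\<lambda>p. g (J p)"] by (auto simp: inv)
  have nrm: "L2 (\<lambda>p. g (J p)) \<Longrightarrow> L2norm g = L2norm (\<lambda>p. g (J p))" for g
    using mp_L2norm[OF J, of g] iff[of g] by auto
  show ?thesis
  proof
    assume "is_partial_fourier \<iota> f F"
    then have F: "L2 F" "(\<lambda>n. L2norm (\<lambda>z. partial_fourier_integral \<iota> (\<lambda>z. indicator (cball 0 (real n)) z *\<^sub>R f z) z - F z)) \<longlonglongrightarrow> 0"
      by (auto simp: is_partial_fourier_def tendsto_L2_def)
    have FJ: "L2 (\<lambda>p. F (J p))" by (rule mp_L2[OF J F(1)])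
    have lim: "(\<lambda>n. L2norm (\<lambda>p. fourier_fst (fn n) p - F (J p))) \<longlonglongrightarrow> 0"
      using F(2) by (subst (asm) nrm) (auto simp: eq intro!: L2_diff L2n FJ)
    obtain G where G: "is_FT (\<lambda>p. f (J p)) G" "(\<lambda>n. L2norm (\<lambda>z. fourier_fst (fn n) z - G z)) \<longlonglongrightarrow> 0"
      using is_FT_truncation_ex[OF fJ S S'] unfolding fn_def by blast
    have "L2norm (\<lambda>p. G p - F (J p)) \<le> 0"
    proof (rule LIMSEQ_le_const)
      show "(\<lambda>n. L2norm (\<lambda>z. fourier_fst (fn n) z - G z) + L2norm (\<lambda>p. fourier_fst (fn n) p - F (J p))) \<longlonglongrightarrow> 0"
        using tendsto_add[OF G(2) lim] by simp
      show "\<exists>N. \<forall>n\<ge>N. L2norm (\<lambda>p. G p - F (J p)) \<le> L2norm (\<lambda>z. fourier_fst (fn n) z - G z) + L2norm (\<lambda>p. fourier_fst (fn n) p - F (J p))"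
        using L2norm_triangle_diff[OF is_FT_L2(2)[OF G(1)] L2n FJ]
        by (auto simp: L2norm_minus_commute[of G])
    qed
    then have "AE p in lborel. G p - F (J p) = 0"
      by (intro L2norm_eq_0_AE L2_diff is_FT_L2(2)[OF G(1)] FJ antisym) auto
    then show "is_FT (\<lambda>p. f (J p)) (\<lambda>p. F (J p))"
      by (intro is_FT_cong[OF G(1)] fJ FJ) auto
  next
    assume F: "is_FT (\<lambda>p. f (J p)) (\<lambda>p. F (J p))"
    note FJ = is_FT_L2(2)[OF F]
    have lim: "(\<lambda>n. L2norm (\<lambda>z. fourier_fst (fn n) z - F (J z))) \<longlonglongrightarrow> 0"
      unfolding fn_def by (rule is_FT_truncation[OF F S S'])
    show "is_partial_fourier \<iota> f F"
      unfolding is_partial_fourier_def tendsto_L2_def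
    proof (intro conjI allI)
      show "L2 F" using FJ iff by blast
      show *: "L2 (\<lambda>z. partial_fourier_integral \<iota> (\<lambda>z. indicator (cball 0 (real n)) z *\<^sub>R f z) z - F z)" for n
        by (subst iff) (auto simp: eq intro!: L2_diff L2n FJ)
      show "(\<lambda>n. L2norm (\<lambda>z. partial_fourier_integral \<iota> (\<lambda>z. indicator (cball 0 (real n)) z *\<^sub>R f z) z - F z)) \<longlonglongrightarrow> 0"
        using lim by (subst nrm) (auto simp: eq intro!: L2_diff L2n FJ)
    qed
  qed
qed

section \<open>Separating the two blocks of \<open>x\<close> and time\<close>

definition join_coords :: "(real ^ 'm0::finite) \<times> ((real ^ 'm1::finite) \<times> real) \<Rightarrow> (real ^ ('m0 + 'm1)) \<times> real" where
  "join_coords p = ((\<chi> k. case k of Inl i \<Rightarrow> fst p $ i | Inr i \<Rightarrow> fst (snd p) $ i), snd (snd p))"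

definition split_coords :: "(real ^ ('m0::finite + 'm1::finite)) \<times> real \<Rightarrow> (real ^ 'm0) \<times> ((real ^ 'm1) \<times> real)" where
  "split_coords z = (block Inl (fst z), (block Inr (fst z), snd z))"

lemma split_join_coords [simp]: "split_coords (join_coords p) = p"
  by (simp add: join_coords_def split_coords_def block_def vec_eq_iff prod_eq_iff)

lemma join_split_coords [simp]: "join_coords (split_coords z) = z"
  by (auto simp: join_coords_def split_coords_def block_def vec_eq_iff prod_eq_iff split: sum.split)

lemma linear_join_coords: "linear join_coords"
  by (rule linearI) (auto simp: join_coords_def vec_eq_iff split: sum.split)

lemma linear_split_coords: "linear split_coords"
  by (rule linearI) (auto simp: split_coords_def block_def vec_eq_iff)

lemma join_coords_Basis: "p \<in> Basis \<Longrightarrow> join_coords p \<in> Basis"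
proof -
  assume "p \<in> Basis"
  then consider (a) i where "p = (axis i 1, 0)" | (b) i where "p = (0, (axis i 1, 0))" | (c) "p = (0, (0, 1))"
    by (auto simp: Basis_prod_def Basis_vec_def)
  then show ?thesis
  proof cases
    case (a i)
    then have "join_coords p = (axis (Inl i) 1, 0)"
      by (auto simp: join_coords_def axis_def vec_eq_iff split: sum.split)
    then show ?thesis by (auto simp: Basis_prod_def Basis_vec_def)
  next
    case (b i)
    then have "join_coords p = (axis (Inr i) 1, 0)"
      by (auto simp: join_coords_def axis_def vec_eq_iff split: sum.split)
    then show ?thesis by (auto simp: Basis_prod_def Basis_vec_def)
  next
    case c
    then have "join_coords p = (0, 1)"
      by (auto simp: join_coords_def vec_eq_iff split: sum.split)
    then show ?thesis by (auto simp: Basis_prod_def)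
  qed
qed

lemma split_coords_Basis: "z \<in> Basis \<Longrightarrow> split_coords z \<in> Basis"
proof -
  assume "z \<in> Basis"
  then consider (a) k where "z = (axis k 1, 0)" | (c) "z = (0, 1)"
    by (auto simp: Basis_prod_def Basis_vec_def)
  then show ?thesis
  proof cases
    case (a k)
    show ?thesis
    proof (cases k)
      case (Inl i)
      with a have "split_coords z = (axis i 1, 0)"
        by (auto simp: split_coords_def block_def axis_def vec_eq_iff zero_prod_def)
      then show ?thesis by (auto simp: Basis_prod_def Basis_vec_def)
    next
      case (Inr i)
      with a have "split_coords z = (0, (axis i 1, 0))"
        by (auto simp: split_coords_def block_def axis_def vec_eq_iff)
      then show ?thesis by (auto simp: Basis_prod_def Basis_vec_def image_iff)
    qed
  next
    case c
    then have "split_coords z = (0, (0, 1))"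
      by (auto simp: split_coords_def block_def vec_eq_iff)
    then show ?thesis by (auto simp: Basis_prod_def)
  qed
qed

lemma measure_preserving_join_coords: "measure_preserving_lborel join_coords"
  by (rule measure_preserving_permute_Basis[OF linear_join_coords], rule bij_betwI[of _ _ _ split_coords])
     (simp_all add: join_coords_Basis split_coords_Basis Pi_iff)

lemma measure_preserving_split_coords: "measure_preserving_lborel split_coords"
  by (rule measure_preserving_permute_Basis[OF linear_split_coords], rule bij_betwI[of _ _ _ join_coords])
     (simp_all add: join_coords_Basis split_coords_Basis Pi_iff)

lemma block_join_coords [simp]: "block Inl (fst (join_coords p)) = fst p" "block Inr (fst (join_coords p)) = fst (snd p)"
  using split_join_coords[of p] by (auto simp: split_coords_def prod_eq_iff simp del: split_join_coords)

text \<open>The preimage lies in the image of the ball under the left inverse, which is a bounded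
  linear map.\<close>

lemma bounded_linear_vimage_cball:
  fixes J :: "'a::euclidean_space \<Rightarrow> 'b::euclidean_space"
  assumes "linear K" "\<And>p. K (J p) = p"
  shows "bounded (J -` cball 0 r)"
proof (rule bounded_subset)
  show "bounded (K ` cball 0 r)"
    using assms(1) by (intro bounded_linear_image) (auto simp: linear_conv_bounded_linear)
  show "J -` cball 0 r \<subseteq> K ` cball 0 r"
    using assms(2) by (metis image_eqI subsetI vimage_eq)
qed

lemma is_partial_fourier_Inl:
  assumes "L2 f"
  shows "is_partial_fourier (Inl :: 'm0::finite \<Rightarrow> 'm0 + 'm1::finite) f F \<longleftrightarrow> is_FT (\<lambda>p. f (join_coords p)) (\<lambda>p. F (join_coords p))"
proof (rule is_partial_fourier_iff_is_FT[where J'=split_coords])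
  have sb: "set_block Inl y (fst (join_coords p)) = fst (join_coords (y, snd p))" for y :: "real ^ 'm0" and p :: "(real ^ 'm0) \<times> ((real ^ 'm1) \<times> real)"
    by (auto simp: set_block_def join_coords_def vec_eq_iff inv_f_f split: sum.split)
  have js: "snd (join_coords p) = snd (join_coords (y, snd p))" for y :: "real ^ 'm0" and p :: "(real ^ 'm0) \<times> ((real ^ 'm1) \<times> real)"
    by (simp add: join_coords_def)
  show "partial_fourier_integral Inl f (join_coords p) = fourier_fst (\<lambda>p. f (join_coords p)) p"
    for f and p :: "(real ^ 'm0) \<times> ((real ^ 'm1) \<times> real)"
  proof -
    have "(set_block Inl y (fst (join_coords p)), snd (join_coords p)) = join_coords (y, snd p)" for y :: "real ^ 'm0"
      by (simp add: prod_eq_iff sb js[of p y])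
    then show ?thesis
      by (simp add: partial_fourier_integral_def fourier_fst_def fourier_def)
  qed
  show "bounded (join_coords -` cball 0 r)" for r
    by (rule bounded_linear_vimage_cball[OF linear_split_coords]) simp
qed (simp_all add: measure_preserving_join_coords measure_preserving_split_coords assms)

lemma is_partial_fourier_Inr:
  assumes "L2 f"
  shows "is_partial_fourier (Inr :: 'm1::finite \<Rightarrow> 'm0::finite + 'm1) f F \<longleftrightarrow> is_FT2 (\<lambda>p. f (join_coords p)) (\<lambda>p. F (join_coords p))"
  unfolding is_FT2_def
proof (rule is_partial_fourier_iff_is_FT[where J'="\<lambda>z. swap3 (split_coords z)"])
  have sb: "set_block Inr y (fst (join_coords (swap3 p))) = fst (join_coords (swap3 (y, snd p)))" for y :: "real ^ 'm1" and p :: "(real ^ 'm1) \<times> ((real ^ 'm0) \<times> real)"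
    by (auto simp: set_block_def join_coords_def vec_eq_iff inv_f_f swap3_def split: sum.split)
  have js: "snd (join_coords (swap3 p)) = snd (join_coords (swap3 (y, snd p)))" for y :: "real ^ 'm1" and p :: "(real ^ 'm1) \<times> ((real ^ 'm0) \<times> real)"
    by (simp add: join_coords_def swap3_def)
  show "partial_fourier_integral Inr f (join_coords (swap3 p)) = fourier_fst (\<lambda>p. f (join_coords (swap3 p))) p"
    for f and p :: "(real ^ 'm1) \<times> ((real ^ 'm0) \<times> real)"
  proof -
    have "(set_block Inr y (fst (join_coords (swap3 p))), snd (join_coords (swap3 p))) = join_coords (swap3 (y, snd p))" for y :: "real ^ 'm1"
      by (simp add: prod_eq_iff sb js[of p y])
    then show ?thesis
      by (simp add: partial_fourier_integral_def fourier_fst_def fourier_def)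
  qed
  show "measure_preserving_lborel (\<lambda>p. join_coords (swap3 p))"
    by (rule measure_preserving_compose[OF measure_preserving_join_coords measure_preserving_swap3])
  show "measure_preserving_lborel (\<lambda>z. swap3 (split_coords z))"
    by (rule measure_preserving_compose[OF measure_preserving_swap3 measure_preserving_split_coords])
  have "linear (\<lambda>z. swap3 (split_coords z))"
    by (intro linearI)
       (simp_all add: swap3_def linear_add[OF linear_split_coords] linear_scale[OF linear_split_coords])
  then show "bounded ((\<lambda>p. join_coords (swap3 p)) -` cball 0 r)" for r
    by (rule bounded_linear_vimage_cball) simp
qed (simp_all add: assms)

section \<open>Test functions\<close>

lemma has_derivative_pderiv_dir:
  assumes "(f has_derivative D) (at z)"
  shows "pderiv_dir b f z = D b"
  using frechet_derivative_at[OF assms] by (simp add: pderiv_dir_def)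

lemma Ck_Suc_differentiable: "Ck (Suc k) f \<Longrightarrow> (f has_derivative frechet_derivative f (at z)) (at z)"
  by (simp add: frechet_derivative_works[symmetric])

lemma Ck_SucI:
  assumes "\<And>z. (f has_derivative D z) (at z)" "\<And>b. b \<in> Basis \<Longrightarrow> Ck k (\<lambda>z. D z b)"
  shows "Ck (Suc k) f"
proof -
  have "pderiv_dir b f = (\<lambda>z. D z b)" for b
    using has_derivative_pderiv_dir[OF assms(1)] by auto
  then show ?thesis using assms by (auto simp: differentiable_def)
qed

lemma Ck_continuous: "Ck k f \<Longrightarrow> continuous_on UNIV f"
  by (cases k) (auto intro!: continuous_at_imp_continuous_on differentiable_imp_continuous_within)

lemma Ck_Suc_imp_Ck: "Ck (Suc k) f \<Longrightarrow> Ck k f"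
proof (induction k arbitrary: f)
  case 0
  then show ?case using Ck_continuous[of "Suc 0" f] by simp
next
  case (Suc k)
  from Suc.prems have "\<forall>z. f differentiable (at z)" "\<forall>b\<in>Basis. Ck (Suc k) (pderiv_dir b f)"
    unfolding Ck.simps(2)[of "Suc k" f] by blast+
  with Suc.IH show ?case by (subst Ck.simps(2)) blast
qed

lemma Ck_const: "Ck k (\<lambda>_. c)"
proof (induction k arbitrary: c)
  case (Suc k)
  show ?case by (rule Ck_SucI[where D="\<lambda>_ _. 0"]) (use Suc in auto)
qed simp

lemma Ck_add: "Ck k f \<Longrightarrow> Ck k g \<Longrightarrow> Ck k (\<lambda>z. f z + g z)"
proof (induction k arbitrary: f g)
  case (Suc k)
  show ?case
    by (rule Ck_SucI, rule has_derivative_add[OF Ck_Suc_differentiable[OF Suc.prems(1)] Ck_Suc_differentiable[OF Suc.prems(2)]])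
       (use Suc in \<open>auto simp: pderiv_dir_def[abs_def]\<close>)
qed (auto intro: continuous_intros)

lemma Ck_mult: "Ck k f \<Longrightarrow> Ck k g \<Longrightarrow> Ck k (\<lambda>z. f z * g z)"
proof (induction k arbitrary: f g)
  case (Suc k)
  have fg: "Ck k f" "Ck k g" using Suc.prems Ck_Suc_imp_Ck by blast+
  show ?case
  proof (rule Ck_SucI, rule has_derivative_mult[OF Ck_Suc_differentiable[OF Suc.prems(1)] Ck_Suc_differentiable[OF Suc.prems(2)]])
    fix b :: 'a assume b: "b \<in> Basis"
    then have "Ck k (\<lambda>z. frechet_derivative f (at z) b)" "Ck k (\<lambda>z. frechet_derivative g (at z) b)"
      using Suc.prems by (auto simp: pderiv_dir_def[abs_def])
    then show "Ck k (\<lambda>z. f z * frechet_derivative g (at z) b + frechet_derivative f (at z) b * g z)"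
      by (intro Ck_add Suc.IH fg)
  qed
qed (auto intro: continuous_intros)

lemma Ck_prod: "(\<And>i. i \<in> I \<Longrightarrow> Ck k (f i)) \<Longrightarrow> Ck k (\<lambda>z. \<Prod>i\<in>I. f i z)"
  by (induction I rule: infinite_finite_induct) (auto intro: Ck_const Ck_mult)

lemma Ck_sum: "(\<And>i. i \<in> I \<Longrightarrow> Ck k (f i)) \<Longrightarrow> Ck k (\<lambda>z. \<Sum>i\<in>I. f i z)"
  by (induction I rule: infinite_finite_induct) (auto intro: Ck_const Ck_add)

lemma Ck_inner: "Ck k (\<lambda>z. complex_of_real (z \<bullet> b))"
proof (cases k)
  case (Suc l)
  show ?thesis unfolding Suc
  proof (rule Ck_SucI)
    show "((\<lambda>z. complex_of_real (z \<bullet> b)) has_derivative (\<lambda>w. complex_of_real (w \<bullet> b))) (at z)" for z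
      by (intro derivative_intros has_derivative_of_real has_derivative_inner_left has_derivative_ident)
  qed (rule Ck_const)
qed (auto intro!: continuous_intros)

text \<open>\<open>Ck\<close> speaks of basis directions only, so the derivative in direction
  \<open>L b\<close> given by the chain rule is expanded into partial derivatives with constant
  coefficients.\<close>

lemma Ck_affine:
  assumes L: "linear L" and f: "Ck k f"
  shows "Ck k (\<lambda>z. f (L z + c))"
  using f
proof (induction k arbitrary: f)
  case 0
  have "continuous_on UNIV (\<lambda>z. L z + c)"
    using L by (intro continuous_intros linear_continuous_on) (simp add: linear_conv_bounded_linear)
  then show ?case using 0 by (auto intro: continuous_on_compose2)
next
  case (Suc k)
  have bl: "bounded_linear L" using L by (simp add: linear_conv_bounded_linear)
  show ?case
  proof (rule Ck_SucI)
    show "((\<lambda>z. f (L z + c)) has_derivative (\<lambda>w. frechet_derivative f (at (L z + c)) (L w))) (at z)" for z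
      by (rule has_derivative_compose[OF _ Ck_Suc_differentiable[OF Suc.prems]])
         (auto intro!: derivative_eq_intros bounded_linear.has_derivative[OF bl])
    fix b :: 'a
    have lin: "linear (frechet_derivative f (at z))" for z
      using Suc.prems by (intro linear_frechet_derivative) simp
    have "frechet_derivative f (at (L z + c)) (L b) = (\<Sum>d\<in>Basis. complex_of_real (L b \<bullet> d) * pderiv_dir d f (L z + c))" for z
      unfolding pderiv_dir_def
      by (subst euclidean_representation[of "L b", symmetric])
         (simp add: linear_sum[OF lin] linear_scale[OF lin] scaleR_conv_of_real)
    then show "Ck k (\<lambda>z. frechet_derivative f (at (L z + c)) (L b))"
      using Suc by (auto intro!: Ck_sum Ck_mult Ck_const)
  qed
qed

section \<open>Smooth bumps and the fundamental lemma of the calculus of variations\<close>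

definition bump :: "nat \<Rightarrow> real \<Rightarrow> real" where
  "bump p x = (if x \<le> 0 then 0 else exp (- (1 / x)) / x ^ p)"

lemma power_le_fact_exp:
  fixes x :: real
  assumes "x \<ge> 0"
  shows "x ^ n \<le> fact n * exp x"
proof -
  have "(\<Sum>k\<in>{n}. x ^ k /\<^sub>R fact k) \<le> (\<Sum>k. x ^ k /\<^sub>R fact k)"
    using assms by (intro sum_le_suminf summable_exp_generic) (auto simp: scaleR_conv_of_real)
  then show ?thesis by (simp add: exp_def field_simps)
qed

text \<open>One term of the exponential series at \<open>1 / x\<close>. The exponent is
  \<open>p + 2\<close> so that a quadratic bound remains, which makes the derivative at 0
  vanish.\<close>

lemma bump_bound: "\<bar>bump p x\<bar> \<le> fact (p + 2) * x\<^sup>2"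
proof (cases "x \<le> 0")
  case False
  then have x: "x > 0" by simp
  have "(1 / x) ^ (p + 2) \<le> fact (p + 2) * exp (1 / x)"
    using x by (intro power_le_fact_exp) simp
  then have "exp (- (1 / x)) \<le> fact (p + 2) * x ^ (p + 2)"
    using x by (simp add: exp_minus field_simps del: fact_Suc)
  then show ?thesis
    using x by (simp add: bump_def field_simps power_add power2_eq_square del: fact_Suc)
qed (simp add: bump_def)

text \<open>The denominator \<open>x ^ p\<close> is part of \<open>bump\<close> in order that the
  family be closed under differentiation; one induction then gives smoothness of all
  members.\<close>

lemma bump_has_derivative:
  "(bump p has_real_derivative (bump (p + 2) x - real p * bump (p + 1) x)) (at x)"
proof -
  consider "x < 0" | "x > 0" | "x = 0" by linarith
  then show ?thesis
  proof cases
    case 1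
    have "((\<lambda>_. 0) has_real_derivative 0) (at x)" by simp
    then have "(bump p has_real_derivative 0) (at x)"
      by (rule has_field_derivative_transform_within_open[of _ _ _ "{..<0}"]) (use 1 in \<open>auto simp: bump_def\<close>)
    then show ?thesis using 1 by (simp add: bump_def)
  next
    case 2
    have "((\<lambda>x. exp (- (1 / x)) / x ^ p) has_real_derivative (bump (p + 2) x - real p * bump (p + 1) x)) (at x)"
      using 2 by (auto intro!: derivative_eq_intros simp: bump_def field_simps power2_eq_square power_diff)
         (cases p; simp add: field_simps)
    then show ?thesis
      by (rule has_field_derivative_transform_within_open[of _ _ _ "{0<..}"]) (use 2 in \<open>auto simp: bump_def\<close>)
  next
    case 3
    have "(\<lambda>h. bump p (0 + h) / h) \<midarrow>0\<rightarrow> 0"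
    proof (rule Lim_null_comparison)
      show "\<forall>\<^sub>F h in at 0. norm (bump p (0 + h) / h) \<le> fact (p + 2) * \<bar>h\<bar>"
      proof (rule always_eventually, rule allI)
        fix h show "norm (bump p (0 + h) / h) \<le> fact (p + 2) * \<bar>h\<bar>"
          using bump_bound[of p h]
          by (cases "h = 0") (auto simp: abs_divide pos_divide_le_eq power2_eq_square abs_mult mult.assoc simp del: fact_Suc)
      qed
      show "(\<lambda>h::real. fact (p + 2) * \<bar>h\<bar>) \<midarrow>0\<rightarrow> 0"
        by (intro tendsto_mult_right_zero tendsto_rabs_zero tendsto_ident_at)
    qed
    then show ?thesis unfolding 3 DERIV_def by (simp add: bump_def)
  qed
qed

lemma Ck_bump:
  assumes q: "\<And>k. Ck k (\<lambda>z. complex_of_real (q z))"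
  shows "Ck k (\<lambda>z. complex_of_real (bump p (q z)))"
proof (induction k arbitrary: p)
  case 0
  have "isCont (bump p) x" for x by (rule DERIV_isCont[OF bump_has_derivative])
  then have "continuous_on UNIV (bump p)" by (simp add: continuous_at_imp_continuous_on)
  moreover have "continuous_on UNIV (\<lambda>z. Re (complex_of_real (q z)))"
    using q[of 0] by (intro continuous_intros) simp
  ultimately have "continuous_on UNIV (\<lambda>z. bump p (q z))"
    by (auto intro: continuous_on_compose2)
  then show ?case by (auto intro: continuous_intros)
next
  case (Suc k)
  have dq: "((\<lambda>z. complex_of_real (q z)) has_derivative frechet_derivative (\<lambda>z. complex_of_real (q z)) (at z)) (at z)" for z
    by (rule Ck_Suc_differentiable[OF q[of "Suc 0"]])
  define D where "D z = frechet_derivative (\<lambda>z. complex_of_real (q z)) (at z)" for z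
  have dq': "(q has_derivative (\<lambda>w. Re (D z w))) (at z)" for z
    using has_derivative_Re[OF dq] by (simp add: D_def)
  \<comment> \<open>The derivative of a real-valued function has no imaginary part, so the real
    chain rule can be rewritten as a product of complex functions to which \<open>Ck_mult\<close>
    applies.\<close>
  have D_real: "complex_of_real (Re (D z w)) = D z w" for z w
  proof -
    have "((\<lambda>z. Im (complex_of_real (q z))) has_derivative (\<lambda>w. Im (D z w))) (at z)"
      using has_derivative_Im[OF dq] by (simp add: D_def)
    then have "((\<lambda>z. 0) has_derivative (\<lambda>w. Im (D z w))) (at z)" by simp
    then have "(\<lambda>w. Im (D z w)) = (\<lambda>w. 0)"
      by (rule has_derivative_unique) (rule has_derivative_const)
    then show ?thesis by (simp add: complex_eq_iff fun_eq_iff)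
  qed
  show ?case
  proof (rule Ck_SucI)
    have "((\<lambda>z. bump p (q z)) has_derivative (\<lambda>w. (bump (p + 2) (q z) - real p * bump (p + 1) (q z)) * Re (D z w))) (at z)" for z
      using has_derivative_compose[OF dq' bump_has_derivative[of p, unfolded has_field_derivative_def]] by simp
    then show "((\<lambda>z. complex_of_real (bump p (q z))) has_derivative
        (\<lambda>w. complex_of_real ((bump (p + 2) (q z) - real p * bump (p + 1) (q z)) * Re (D z w)))) (at z)" for z
      by (rule has_derivative_of_real)
    fix b :: 'a assume "b \<in> Basis"
    then have "Ck k (\<lambda>z. D z b)"
      using q[of "Suc k"] by (simp add: D_def pderiv_dir_def[abs_def])
    moreover have "complex_of_real ((bump (p + 2) (q z) - real p * bump (p + 1) (q z)) * Re (D z b))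
      = (complex_of_real (bump (p + 2) (q z)) + complex_of_real (- real p) * complex_of_real (bump (p + 1) (q z))) * D z b" for z
      by (simp add: D_real)
    ultimately show "Ck k (\<lambda>z. complex_of_real ((bump (p + 2) (q z) - real p * bump (p + 1) (q z)) * Re (D z b)))"
      using Suc.IH by (simp only:) (intro Ck_mult Ck_add Ck_const)
  qed
qed

text \<open>For c > 0 the values exp (- 1 / ((n + 1) c)) increase to 1 with n, so these smooth
  functions approximate the indicator of the box.\<close>

definition box_bump :: "'a::euclidean_space \<Rightarrow> 'a \<Rightarrow> nat \<Rightarrow> 'a \<Rightarrow> complex" where
  "box_bump l r n z = (\<Prod>b\<in>Basis. complex_of_real (bump 0 (real (Suc n) * ((z \<bullet> b - l \<bullet> b) * (r \<bullet> b - z \<bullet> b)))))"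

text \<open>The corners must be ordered: a coordinate strictly between exchanged corners would make
  both factors negative and their product positive.\<close>

lemma box_bump_outside:
  assumes "\<And>b. b \<in> Basis \<Longrightarrow> l \<bullet> b \<le> r \<bullet> b" "z \<notin> box l r"
  shows "box_bump l r n z = 0"
proof -
  obtain b where b: "b \<in> Basis" "\<not> (l \<bullet> b < z \<bullet> b \<and> z \<bullet> b < r \<bullet> b)"
    using assms(2) by (auto simp: mem_box)
  then have "(z \<bullet> b - l \<bullet> b) * (r \<bullet> b - z \<bullet> b) \<le> 0"
    using assms(1)[OF b(1)] by (auto simp: mult_le_0_iff)
  then have "bump 0 (real (Suc n) * ((z \<bullet> b - l \<bullet> b) * (r \<bullet> b - z \<bullet> b))) = 0"
    by (auto simp: bump_def mult_le_0_iff)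
  then show ?thesis
    unfolding box_bump_def using b(1) by (intro prod_zero) auto
qed

lemma box_bump_norm_le: "cmod (box_bump l r n z) \<le> 1"
  unfolding box_bump_def by (auto simp: prod_norm[symmetric] bump_def intro!: prod_le_1)

lemma box_bump_tendsto:
  assumes "\<And>b. b \<in> Basis \<Longrightarrow> l \<bullet> b \<le> r \<bullet> b"
  shows "(\<lambda>n. box_bump l r n z) \<longlonglongrightarrow> indicator (box l r) z"
proof (cases "z \<in> box l r")
  case True
  have "(\<lambda>n. complex_of_real (bump 0 (real (Suc n) * ((z \<bullet> b - l \<bullet> b) * (r \<bullet> b - z \<bullet> b))))) \<longlonglongrightarrow> 1" if b: "b \<in> Basis" for b
  proof -
    define c where "c = (z \<bullet> b - l \<bullet> b) * (r \<bullet> b - z \<bullet> b)"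
    have c: "c > 0" using True b by (auto simp: c_def mem_box)
    have "(\<lambda>n. complex_of_real (exp (- (inverse (real (Suc n)) * (1 / c))))) \<longlonglongrightarrow> complex_of_real (exp (- (0 * (1 / c))))"
      by (intro tendsto_intros LIMSEQ_inverse_real_of_nat)
    moreover have "bump 0 (real (Suc n) * c) = exp (- (inverse (real (Suc n)) * (1 / c)))" for n
      using c by (auto simp: bump_def mult_le_0_iff inverse_eq_divide)
    ultimately show ?thesis by (simp only: c_def[symmetric]) simp
  qed
  then have "(\<lambda>n. box_bump l r n z) \<longlonglongrightarrow> (\<Prod>b\<in>(Basis :: 'a set). 1)"
    unfolding box_bump_def by (intro tendsto_prod)
  then show ?thesis using True by simp
qed (simp add: box_bump_outside[OF assms])

lemma test_function_box_bump:
  assumes "\<And>b. b \<in> Basis \<Longrightarrow> l \<bullet> b \<le> r \<bullet> b"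
  shows "test_function (box_bump l r n)"
  unfolding test_function_def
proof (intro conjI allI)
  fix k
  have "Ck k (\<lambda>z. complex_of_real (real (Suc n) * ((z \<bullet> b - l \<bullet> b) * (r \<bullet> b - z \<bullet> b))))" for k and b :: 'a
  proof -
    have "Ck k (\<lambda>z. complex_of_real (real (Suc n)) * ((complex_of_real (z \<bullet> b) + complex_of_real (- (l \<bullet> b))) *
        (complex_of_real (r \<bullet> b) + (-1) * complex_of_real (z \<bullet> b))))"
      by (intro Ck_mult Ck_add Ck_const Ck_inner)
    then show ?thesis by simp
  qed
  then show "Ck k (box_bump l r n)"
    unfolding box_bump_def[abs_def] by (intro Ck_prod Ck_bump)
  have "{z. box_bump l r n z \<noteq> 0} \<subseteq> box l r" using box_bump_outside[OF assms] by blast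
  then have "bounded {z. box_bump l r n z \<noteq> 0}" by (rule bounded_subset[OF bounded_box])
  then show "compact (closure {z. box_bump l r n z \<noteq> 0})" by simp
qed

text \<open>The smooth bumps converge to box indicators under an integrable bound, which reduces the
  claim to integrals over boxes.\<close>

lemma AE_zero_if_test_integrals_zero:
  fixes f :: "'a::euclidean_space \<Rightarrow> complex"
  assumes f [measurable]: "f \<in> borel_measurable borel"
    and int: "\<And>a b. integrable lborel (\<lambda>z. indicator (box a b) z *\<^sub>R f z)"
    and zero: "\<And>\<phi>. test_function \<phi> \<Longrightarrow> (LINT z|lborel. f z * \<phi> z) = 0"
  shows "AE z in lborel. f z = 0"
proof (rule AE_zero_if_box_integrals_zero[OF int])
  fix l r :: 'a
  show "(LINT z|lborel. indicator (box l r) z *\<^sub>R f z) = 0"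
  proof (cases "box l r = {}")
    case False
    then have le: "l \<bullet> b \<le> r \<bullet> b" if "b \<in> Basis" for b
      using that by (auto simp: box_eq_empty less_imp_le not_le)
    have t: "test_function (box_bump l r n)" for n
      by (rule test_function_box_bump) (rule le)
    have [measurable]: "box_bump l r n \<in> borel_measurable borel" for n
      using t[of n] by (auto simp: test_function_def intro!: borel_measurable_continuous_onI intro: Ck_continuous)
    have "(\<lambda>n. LINT z|lborel. f z * box_bump l r n z) \<longlonglongrightarrow> (LINT z|lborel. f z * indicator (box l r) z)"
    proof (rule integral_dominated_convergence[where w="\<lambda>z. cmod (indicator (box l r) z *\<^sub>R f z)"])
      show "integrable lborel (\<lambda>z. cmod (indicator (box l r) z *\<^sub>R f z))" by (intro integrable_norm int)
      show "AE z in lborel. (\<lambda>n. f z * box_bump l r n z) \<longlonglongrightarrow> f z * indicator (box l r) z"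
        by (intro AE_I2 tendsto_mult_left box_bump_tendsto le)
      have "cmod (f z * box_bump l r n z) \<le> cmod (indicator (box l r) z *\<^sub>R f z)" for z n
        using box_bump_outside[OF le, of z n] box_bump_norm_le[of l r n z]
        by (cases "z \<in> box l r") (auto simp: norm_mult mult_right_le_one_le)
      then show "AE z in lborel. norm (f z * box_bump l r n z) \<le> cmod (indicator (box l r) z *\<^sub>R f z)" for n
        by auto
    qed measurable
    then have "(LINT z|lborel. f z * indicator (box l r) z) = 0"
      unfolding zero[OF t] by (rule LIMSEQ_unique[OF _ tendsto_const])
    moreover have "(\<lambda>z. f z * indicator (box l r) z) = (\<lambda>z. indicator (box l r) z *\<^sub>R f z)"
      by (auto simp: indicator_def)
    ultimately show ?thesis by simp
  qed simp
qed

section \<open>Transport along the flow\<close>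

lemma measure_preserving_translation: "measure_preserving_lborel (\<lambda>x::'a::euclidean_space. x + c)"
proof -
  have "(\<lambda>x. x + c) = (+) c" by (simp add: fun_eq_iff add.commute)
  then show ?thesis
    using lborel_distr_plus[of c] by (simp add: measure_preserving_lborel_def)
qed

lemma measure_preservingI:
  assumes [measurable]: "T \<in> borel_measurable borel"
    and "\<And>f. f \<in> borel_measurable borel \<Longrightarrow> (\<integral>\<^sup>+x. f (T x) \<partial>lborel) = (\<integral>\<^sup>+x. f x \<partial>lborel)"
  shows "measure_preserving_lborel T"
proof -
  have "distr lborel borel T = lborel"
  proof (rule measure_eqI)
    fix A assume "A \<in> sets (distr lborel borel T)"
    then have A [measurable]: "A \<in> sets borel" by simp
    have "emeasure (distr lborel borel T) A = (\<integral>\<^sup>+x. indicator A x \<partial>distr lborel borel T)"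
      by (simp add: nn_integral_indicator)
    also have "\<dots> = (\<integral>\<^sup>+x. indicator A (T x) \<partial>lborel)"
      by (intro nn_integral_distr) auto
    also have "\<dots> = (\<integral>\<^sup>+x. indicator A x \<partial>lborel)" by (rule assms(2)) simp
    finally show "emeasure (distr lborel borel T) A = emeasure lborel A" by simp
  qed simp
  then show ?thesis by (simp add: measure_preserving_lborel_def)
qed

lemma measure_preserving_shear_snd:
  fixes c :: "'a::euclidean_space \<Rightarrow> 'b::euclidean_space"
  assumes [measurable]: "c \<in> borel_measurable borel"
  shows "measure_preserving_lborel (\<lambda>p. (fst p, snd p + c (fst p)))"
proof (rule measure_preservingI)
  fix f :: "'a \<times> 'b \<Rightarrow> ennreal" assume [measurable]: "f \<in> borel_measurable borel"
  have "(\<integral>\<^sup>+p. f (fst p, snd p + c (fst p)) \<partial>lborel) = (\<integral>\<^sup>+x. \<integral>\<^sup>+y. f (x, y + c x) \<partial>lborel \<partial>lborel)"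
    by (subst lborel_nn_Fubini(1)[symmetric]) auto
  also have "\<dots> = (\<integral>\<^sup>+x. \<integral>\<^sup>+y. f (x, y) \<partial>lborel \<partial>lborel)"
    by (intro nn_integral_cong mp_nn_integral[OF measure_preserving_translation]) measurable
  also have "\<dots> = (\<integral>\<^sup>+p. f p \<partial>lborel)"
    by (rule lborel_nn_Fubini(1)) simp
  finally show "(\<integral>\<^sup>+p. f (fst p, snd p + c (fst p)) \<partial>lborel) = (\<integral>\<^sup>+p. f p \<partial>lborel)" .
qed measurable

lemma measure_preserving_shear_fst:
  fixes c :: "'b::euclidean_space \<Rightarrow> 'a::euclidean_space"
  assumes [measurable]: "c \<in> borel_measurable borel"
  shows "measure_preserving_lborel (\<lambda>p. (fst p + c (snd p), snd p))"
proof (rule measure_preservingI)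
  fix f :: "'a \<times> 'b \<Rightarrow> ennreal" assume [measurable]: "f \<in> borel_measurable borel"
  have "(\<integral>\<^sup>+p. f (fst p + c (snd p), snd p) \<partial>lborel) = (\<integral>\<^sup>+y. \<integral>\<^sup>+x. f (x + c y, y) \<partial>lborel \<partial>lborel)"
    by (subst lborel_nn_Fubini(2)[symmetric]) auto
  also have "\<dots> = (\<integral>\<^sup>+y. \<integral>\<^sup>+x. f (x, y) \<partial>lborel \<partial>lborel)"
    by (intro nn_integral_cong mp_nn_integral[OF measure_preserving_translation]) measurable
  also have "\<dots> = (\<integral>\<^sup>+p. f p \<partial>lborel)"
    by (rule lborel_nn_Fubini(2)) simp
  finally show "(\<integral>\<^sup>+p. f (fst p + c (snd p), snd p) \<partial>lborel) = (\<integral>\<^sup>+p. f p \<partial>lborel)" .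
qed measurable

lemma integrable_indicator_Icc: "integrable lborel (indicator {a..b::real} :: real \<Rightarrow> real)"
  by (rule integrable_real_indicator) (auto simp: emeasure_lborel_Icc_eq)

text \<open>The maps preserve L2 norms, so Cauchy-Schwarz bounds the inner integral uniformly in
  time, and the time interval is finite.\<close>

lemma integrable_along_flow:
  fixes \<Theta> :: "real \<Rightarrow> 'a::euclidean_space \<Rightarrow> 'a"
  assumes meas: "(\<lambda>p. \<Theta> (fst p) (snd p)) \<in> borel_measurable borel"
    and mp: "\<And>\<sigma>. measure_preserving_lborel (\<Theta> \<sigma>)" and g: "L2 g" and h: "L2 h"
  shows "integrable lborel (\<lambda>p. indicator {0..\<tau>} (fst p) *\<^sub>R (g (\<Theta> (fst p) (snd p)) * h (snd p)))"
proof -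
  have [measurable]: "g \<in> borel_measurable borel" "h \<in> borel_measurable borel" using g h by auto
  note [measurable] = meas
  let ?F = "\<lambda>p. indicator {0..\<tau>} (fst p) *\<^sub>R (g (\<Theta> (fst p) (snd p)) * h (snd p))"
  have F [measurable]: "?F \<in> borel_measurable borel" by measurable
  have g\<Theta>: "L2 (\<lambda>z. g (\<Theta> \<sigma> z))" "L2norm (\<lambda>z. g (\<Theta> \<sigma> z)) = L2norm g" for \<sigma>
    by (intro mp_L2[OF mp] mp_L2norm[OF mp] g; simp)+
  have "integrable (lborel \<Otimes>\<^sub>M lborel) ?F"
  proof (rule lborel_pair.Fubini_integrable)
    show F': "?F \<in> borel_measurable (lborel \<Otimes>\<^sub>M lborel)" using F by (simp add: lborel_prod)
    show "integrable lborel (\<lambda>\<sigma>. LINT z|lborel. norm (?F (\<sigma>, z)))"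
    proof (rule Bochner_Integration.integrable_bound)
      show "integrable lborel (\<lambda>\<sigma>. indicator {0..\<tau>} \<sigma> * (L2norm g * L2norm h))"
        by (intro integrable_mult_left integrable_indicator_Icc)
      have "(\<lambda>p. norm (?F p)) \<in> borel_measurable (lborel \<Otimes>\<^sub>M lborel)" using F' by measurable
      then show "(\<lambda>\<sigma>. LINT z|lborel. norm (?F (\<sigma>, z))) \<in> borel_measurable lborel"
        by (intro lborel.borel_measurable_lebesgue_integral) (simp add: case_prod_unfold)
      show "AE \<sigma> in lborel. norm (LINT z|lborel. norm (?F (\<sigma>, z))) \<le> norm (indicator {0..\<tau>} \<sigma> * (L2norm g * L2norm h))"
      proof (rule AE_I2)
        fix \<sigma>
        have "(LINT z|lborel. norm (?F (\<sigma>, z))) = indicator {0..\<tau>} \<sigma> * (LINT z|lborel. cmod (g (\<Theta> \<sigma> z)) * cmod (h z))"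
          by (simp add: norm_mult)
        also have "\<dots> \<le> indicator {0..\<tau>} \<sigma> * (L2norm g * L2norm h)"
          using L2_mult_bound(2)[OF g\<Theta>(1) h, of \<sigma>] g\<Theta>(2) by (intro mult_left_mono) auto
        finally show "norm (LINT z|lborel. norm (?F (\<sigma>, z))) \<le> norm (indicator {0..\<tau>} \<sigma> * (L2norm g * L2norm h))"
          by (simp add: abs_mult)
      qed
    qed
    show "AE \<sigma> in lborel. integrable lborel (\<lambda>z. ?F (\<sigma>, z))"
      using L2_mult_bound(1)[OF g\<Theta>(1) h] by (intro AE_I2) simp
  qed
  then show ?thesis unfolding lborel_prod .
qed

section \<open>Duhamel's formula in the original variables\<close>

definition flow :: "real ^ 'n::finite ^ 'n \<Rightarrow> real \<Rightarrow> (real ^ 'n) \<times> real \<Rightarrow> (real ^ 'n) \<times> real" where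
  "flow B \<sigma> z = (fst z - \<sigma> *\<^sub>R (B *v fst z), snd z + \<sigma>)"

lemma continuous_matrix_vector_mult [continuous_intros]:
  "continuous_on S f \<Longrightarrow> continuous_on S (\<lambda>x. (B :: real ^ 'n ^ 'm) *v f x)"
  by (rule bounded_linear.continuous_on[OF matrix_vector_mul_bounded_linear])

lemma flow_continuous: "continuous_on S f \<Longrightarrow> continuous_on S h \<Longrightarrow> continuous_on S (\<lambda>x. flow B (f x) (h x))"
  unfolding flow_def by (intro continuous_intros)

lemma flow_measurable:
  "(\<lambda>p. flow B (fst p) (snd p)) \<in> borel_measurable borel" "flow B \<sigma> \<in> borel_measurable borel"
  "(\<lambda>p. flow B (- fst p) (snd p)) \<in> borel_measurable borel"
  by (intro borel_measurable_continuous_onI flow_continuous continuous_intros)+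

text \<open>The properties of the drift behind the weak formulation. As \<open>B\<close> squares to
  zero, its exponential is affine in time, which is the form taken by \<open>flow\<close>; the zero
  diagonal removes the zero-order term from the adjoint of the transport operator.\<close>

locale nilpotent_drift =
  fixes B :: "real ^ 'n::finite ^ 'n"
  assumes nilpotent: "B *v (B *v x) = 0" and diagonal: "B $ i $ i = 0"
    and mp_flow: "measure_preserving_lborel (flow B \<sigma>)"
begin

lemma flow_minus [simp]: "flow B (- \<sigma>) (flow B \<sigma> z) = z" "flow B \<sigma> (flow B (- \<sigma>) z) = z"
  by (simp_all add: flow_def nilpotent matrix_vector_mult_diff_distrib matrix_vector_right_distrib
      matrix_vector_mult_scaleR)

text \<open>The diagonal entries vanish, so the coefficients pass through the derivatives, and what
  remains is the derivative of \<open>\<phi>\<close> in the direction of the velocity of the flow at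
  \<open>z\<close>.\<close>

lemma Y_integrand:
  fixes \<phi> :: "(real ^ 'n) \<times> real \<Rightarrow> complex"
  assumes "Ck 1 \<phi>"
  shows "pderiv_dir (0, 1) \<phi> z
      - (\<Sum>i\<in>UNIV. \<Sum>j\<in>UNIV. pderiv_dir (axis i 1, 0) (\<lambda>w. (B $ i $ j * fst w $ j) *\<^sub>R \<phi> w) z)
    = frechet_derivative \<phi> (at z) (- (B *v fst z), 1)"
proof -
  let ?D = "frechet_derivative \<phi> (at z)"
  have D: "(\<phi> has_derivative ?D) (at z)" using Ck_Suc_differentiable[of 0 \<phi> z] assms by simp
  have lin: "linear ?D" using D by (rule has_derivative_linear)
  have "pderiv_dir (axis i 1, 0) (\<lambda>w. (B $ i $ j * fst w $ j) *\<^sub>R \<phi> w) z = (B $ i $ j * fst z $ j) *\<^sub>R ?D (axis i 1, 0)" for i j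
  proof -
    have "((\<lambda>w. (B $ i $ j * fst w $ j) *\<^sub>R \<phi> w) has_derivative
      (\<lambda>w. (B $ i $ j * fst z $ j) *\<^sub>R ?D w + (B $ i $ j * fst w $ j) *\<^sub>R \<phi> z)) (at z)"
      by (rule has_derivative_scaleR[OF _ D])
         (intro has_derivative_mult_right bounded_linear.has_derivative[OF bounded_linear_vec_nth] has_derivative_fst has_derivative_ident)
    from has_derivative_pderiv_dir[OF this, of "(axis i 1, 0)"]
    show ?thesis by (cases "i = j") (auto simp: diagonal axis_def)
  qed
  then have "(\<Sum>i\<in>UNIV. \<Sum>j\<in>UNIV. pderiv_dir (axis i 1, 0) (\<lambda>w. (B $ i $ j * fst w $ j) *\<^sub>R \<phi> w) z)
     = (\<Sum>i\<in>UNIV. ((B *v fst z) $ i) *\<^sub>R ?D (axis i 1, 0))"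
    by (simp add: matrix_vector_mult_def scaleR_sum_left)
  also have "\<dots> = ?D (\<Sum>i\<in>UNIV. ((B *v fst z) $ i) *\<^sub>R (axis i 1, 0))"
    by (simp add: linear_sum[OF lin] linear_scale[OF lin] del: scaleR_Pair)
  also have "(\<Sum>i\<in>UNIV. ((B *v fst z) $ i) *\<^sub>R (axis i (1::real), 0::real)) = (B *v fst z, 0)"
    using basis_expansion[of "B *v fst z"]
    by (simp add: prod_eq_iff fst_sum snd_sum vector_scalar_mult_def[symmetric] scalar_mult_eq_scaleR)
  finally show ?thesis
    unfolding pderiv_dir_def[of "(0, 1)"] using linear_diff[OF lin, of "(0, 1)" "(B *v fst z, 0)"] by simp
qed

lemma flow_affine: "flow B \<sigma> z = (fst z - \<sigma> *\<^sub>R (B *v fst z), snd z) + (0, \<sigma>)"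
  by (simp add: flow_def)

lemma linear_flow: "linear (\<lambda>z. (fst z - \<sigma> *\<^sub>R (B *v fst z), snd z :: real))"
  by (rule linearI) (auto simp: matrix_vector_right_distrib matrix_vector_mult_scaleR algebra_simps)

lemma test_function_flow:
  assumes "test_function \<phi>"
  shows "test_function (\<lambda>z. \<phi> (flow B \<sigma> z))"
  unfolding test_function_def
proof (intro conjI allI)
  show "Ck k (\<lambda>z. \<phi> (flow B \<sigma> z))" for k
    unfolding flow_affine using assms by (intro Ck_affine linear_flow) (simp add: test_function_def)
  have "{z. \<phi> (flow B \<sigma> z) \<noteq> 0} \<subseteq> flow B (- \<sigma>) ` closure {z. \<phi> z \<noteq> 0}"
    using closure_subset by (force intro: image_eqI[where x="flow B \<sigma> z" for z])
  moreover have "compact (flow B (- \<sigma>) ` closure {z. \<phi> z \<noteq> 0})"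
    using assms by (intro compact_continuous_image flow_continuous continuous_intros) (simp add: test_function_def)
  ultimately have "bounded {z. \<phi> (flow B \<sigma> z) \<noteq> 0}"
    using bounded_subset compact_imp_bounded by blast
  then show "compact (closure {z. \<phi> (flow B \<sigma> z) \<noteq> 0})" by simp
qed

text \<open>The velocity is taken at the starting point \<open>z\<close>: by nilpotency it is
  constant along the trajectory.\<close>

definition flow_deriv :: "((real ^ 'n) \<times> real \<Rightarrow> complex) \<Rightarrow> real \<Rightarrow> (real ^ 'n) \<times> real \<Rightarrow> complex" where
  "flow_deriv \<phi> \<sigma> z = frechet_derivative \<phi> (at (flow B \<sigma> z)) (- (B *v fst z), 1)"

lemma flow_deriv_vector_derivative:
  assumes "Ck 1 \<phi>"
  shows "((\<lambda>\<sigma>. \<phi> (flow B \<sigma> z)) has_vector_derivative flow_deriv \<phi> \<sigma> z) (at \<sigma>)"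
proof -
  have "((\<lambda>\<sigma>. flow B \<sigma> z) has_vector_derivative (- (B *v fst z), 1)) (at \<sigma>)"
    unfolding flow_def by (auto intro!: derivative_eq_intros)
  then have "((\<lambda>\<sigma>. flow B \<sigma> z) has_derivative (\<lambda>h. h *\<^sub>R (- (B *v fst z), 1))) (at \<sigma>)"
    by (simp add: has_vector_derivative_def)
  moreover have D: "(\<phi> has_derivative frechet_derivative \<phi> (at (flow B \<sigma> z))) (at (flow B \<sigma> z))"
    using Ck_Suc_differentiable[of 0 \<phi>] assms by simp
  ultimately have "((\<lambda>\<sigma>. \<phi> (flow B \<sigma> z)) has_derivative (\<lambda>h. frechet_derivative \<phi> (at (flow B \<sigma> z)) (h *\<^sub>R (- (B *v fst z), 1)))) (at \<sigma>)"
    by (rule has_derivative_compose)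
  then show ?thesis
    unfolding has_vector_derivative_def flow_deriv_def linear_scale[OF has_derivative_linear[OF D]] .
qed

text \<open>The differential of the flow fixes the velocity vector, since \<open>B\<close> maps
  \<open>B *v fst z\<close> to zero. Hence the adjoint operator, applied to the transported test
  function, differentiates along the trajectory.\<close>

lemma Y_distr_flow:
  assumes \<phi>: "test_function \<phi>"
  shows "Y_distr B u (\<lambda>z. \<phi> (flow B \<sigma> z)) = (LINT z|lborel. u z * flow_deriv \<phi> \<sigma> z)"
proof -
  have C1: "Ck 1 \<phi>" "Ck 1 (\<lambda>z. \<phi> (flow B \<sigma> z))"
    using \<phi> test_function_flow[OF \<phi>, of \<sigma>] by (auto simp: test_function_def simp del: Ck.simps)
  have "frechet_derivative (\<lambda>z. \<phi> (flow B \<sigma> z)) (at z) (- (B *v fst z), 1) = flow_deriv \<phi> \<sigma> z" for z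
  proof -
    have "((\<lambda>z. flow B \<sigma> z) has_derivative (\<lambda>w. (fst w - \<sigma> *\<^sub>R (B *v fst w), snd w))) (at z)"
      unfolding flow_affine
      by (rule has_derivative_add_const) (use linear_flow[of \<sigma>] in \<open>auto intro!: bounded_linear_imp_has_derivative simp: linear_conv_bounded_linear\<close>)
    moreover have "(\<phi> has_derivative frechet_derivative \<phi> (at (flow B \<sigma> z))) (at (flow B \<sigma> z))"
      using Ck_Suc_differentiable[of 0 \<phi>] C1 by simp
    ultimately have "((\<lambda>z. \<phi> (flow B \<sigma> z)) has_derivative
        (\<lambda>w. frechet_derivative \<phi> (at (flow B \<sigma> z)) (fst w - \<sigma> *\<^sub>R (B *v fst w), snd w))) (at z)"
      by (rule has_derivative_compose)
    from has_derivative_pderiv_dir[OF this, of "(- (B *v fst z), 1)"]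
    show ?thesis
      using nilpotent[of "fst z"]
      by (simp add: pderiv_dir_def flow_deriv_def linear_neg[OF matrix_vector_mul_linear])
  qed
  then show ?thesis
    unfolding Y_distr_def Y_integrand[OF C1(2)] by simp
qed

lemma flow_deriv_continuous:
  assumes "test_function \<phi>"
  shows "continuous_on S (\<lambda>p. flow_deriv \<phi> (fst p) (snd p))"
proof -
  have C: "Ck (Suc 0) \<phi>" using assms unfolding test_function_def by blast
  have lin: "linear (frechet_derivative \<phi> (at z))" for z
    using Ck_Suc_differentiable[OF C] by (rule has_derivative_linear)
  let ?N = "\<lambda>p. (- (B *v fst (snd p)), 1 :: real)"
  have "flow_deriv \<phi> (fst p) (snd p) = (\<Sum>d\<in>Basis. complex_of_real (?N p \<bullet> d) * pderiv_dir d \<phi> (flow B (fst p) (snd p)))" for p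
    unfolding flow_deriv_def pderiv_dir_def
    by (subst euclidean_representation[of "?N p", symmetric])
       (simp add: linear_sum[OF lin] linear_scale[OF lin] scaleR_conv_of_real del: scaleR_Pair)
  moreover have "continuous_on S (\<lambda>p. pderiv_dir d \<phi> (flow B (fst p) (snd p)))" if "d \<in> Basis" for d
  proof -
    have "continuous_on UNIV (pderiv_dir d \<phi>)" using C that by simp
    moreover have "continuous_on S (\<lambda>p. flow B (fst p) (snd p))"
      by (intro flow_continuous continuous_intros)
    ultimately show ?thesis by (rule continuous_on_compose2) simp
  qed
  then have "continuous_on S (\<lambda>p. \<Sum>d\<in>Basis. complex_of_real (?N p \<bullet> d) * pderiv_dir d \<phi> (flow B (fst p) (snd p)))"
    by (intro continuous_on_sum continuous_on_mult continuous_intros)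
  ultimately show ?thesis by simp
qed

lemma flow_deriv_eq_0:
  assumes "flow B \<sigma> z \<notin> closure {z. \<phi> z \<noteq> 0}"
  shows "flow_deriv \<phi> \<sigma> z = 0"
proof -
  have "(\<phi> has_derivative (\<lambda>_. 0)) (at (flow B \<sigma> z))"
  proof (rule has_derivative_transform_within_open[where f="\<lambda>_. 0" and s="- closure {z. \<phi> z \<noteq> 0}"])
    show "0 = \<phi> w" if "w \<in> - closure {z. \<phi> z \<noteq> 0}" for w
      using that closure_subset[of "{z. \<phi> z \<noteq> 0}"] by auto
  qed (use assms in auto)
  then show ?thesis unfolding flow_deriv_def by (simp add: frechet_derivative_at[symmetric])
qed

lemma integrable_flow_deriv:
  assumes u: "L2 u" and \<phi>: "test_function \<phi>"
  shows "integrable lborel (\<lambda>p. indicator {0..\<tau>} (fst p) *\<^sub>R (u (snd p) * flow_deriv \<phi> (fst p) (snd p)))"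
proof -
  have [measurable]: "u \<in> borel_measurable borel" using u by auto
  have [measurable]: "(\<lambda>p. flow_deriv \<phi> (fst p) (snd p)) \<in> borel_measurable borel"
    by (intro borel_measurable_continuous_onI flow_deriv_continuous \<phi>)
  define S where "S = closure {z. \<phi> z \<noteq> 0}"
  \<comment> \<open>One compact set containing the supports of all transported test functions with
    times in \<open>{0..\<tau>}\<close>.\<close>
  define P where "P = (\<lambda>p. flow B (- fst p) (snd p)) ` ({0..\<tau>} \<times> S)"
  have "compact S" using \<phi> by (simp add: S_def test_function_def)
  then have P: "compact P"
    unfolding P_def by (intro compact_continuous_image flow_continuous continuous_intros compact_Times compact_Icc)
  then have Pb: "bounded P" "P \<in> sets borel" by (auto intro: compact_imp_bounded borel_compact)
  have out: "flow_deriv \<phi> \<sigma> z = 0" if "\<sigma> \<in> {0..\<tau>}" "z \<notin> P" for \<sigma> z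
  proof (rule flow_deriv_eq_0, rule notI)
    assume "flow B \<sigma> z \<in> closure {z. \<phi> z \<noteq> 0}"
    then have "flow B (- \<sigma>) (flow B \<sigma> z) \<in> P" unfolding P_def S_def[symmetric] using that(1) by force
    with that show False by simp
  qed
  have "compact ((\<lambda>p. flow_deriv \<phi> (fst p) (snd p)) ` ({0..\<tau>} \<times> P))"
    using P by (intro compact_continuous_image flow_deriv_continuous \<phi> compact_Times compact_Icc)
  then have "bounded ((\<lambda>p. flow_deriv \<phi> (fst p) (snd p)) ` ({0..\<tau>} \<times> P))"
    by (rule compact_imp_bounded)
  then obtain M where M': "\<forall>x\<in>(\<lambda>p. flow_deriv \<phi> (fst p) (snd p)) ` ({0..\<tau>} \<times> P). norm x \<le> M"
    by (auto simp: bounded_iff)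
  have M: "cmod (flow_deriv \<phi> \<sigma> z) \<le> M" if "\<sigma> \<in> {0..\<tau>}" "z \<in> P" for \<sigma> z
    using M'[rule_format, of "flow_deriv \<phi> \<sigma> z"] that by force
  have "integrable lborel (\<lambda>p. indicator {0..\<tau>} (fst p) * (u (snd p) * indicator P (snd p)) :: complex)"
  proof (rule integrable_lborel_times)
    have "integrable lborel (\<lambda>\<sigma>. complex_of_real (indicator {0..\<tau>} \<sigma>))"
      by (intro integrable_of_real integrable_indicator_Icc)
    moreover have "(\<lambda>\<sigma>. complex_of_real (indicator {0..\<tau>} \<sigma>)) = indicator {0..\<tau>}"
      by (auto simp: indicator_def fun_eq_iff)
    ultimately show "integrable lborel (indicator {0..\<tau>} :: real \<Rightarrow> complex)" by simp
    show "integrable lborel (\<lambda>z. u z * indicator P z)"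
      by (intro L2_mult_bound u L2_bdd_L2 L2_bdd_indicator Pb)
  qed
  then have "integrable lborel (\<lambda>p. complex_of_real M * (indicator {0..\<tau>} (fst p) * (u (snd p) * indicator P (snd p))))"
    by (rule integrable_mult_right)
  then show ?thesis
  proof (rule Bochner_Integration.integrable_bound)
    show "AE p in lborel. norm (indicator {0..\<tau>} (fst p) *\<^sub>R (u (snd p) * flow_deriv \<phi> (fst p) (snd p)))
        \<le> norm (complex_of_real M * (indicator {0..\<tau>} (fst p) * (u (snd p) * indicator P (snd p))))"
    proof (rule AE_I2)
      fix p :: "real \<times> (real ^ 'n) \<times> real"
      show "norm (indicator {0..\<tau>} (fst p) *\<^sub>R (u (snd p) * flow_deriv \<phi> (fst p) (snd p)))
        \<le> norm (complex_of_real M * (indicator {0..\<tau>} (fst p) * (u (snd p) * indicator P (snd p))))"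
      proof (cases "fst p \<in> {0..\<tau>} \<and> snd p \<in> P")
        case True
        then have "cmod (flow_deriv \<phi> (fst p) (snd p)) \<le> \<bar>M\<bar>" using M by fastforce
        then show ?thesis using True
          using mult_left_mono[of "cmod (flow_deriv \<phi> (fst p) (snd p))" "\<bar>M\<bar>" "cmod (u (snd p))"]
          by (simp add: norm_mult mult.commute)
      next
        case False
        then show ?thesis using out[of "fst p" "snd p"] by (auto simp: indicator_def)
      qed
    qed
  qed measurable
qed

text \<open>The equation is tested with \<open>\<phi>\<close> transported by each time
  \<open>\<sigma>\<close> and then integrated over \<open>\<sigma>\<close>; on the side of
  \<open>u\<close> the integrand is a total derivative in \<open>\<sigma>\<close>.\<close>

lemma duhamel_test:
  assumes u: "L2 u" and sol: "solves_Y B u g" and \<phi>: "test_function \<phi>" and \<tau>: "\<tau> \<ge> 0"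
  shows "(LINT z|lborel. u z * (\<phi> (flow B \<tau> z) - \<phi> z))
    = (LINT \<sigma>|lborel. indicator {0..\<tau>} \<sigma> *\<^sub>R (LINT z|lborel. g z * \<phi> (flow B \<sigma> z)))"
proof -
  have C1: "Ck 1 \<phi>" using \<phi> by (auto simp: test_function_def simp del: Ck.simps)
  let ?F = "\<lambda>p. indicator {0..\<tau>} (fst p) *\<^sub>R (u (snd p) * flow_deriv \<phi> (fst p) (snd p))"
  have i: "integrable lborel ?F" by (rule integrable_flow_deriv[OF u \<phi>])
  have ftc: "(LINT \<sigma>|lborel. indicator {0..\<tau>} \<sigma> *\<^sub>R flow_deriv \<phi> \<sigma> z) = \<phi> (flow B \<tau> z) - \<phi> z" for z
  proof -
    have "(LINT \<sigma>|lborel. indicator {0..\<tau>} \<sigma> *\<^sub>R flow_deriv \<phi> \<sigma> z) = \<phi> (flow B \<tau> z) - \<phi> (flow B 0 z)"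
    proof (rule integral_FTC_atLeastAtMost[OF \<tau>])
      show "((\<lambda>\<sigma>. \<phi> (flow B \<sigma> z)) has_vector_derivative flow_deriv \<phi> \<sigma> z) (at \<sigma> within {0..\<tau>})" for \<sigma>
        using flow_deriv_vector_derivative[OF C1] by (rule has_vector_derivative_at_within)
      have "continuous_on {0..\<tau>} (\<lambda>\<sigma>. (\<sigma>, z))" by (intro continuous_intros)
      from continuous_on_compose2[OF flow_deriv_continuous[OF \<phi>, of UNIV] this]
      show "continuous_on {0..\<tau>} (\<lambda>\<sigma>. flow_deriv \<phi> \<sigma> z)" by simp
    qed
    then show ?thesis by (simp add: flow_def)
  qed
  have "(LINT z|lborel. u z * (\<phi> (flow B \<tau> z) - \<phi> z)) = (LINT z|lborel. LINT \<sigma>|lborel. ?F (\<sigma>, z))"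
    unfolding ftc[symmetric] by (simp flip: integral_mult_right_zero)
  also have "\<dots> = (LINT \<sigma>|lborel. LINT z|lborel. ?F (\<sigma>, z))"
    using lborel_Fubini(1,2)[OF i] by simp
  also have "\<dots> = (LINT \<sigma>|lborel. indicator {0..\<tau>} \<sigma> *\<^sub>R Y_distr B u (\<lambda>z. \<phi> (flow B \<sigma> z)))"
    unfolding Y_distr_flow[OF \<phi>] by simp
  also have "\<dots> = (LINT \<sigma>|lborel. indicator {0..\<tau>} \<sigma> *\<^sub>R (LINT z|lborel. g z * \<phi> (flow B \<sigma> z)))"
    using sol test_function_flow[OF \<phi>] by (simp add: solves_Y_def)
  finally show ?thesis .
qed

lemma L2_test_function: "test_function \<phi> \<Longrightarrow> L2 \<phi>"
proof -
  assume \<phi>: "test_function \<phi>"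
  define S where "S = closure {z. \<phi> z \<noteq> 0}"
  have S: "compact S" using \<phi> by (simp add: S_def test_function_def)
  have c: "continuous_on UNIV \<phi>" using \<phi> Ck_continuous unfolding test_function_def by blast
  then have [measurable]: "\<phi> \<in> borel_measurable borel" by (rule borel_measurable_continuous_onI)
  have "bounded (\<phi> ` S)" using S c by (intro compact_imp_bounded compact_continuous_image) (auto intro: continuous_on_subset)
  then obtain M where M: "\<And>z. z \<in> S \<Longrightarrow> cmod (\<phi> z) \<le> M" by (auto simp: bounded_iff)
  have "z \<notin> S \<Longrightarrow> \<phi> z = 0" for z
    using closure_subset[of "{z. \<phi> z \<noteq> 0}"] unfolding S_def by auto
  then have "cmod (\<phi> z) \<le> \<bar>M\<bar> * cmod (indicator S z)" for z
    using M[of z] by (cases "z \<in> S") auto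
  moreover have "L2 (indicator S :: _ \<Rightarrow> complex)"
    using S by (intro L2_bdd_L2 L2_bdd_indicator) (auto intro: compact_imp_bounded borel_compact)
  ultimately show "L2 \<phi>"
    by (intro L2_bound(1)[of "indicator S" \<phi> "\<bar>M\<bar>"]) auto
qed

text \<open>Duhamel's identity is first shown almost everywhere and can then be paired with any L2
  function. It is recorded as a bound with a constant \<open>M\<close> because in this form it
  transfers to the Fourier side without an integral over \<open>\<sigma>\<close> there.\<close>

lemma duhamel_bound:
  assumes u: "L2 u" and g: "L2 g" and h: "L2 h" and sol: "solves_Y B u g" and \<tau>: "\<tau> \<ge> 0"
    and M: "\<And>\<sigma>. 0 \<le> \<sigma> \<Longrightarrow> \<sigma> \<le> \<tau> \<Longrightarrow> cmod (LINT z|lborel. g (flow B (- \<sigma>) z) * h z) \<le> M"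
  shows "cmod (LINT z|lborel. (u (flow B (- \<tau>) z) - u z) * h z) \<le> \<tau> * M"
proof -
  have [measurable]: "u \<in> borel_measurable borel" "g \<in> borel_measurable borel" "h \<in> borel_measurable borel" using u g h by auto
  note [measurable] = flow_measurable
  have fi: "integrable lborel (\<lambda>p. indicator {0..\<tau>} (fst p) *\<^sub>R (g (flow B (- fst p) (snd p)) * k (snd p)))" if "L2 k" for k
    by (rule integrable_along_flow[where \<Theta>="\<lambda>\<sigma>. flow B (- \<sigma>)"]) (auto intro: flow_measurable mp_flow g that)
  \<comment> \<open>\<open>I\<close> is controlled through its products with L2 functions, as
    provided by Fubini's theorem. Box indicators among them yield the local integrability required
    by the fundamental lemma.\<close>
  define I where "I z = (LINT \<sigma>|lborel. indicator {0..\<tau>} \<sigma> *\<^sub>R g (flow B (- \<sigma>) z))" for z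
  have I_mult: "(LINT \<sigma>|lborel. indicator {0..\<tau>} \<sigma> *\<^sub>R (g (flow B (- \<sigma>) z) * k)) = I z * k" for z k
    unfolding I_def by (simp flip: integral_mult_left_zero)
  have Ik: "integrable lborel (\<lambda>z. I z * k z)"
    "(LINT z|lborel. I z * k z) = (LINT \<sigma>|lborel. indicator {0..\<tau>} \<sigma> *\<^sub>R (LINT z|lborel. g (flow B (- \<sigma>) z) * k z))" if "L2 k" for k
  proof -
    show "integrable lborel (\<lambda>z. I z * k z)"
      using lborel_Fubini(6)[OF fi[OF that]] by (simp add: I_mult)
    show "(LINT z|lborel. I z * k z) = (LINT \<sigma>|lborel. indicator {0..\<tau>} \<sigma> *\<^sub>R (LINT z|lborel. g (flow B (- \<sigma>) z) * k z))"
      using lborel_Fubini(1,2)[OF fi[OF that]] by (simp add: I_mult)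
  qed
  have [measurable]: "(\<lambda>p. g (flow B (- snd p) (fst p))) \<in> borel_measurable borel"
  proof -
    have "(\<lambda>p. flow B (- snd p) (fst p)) \<in> borel_measurable borel"
      by (intro borel_measurable_continuous_onI flow_continuous continuous_intros)
    then show ?thesis by measurable
  qed
  have "(\<lambda>p. indicator {0..\<tau>} (snd p) *\<^sub>R g (flow B (- snd p) (fst p))) \<in> borel_measurable (lborel \<Otimes>\<^sub>M lborel)"
    unfolding lborel_prod by measurable
  then have [measurable]: "I \<in> borel_measurable borel"
    unfolding I_def using lborel.borel_measurable_lebesgue_integral[of "\<lambda>z \<sigma>. indicator {0..\<tau>} \<sigma> *\<^sub>R g (flow B (- \<sigma>) z)" lborel]
    by (simp add: case_prod_unfold)
  define D where "D z = u (flow B (- \<tau>) z) - u z - I z" for z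
  have [measurable]: "D \<in> borel_measurable borel" unfolding D_def by measurable
  have u\<tau>: "L2 (\<lambda>z. u (flow B (- \<tau>) z))" by (rule mp_L2[OF mp_flow u])
  have Dk: "integrable lborel (\<lambda>z. D z * k z)"
    "(LINT z|lborel. D z * k z) = (LINT z|lborel. u (flow B (- \<tau>) z) * k z) - (LINT z|lborel. u z * k z) - (LINT z|lborel. I z * k z)" if "L2 k" for k
    using Ik(1)[OF that] L2_mult_bound(1)[OF u that] L2_mult_bound(1)[OF u\<tau> that]
    by (simp_all add: D_def left_diff_distrib)
  have "AE z in lborel. D z = 0"
  proof (rule AE_zero_if_test_integrals_zero)
    show "integrable lborel (\<lambda>z. indicator (box a b) z *\<^sub>R D z)" for a b
    proof -
      have "L2 (indicator (box a b) :: (real ^ 'n) \<times> real \<Rightarrow> complex)" by (intro L2_bdd_L2 L2_bdd_indicator) auto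
      from Dk(1)[OF this] show ?thesis by (simp add: indicator_def of_bool_def if_distrib if_distribR cong: if_cong)
    qed
    fix \<phi> :: "(real ^ 'n) \<times> real \<Rightarrow> complex" assume \<phi>: "test_function \<phi>"
    have L2\<phi>: "L2 \<phi>" "L2 (\<lambda>z. \<phi> (flow B \<sigma> z))" for \<sigma>
      using L2_test_function test_function_flow \<phi> by blast+
    have [measurable]: "\<phi> \<in> borel_measurable borel" using L2\<phi>(1) by auto
    have shift: "(LINT z|lborel. f (flow B (- \<sigma>) z) * \<phi> z) = (LINT z|lborel. f z * \<phi> (flow B \<sigma> z))"
      if "f \<in> borel_measurable borel" for f \<sigma>
      using mp_integral[OF mp_flow[of \<sigma>], of "\<lambda>z. f (flow B (- \<sigma>) z) * \<phi> z"] that by simp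
    have "(LINT z|lborel. D z * \<phi> z) = (LINT z|lborel. u z * (\<phi> (flow B \<tau> z) - \<phi> z)) - (LINT z|lborel. I z * \<phi> z)"
      unfolding Dk(2)[OF L2\<phi>(1)] using L2_mult_bound(1)[OF u L2\<phi>(1)] L2_mult_bound(1)[OF u L2\<phi>(2)]
      by (simp add: shift right_diff_distrib)
    also have "\<dots> = 0"
      unfolding duhamel_test[OF u sol \<phi> \<tau>] Ik(2)[OF L2\<phi>(1)] by (simp add: shift)
    finally show "(LINT z|lborel. D z * \<phi> z) = 0" .
  qed measurable
  then have "(LINT z|lborel. (u (flow B (- \<tau>) z) - u z) * h z) = (LINT z|lborel. I z * h z)"
    by (intro integral_cong_AE) (auto simp: D_def elim!: eventually_mono)
  also have "\<dots> = (LINT \<sigma>|lborel. indicator {0..\<tau>} \<sigma> *\<^sub>R (LINT z|lborel. g (flow B (- \<sigma>) z) * h z))"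
    by (rule Ik(2)[OF h])
  also have "cmod \<dots> \<le> (LINT \<sigma>|lborel. indicator {0..\<tau>} \<sigma> * M)"
  proof -
    have "cmod (LINT \<sigma>|lborel. indicator {0..\<tau>} \<sigma> *\<^sub>R (LINT z|lborel. g (flow B (- \<sigma>) z) * h z))
      \<le> (LINT \<sigma>|lborel. norm (indicator {0..\<tau>} \<sigma> *\<^sub>R (LINT z|lborel. g (flow B (- \<sigma>) z) * h z)))"
      by (rule integral_norm_bound)
    also have "\<dots> \<le> (LINT \<sigma>|lborel. indicator {0..\<tau>} \<sigma> * M)"
    proof (rule integral_mono')
      show "integrable lborel (\<lambda>\<sigma>. indicator {0..\<tau>} \<sigma> * M)" by (intro integrable_mult_left integrable_indicator_Icc)
      show "norm (indicator {0..\<tau>} \<sigma> *\<^sub>R (LINT z|lborel. g (flow B (- \<sigma>) z) * h z)) \<le> indicator {0..\<tau>} \<sigma> * M" for \<sigma>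
        using M[of \<sigma>] by (auto simp: indicator_def)
      \<comment> \<open>The hypothesis at time 0, which lies in the interval since
        \<open>\<tau> \<ge> 0\<close>, shows that \<open>M\<close> is nonnegative.\<close>
      show "0 \<le> indicator {0..\<tau>} \<sigma> * M" for \<sigma>
        using order_trans[OF norm_ge_zero M[of 0]] \<tau> by simp
    qed
    finally show ?thesis .
  qed
  also have "\<dots> = \<tau> * M" using \<tau> by simp
  finally show ?thesis .
qed

end

section \<open>The flow in split coordinates\<close>

definition block_flow :: "('a \<Rightarrow> 'b) \<Rightarrow> real \<Rightarrow> 'a::euclidean_space \<times> ('b::euclidean_space \<times> real) \<Rightarrow> 'a \<times> ('b \<times> real)" where
  "block_flow A \<sigma> p = (fst p, (fst (snd p) - \<sigma> *\<^sub>R A (fst p), snd (snd p) + \<sigma>))"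

lemma measure_preserving_block_flow:
  assumes [measurable]: "A \<in> borel_measurable borel"
  shows "measure_preserving_lborel (block_flow A \<sigma>)"
proof -
  have "measure_preserving_lborel (\<lambda>p. (fst p, snd p + (- \<sigma> *\<^sub>R A (fst p), \<sigma>)))"
    by (rule measure_preserving_shear_snd[where c="\<lambda>x. (- \<sigma> *\<^sub>R A x, \<sigma>)"]) measurable
  also have "(\<lambda>p. (fst p, snd p + (- \<sigma> *\<^sub>R A (fst p), \<sigma>))) = block_flow A \<sigma>"
    by (auto simp: block_flow_def fun_eq_iff plus_prod_def)
  finally show ?thesis .
qed

lemma block_matrix_mult:
  fixes B1 :: "real ^ 'm0::finite ^ 'm1::finite"
  shows "(block_matrix B1 *v x) $ Inl i = 0" "(block_matrix B1 *v x) $ Inr k = (B1 *v block Inl x) $ k"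
proof -
  have split: "(\<Sum>j\<in>UNIV. f j) = (\<Sum>l\<in>UNIV. f (Inl l)) + (\<Sum>k\<in>UNIV. f (Inr k))" for f :: "'m0 + 'm1 \<Rightarrow> real"
    using sum.Plus[of "UNIV :: 'm0 set" "UNIV :: 'm1 set" f] by (simp add: comp_def)
  show "(block_matrix B1 *v x) $ Inl i = 0"
    by (simp add: matrix_vector_mult_def block_matrix_def)
  show "(block_matrix B1 *v x) $ Inr k = (B1 *v block Inl x) $ k"
    by (simp add: matrix_vector_mult_def split block_matrix_def block_def)
qed

lemma join_coords_nth:
  "fst (join_coords p) $ Inl i = fst p $ i" "fst (join_coords p) $ Inr k = fst (snd p) $ k"
  "snd (join_coords p) = snd (snd p)"
  by (simp_all add: join_coords_def)

lemma flow_join_coords: "flow (block_matrix B1) \<sigma> (join_coords p) = join_coords (block_flow (\<lambda>x. B1 *v x) \<sigma> p)"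
proof -
  have "fst (flow (block_matrix B1) \<sigma> (join_coords p)) $ k = fst (join_coords (block_flow (\<lambda>x. B1 *v x) \<sigma> p)) $ k" for k
    by (cases k) (simp_all add: flow_def block_flow_def block_matrix_mult join_coords_nth)
  then show ?thesis
    by (simp add: prod_eq_iff vec_eq_iff) (simp add: flow_def block_flow_def join_coords_nth)
qed

lemma nilpotent_drift_block_matrix:
  fixes B1 :: "real ^ 'm0::finite ^ 'm1::finite"
  shows "nilpotent_drift (block_matrix B1)"
proof
  fix x :: "real ^ ('m0 + 'm1)"
  have "block Inl (block_matrix B1 *v x) = 0" by (simp add: block_def block_matrix_mult vec_eq_iff)
  then have "(block_matrix B1 *v (block_matrix B1 *v x)) $ k = 0" for k
    by (cases k) (simp_all add: block_matrix_mult)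
  then show "block_matrix B1 *v (block_matrix B1 *v x) = 0" by (simp add: vec_eq_iff)
  show "block_matrix B1 $ i $ i = 0" for i by (cases i) (simp_all add: block_matrix_def)
  fix \<sigma>
  have "flow (block_matrix B1) \<sigma> = (\<lambda>z. join_coords (block_flow (\<lambda>x. B1 *v x) \<sigma> (split_coords z)))"
  proof
    show "flow (block_matrix B1) \<sigma> z = join_coords (block_flow (\<lambda>x. B1 *v x) \<sigma> (split_coords z))" for z
      using flow_join_coords[of B1 \<sigma> "split_coords z"] unfolding join_split_coords .
  qed
  moreover have "(\<lambda>x. B1 *v x) \<in> borel_measurable borel"
    by (intro borel_measurable_continuous_onI continuous_matrix_vector_mult continuous_on_id)
  ultimately show "measure_preserving_lborel (flow (block_matrix B1) \<sigma>)"
    using measure_preserving_compose[OF measure_preserving_join_coords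
        measure_preserving_compose[OF measure_preserving_block_flow measure_preserving_split_coords]] by simp
qed

lemma duhamel_bound_block:
  fixes B1 :: "real ^ 'm0::finite ^ 'm1::finite"
  defines "A \<equiv> \<lambda>x. B1 *v x"
  assumes u: "L2 u" and g: "L2 g" and h: "L2 h" and sol: "solves_Y (block_matrix B1) u g" and \<tau>: "\<tau> \<ge> 0"
    and M: "\<And>\<sigma>. 0 \<le> \<sigma> \<Longrightarrow> \<sigma> \<le> \<tau> \<Longrightarrow> cmod (LINT p|lborel. g (join_coords (block_flow A (- \<sigma>) p)) * h p) \<le> M"
  shows "cmod (LINT p|lborel. (u (join_coords (block_flow A (- \<tau>) p)) - u (join_coords p)) * h p) \<le> \<tau> * M"
proof -
  interpret nilpotent_drift "block_matrix B1" by (rule nilpotent_drift_block_matrix)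
  note [measurable] = mp_measurable[OF measure_preserving_split_coords] flow_measurable(2)
  have [measurable]: "u \<in> borel_measurable borel" "g \<in> borel_measurable borel" "h \<in> borel_measurable borel" using u g h by auto
  define k where "k z = h (split_coords z)" for z
  have k: "L2 k" unfolding k_def by (rule mp_L2[OF measure_preserving_split_coords h])
  have [measurable]: "k \<in> borel_measurable borel" using k by auto
  have eq: "(LINT p|lborel. f (join_coords p) * h p) = (LINT z|lborel. f z * k z)" if [measurable]: "f \<in> borel_measurable borel" for f
    using mp_integral[OF measure_preserving_join_coords, of "\<lambda>z. f z * k z"] by (simp add: k_def)
  have 1: "(LINT p|lborel. g (join_coords (block_flow A (- \<sigma>) p)) * h p) = (LINT z|lborel. g (flow (block_matrix B1) (- \<sigma>) z) * k z)" for \<sigma>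
    unfolding A_def flow_join_coords[symmetric] by (rule eq) measurable
  have 2: "(LINT p|lborel. (u (join_coords (block_flow A (- \<tau>) p)) - u (join_coords p)) * h p)
      = (LINT z|lborel. (u (flow (block_matrix B1) (- \<tau>) z) - u z) * k z)"
    unfolding A_def flow_join_coords[symmetric] by (rule eq[of "\<lambda>z. u (flow (block_matrix B1) (- \<tau>) z) - u z"]) measurable
  show ?thesis
    unfolding 2 using M unfolding 1 by (intro duhamel_bound[OF u g k sol \<tau>])
qed

section \<open>The transport equation on the Fourier side\<close>

lemma fourier_fst_modulate:
  fixes h :: "'a::euclidean_space \<times> 'b::euclidean_space \<Rightarrow> complex"
  shows "fourier_fst (\<lambda>p. cis (fst p \<bullet> a (snd p)) * h (fst p, T (snd p))) p = fourier_fst h (fst p - a (snd p), T (snd p))"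
proof -
  have "cis (- (fst p \<bullet> y)) * (cis (y \<bullet> a (snd p)) * h (y, T (snd p))) = cis (- ((fst p - a (snd p)) \<bullet> y)) * h (y, T (snd p))" for y
  proof -
    have "cis (- (fst p \<bullet> y)) * cis (y \<bullet> a (snd p)) = cis (- ((fst p - a (snd p)) \<bullet> y))"
      unfolding cis_mult using inner_commute[of y "a (snd p)"] by (simp add: inner_diff_left)
    then show ?thesis by (metis mult.assoc)
  qed
  then show ?thesis unfolding fourier_fst_def fourier_def by (simp only: fst_conv snd_conv)
qed

text \<open>The shift may depend on the untransformed variable. The phase and the constant shift
  \<open>d\<close> are absorbed into the test function, which keeps its bounded support.\<close>

lemma is_FT_translate:
  fixes f :: "'a::euclidean_space \<times> 'b::euclidean_space \<Rightarrow> complex"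
  assumes F: "is_FT f F" and a [measurable]: "a \<in> borel_measurable borel"
  shows "is_FT (\<lambda>p. f (fst p + a (snd p), snd p + d)) (\<lambda>p. cis (fst p \<bullet> a (snd p)) * F (fst p, snd p + d))"
proof -
  have [measurable]: "f \<in> borel_measurable borel" "F \<in> borel_measurable borel" using is_FT_L2[OF F] by auto
  have mp1: "measure_preserving_lborel (\<lambda>p::'a \<times> 'b. (fst p, snd p + e))" for e
    using measure_preserving_shear_snd[of "\<lambda>_::'a. e"] by simp
  have mp2: "measure_preserving_lborel (\<lambda>p::'a \<times> 'b. (fst p + a (snd p), snd p + d))"
    using measure_preserving_compose[OF mp1[of d] measure_preserving_shear_fst[OF a]] by simp
  show ?thesis
    unfolding is_FT_def
  proof (intro conjI allI impI)
    show "L2 (\<lambda>p. f (fst p + a (snd p), snd p + d))" by (rule mp_L2[OF mp2 is_FT_L2(1)[OF F]])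
    have "L2 (\<lambda>p. F (fst p, snd p + d))" by (rule mp_L2[OF mp1 is_FT_L2(2)[OF F]])
    then show "L2 (\<lambda>p. cis (fst p \<bullet> a (snd p)) * F (fst p, snd p + d))"
      by (rule L2_mult_bounded[where C=1]) auto
    fix h :: "'a \<times> 'b \<Rightarrow> complex" assume h: "L2_bdd h"
    have [measurable]: "h \<in> borel_measurable borel" using L2_bdd_L2[OF h] by auto
    define k where "k p = cis (fst p \<bullet> a (snd p - d)) * h (fst p, snd p - d)" for p
    have "L2_bdd k"
      unfolding L2_bdd_def
    proof
      have "L2 (\<lambda>p. h (fst p, snd p - d))"
        using mp_L2[OF mp1[of "- d"] L2_bdd_L2[OF h]] by simp
      then show "L2 k" unfolding k_def by (rule L2_mult_bounded[where C=1]) auto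
      obtain R where R: "\<And>p. norm p > R \<Longrightarrow> h p = 0" using h by (auto simp: L2_bdd_def)
      have "k p = 0" if "norm p > R + norm d" for p
      proof -
        have "norm p \<le> norm (fst p, snd p - d) + norm (0 :: 'a, d)"
          using norm_triangle_ineq[of "(fst p, snd p - d)" "(0, d)"] by simp
        then have "norm (fst p, snd p - d) > R" using that by (simp add: norm_Pair)
        then show ?thesis using R by (simp add: k_def)
      qed
      then show "\<exists>R. \<forall>p. norm p > R \<longrightarrow> k p = 0" by blast
    qed
    note k = this
    have [measurable]: "k \<in> borel_measurable borel" using L2_bdd_L2[OF k] by auto
    have "(LINT p|lborel. cis (fst p \<bullet> a (snd p)) * F (fst p, snd p + d) * h p)
        = (LINT p|lborel. F (fst p, snd p + d) * k (fst p, snd p + d))"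
      by (simp add: k_def mult_ac)
    also have "\<dots> = (LINT p|lborel. F p * k p)"
      by (rule mp_integral[OF mp1]) measurable
    also have "\<dots> = (LINT p|lborel. f p * fourier_fst k p)" by (rule is_FT_test[OF F k])
    also have "\<dots> = (LINT p|lborel. f (fst p + a (snd p), snd p + d) * fourier_fst k (fst p + a (snd p), snd p + d))"
      by (rule mp_integral[OF mp2, symmetric]) measurable
    also have "\<dots> = (LINT p|lborel. f (fst p + a (snd p), snd p + d) * fourier_fst h p)"
      unfolding k_def[abs_def] by (subst fourier_fst_modulate[where a="\<lambda>z. a (z - d)" and T="\<lambda>z. z - d"]) simp
    finally show "(LINT p|lborel. cis (fst p \<bullet> a (snd p)) * F (fst p, snd p + d) * h p)
        = (LINT p|lborel. f (fst p + a (snd p), snd p + d) * fourier_fst h p)" .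
  qed
qed

text \<open>Translation read through inversion; the conjugates reverse the sign of the phase, hence
  the shift by \<open>- a\<close>.\<close>

lemma is_FT_modulate:
  fixes f :: "'a::euclidean_space \<times> 'b::euclidean_space \<Rightarrow> complex"
  assumes F: "is_FT f F" and a [measurable]: "a \<in> borel_measurable borel"
  shows "is_FT (\<lambda>p. cis (fst p \<bullet> a (snd p)) * f (fst p, snd p + d)) (\<lambda>p. F (fst p - a (snd p), snd p + d))"
  using is_FT_inversion[OF is_FT_translate[OF is_FT_inversion[OF F], of "\<lambda>z. - a z" d]]
  by (simp add: cis_cnj)

definition dual_flow :: "('b \<Rightarrow> 'a) \<Rightarrow> real \<Rightarrow> 'a::euclidean_space \<times> ('b::euclidean_space \<times> real) \<Rightarrow> 'a \<times> ('b \<times> real)" where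
  "dual_flow w \<tau> p = (fst p - \<tau> *\<^sub>R w (fst (snd p)), (fst (snd p), snd (snd p) - \<tau>))"

lemma measure_preserving_dual_flow:
  assumes [measurable]: "w \<in> borel_measurable borel"
  shows "measure_preserving_lborel (dual_flow w \<tau>)"
proof -
  have "measure_preserving_lborel (\<lambda>p. (fst p + (- \<tau> *\<^sub>R w (fst (snd p))), snd p))"
    by (rule measure_preserving_shear_fst[where c="\<lambda>z. - \<tau> *\<^sub>R w (fst z)"]) measurable
  from measure_preserving_compose[OF measure_preserving_translation[of "(0, (0, - \<tau>))"] this]
  have "measure_preserving_lborel (\<lambda>p. (fst p + (- \<tau> *\<^sub>R w (fst (snd p))), snd p) + (0, (0, - \<tau>)))" .
  also have "(\<lambda>p. (fst p + (- \<tau> *\<^sub>R w (fst (snd p))), snd p) + (0, (0, - \<tau>))) = dual_flow w \<tau>"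
    by (auto simp: dual_flow_def fun_eq_iff)
  finally show ?thesis .
qed

text \<open>The shift in the second block becomes a phase under the transform in that block. Since
  \<open>w\<close> is adjoint to \<open>A\<close>, this phase is a modulation in the first variable,
  which the transform in the first block turns into a shift by a multiple of
  \<open>w\<close>.\<close>

lemma FT_block_flow:
  fixes u :: "'a::euclidean_space \<times> ('b::euclidean_space \<times> real) \<Rightarrow> complex"
  assumes b: "is_FT2 u b" and c: "is_FT b c"
    and A [measurable]: "A \<in> borel_measurable borel" and w [measurable]: "w \<in> borel_measurable borel"
    and adj: "\<And>x \<eta>. w \<eta> \<bullet> x = \<eta> \<bullet> A x"
  obtains b' where "is_FT2 (\<lambda>p. u (block_flow A (- \<tau>) p)) b'" "is_FT b' (\<lambda>p. c (dual_flow w \<tau> p))"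
proof
  define b' where "b' p = cis (fst p \<bullet> (\<tau> *\<^sub>R w (fst (snd p)))) * b (fst p, snd p + (0, - \<tau>))" for p
  have "is_FT (\<lambda>q. u (swap3 (fst q + \<tau> *\<^sub>R A (fst (snd q)), snd q + (0, - \<tau>))))
      (\<lambda>q. cis (fst q \<bullet> (\<tau> *\<^sub>R A (fst (snd q)))) * b (swap3 (fst q, snd q + (0, - \<tau>))))"
    using b unfolding is_FT2_def by (rule is_FT_translate) measurable
  moreover have "(\<lambda>q. u (swap3 (fst q + \<tau> *\<^sub>R A (fst (snd q)), snd q + (0, - \<tau>)))) = (\<lambda>q. u (block_flow A (- \<tau>) (swap3 q)))"
    by (auto simp: block_flow_def swap3_def fun_eq_iff)
  moreover have "(\<lambda>q. cis (fst q \<bullet> (\<tau> *\<^sub>R A (fst (snd q)))) * b (swap3 (fst q, snd q + (0, - \<tau>)))) = (\<lambda>q. b' (swap3 q))"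
    by (auto simp: b'_def swap3_def fun_eq_iff adj inner_commute[of _ "w _"])
  ultimately show "is_FT2 (\<lambda>p. u (block_flow A (- \<tau>) p)) b'" by (simp add: is_FT2_def)
  have "is_FT b' (\<lambda>p. c (fst p - \<tau> *\<^sub>R w (fst (snd p)), snd p + (0, - \<tau>)))"
    unfolding b'_def[abs_def] by (rule is_FT_modulate[OF c, where a="\<lambda>z. \<tau> *\<^sub>R w (fst z)"]) measurable
  moreover have "(\<lambda>p. c (fst p - \<tau> *\<^sub>R w (fst (snd p)), snd p + (0, - \<tau>))) = (\<lambda>p. c (dual_flow w \<tau> p))"
    by (auto simp: dual_flow_def fun_eq_iff)
  ultimately show "is_FT b' (\<lambda>p. c (dual_flow w \<tau> p))" by simp
qed

lemma duhamel_bound_dual: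
  fixes u g :: "'a::euclidean_space \<times> ('b::euclidean_space \<times> real) \<Rightarrow> complex"
  assumes u: "is_FT2 u bu" "is_FT bu cu" and g: "is_FT2 g bg" "is_FT bg cg"
    and A: "A \<in> borel_measurable borel" and w: "w \<in> borel_measurable borel"
    and adj: "\<And>x \<eta>. w \<eta> \<bullet> x = \<eta> \<bullet> A x"
    and duhamel: "\<And>h M. L2 h \<Longrightarrow>
        (\<And>\<sigma>. 0 \<le> \<sigma> \<Longrightarrow> \<sigma> \<le> \<tau> \<Longrightarrow> cmod (LINT p|lborel. g (block_flow A (- \<sigma>) p) * h p) \<le> M) \<Longrightarrow>
        cmod (LINT p|lborel. (u (block_flow A (- \<tau>) p) - u p) * h p) \<le> \<tau> * M"
    and k: "L2 k"
    and M: "\<And>\<sigma>. 0 \<le> \<sigma> \<Longrightarrow> \<sigma> \<le> \<tau> \<Longrightarrow> cmod (LINT p|lborel. cg (dual_flow w \<sigma> p) * k p) \<le> M"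
  shows "cmod (LINT p|lborel. (cu (dual_flow w \<tau> p) - cu p) * k p) \<le> \<tau> * M"
proof -
  \<comment> \<open>\<open>h\<close> will be the transform of \<open>k\<close> in both blocks.
    Duality, which involves no conjugation, turns every pairing with \<open>k\<close> on the Fourier
    side into a pairing with \<open>h\<close> in the original variables.\<close>
  obtain k1 where k1: "is_FT k k1" using is_FT_ex[OF k] by blast
  obtain h where h: "is_FT2 k1 h" using is_FT2_ex[OF is_FT_L2(2)[OF k1]] by blast
  note L2h = is_FT2_L2(2)[OF h]
  have pair: "(LINT p|lborel. c p * k p) = (LINT p|lborel. f p * h p)" if "is_FT2 f b" "is_FT b c" for f b c
    using is_FT_duality[OF that(2) k1] is_FT2_duality[OF that(1) h] by simp
  have pair_flow: "(LINT p|lborel. c (dual_flow w \<sigma> p) * k p) = (LINT p|lborel. f (block_flow A (- \<sigma>) p) * h p)"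
    if "is_FT2 f b" "is_FT b c" for f b c \<sigma>
    using FT_block_flow[OF that A w adj, where \<tau>=\<sigma>] pair by metis
  have L2u: "L2 u" "L2 cu" using u is_FT2_L2 is_FT_L2 by blast+
  have L2u': "L2 (\<lambda>p. u (block_flow A (- \<tau>) p))" "L2 (\<lambda>p. cu (dual_flow w \<tau> p))"
    by (intro mp_L2[OF measure_preserving_block_flow[OF A]] mp_L2[OF measure_preserving_dual_flow[OF w]] L2u)+
  have "(LINT p|lborel. (cu (dual_flow w \<tau> p) - cu p) * k p) = (LINT p|lborel. (u (block_flow A (- \<tau>) p) - u p) * h p)"
    using L2_mult_bound(1)[OF L2u(1) L2h] L2_mult_bound(1)[OF L2u(2) k] L2_mult_bound(1)[OF L2u'(1) L2h] L2_mult_bound(1)[OF L2u'(2) k]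
    by (simp add: left_diff_distrib pair[OF u] pair_flow[OF u])
  then show ?thesis
    using duhamel[OF L2h, of M] M by (simp add: pair_flow[OF g])
qed

section \<open>The energy estimate\<close>

text \<open>The gap keeps \<open>\<bar>x - \<sigma>\<bar> powr \<gamma>\<close> away from its zero for all shifts \<open>\<sigma> \<le> \<delta>\<close>. With it, the
  equation is only used over a time interval of length \<open>\<delta>\<close>, and \<open>L\<^sup>2\<close>-continuity of the flow is not
  needed.\<close>

definition gap :: "real \<Rightarrow> real \<Rightarrow> real" where
  "gap \<delta> x = (if x > \<delta> then x - \<delta> else if x < - \<delta> then x + \<delta> else 0)"

lemma gap_measurable [measurable]: "gap \<delta> \<in> borel_measurable borel"
  unfolding gap_def by measurable

lemma gap_abs_le: "0 \<le> \<sigma> \<Longrightarrow> \<sigma> \<le> \<delta> \<Longrightarrow> \<bar>gap \<delta> x\<bar> \<le> \<bar>x - \<sigma>\<bar>"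
  by (auto simp: gap_def)

text \<open>Two independent shifts are allowed because in the energy argument \<open>e\<close> is
  displaced by an intermediate time and \<open>c\<close> by an end of the interval; the modulus of
  \<open>gap\<close> is dominated by both displaced arguments, and the exponents add up to
  1.\<close>

lemma gap_abs_le_powr:
  assumes "0 \<le> \<sigma>" "\<sigma> \<le> \<delta>" "0 \<le> \<sigma>'" "\<sigma>' \<le> \<delta>" "0 \<le> \<gamma>" "\<gamma> \<le> 1"
  shows "\<bar>gap \<delta> x\<bar> \<le> \<bar>x - \<sigma>\<bar> powr \<gamma> * \<bar>x - \<sigma>'\<bar> powr (1 - \<gamma>)"
proof (cases "gap \<delta> x = 0")
  case False
  then have "\<bar>gap \<delta> x\<bar> = \<bar>gap \<delta> x\<bar> powr \<gamma> * \<bar>gap \<delta> x\<bar> powr (1 - \<gamma>)"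
    by (simp flip: powr_add)
  also have "\<dots> \<le> \<bar>x - \<sigma>\<bar> powr \<gamma> * \<bar>x - \<sigma>'\<bar> powr (1 - \<gamma>)"
    using assms by (intro mult_mono powr_mono2 gap_abs_le) auto
  finally show ?thesis .
qed simp

text \<open>The discrete counterpart of unit speed: \<open>gap\<close> is nondecreasing, with slope
  1 outside the interval from -\<delta> to \<delta>.\<close>

lemma gap_shift: "\<delta> > 0 \<Longrightarrow> gap \<delta> (x + \<delta>) - gap \<delta> x \<ge> (if \<bar>x\<bar> \<ge> 2 * \<delta> then \<delta> else 0)"
  by (auto simp: gap_def)

text \<open>The situation on the Fourier side, with \<open>c\<close> and \<open>e\<close> coupled
  only through the paired Duhamel bound; the Fourier transform itself does not enter the energy
  argument.\<close>

locale transport_pair =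
  fixes w :: "'b::euclidean_space \<Rightarrow> 'a::euclidean_space"
    and c e :: "'a \<times> ('b \<times> real) \<Rightarrow> complex" and \<beta> \<gamma> :: real
  assumes w [measurable]: "w \<in> borel_measurable borel"
    and \<beta>: "\<beta> \<ge> 1" and \<gamma>: "0 \<le> \<gamma>" "\<gamma> \<le> 1"
    and c: "L2 c" and e: "L2 e"
    and X: "L2 (\<lambda>p. complex_of_real (norm (fst p) powr \<beta>) * c p)"
    and Y: "L2 (\<lambda>p. complex_of_real (norm (fst p) powr \<gamma>) * e p)"
    and duhamel: "\<And>\<tau> k M. \<tau> \<ge> 0 \<Longrightarrow> L2 k \<Longrightarrow>
        (\<And>\<sigma>. 0 \<le> \<sigma> \<Longrightarrow> \<sigma> \<le> \<tau> \<Longrightarrow> cmod (LINT p|lborel. e (dual_flow w \<sigma> p) * k p) \<le> M) \<Longrightarrow>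
        cmod (LINT p|lborel. (c (dual_flow w \<tau> p) - c p) * k p) \<le> \<tau> * M"
begin

definition "s = \<beta> / (1 - \<gamma> + \<beta>)"
definition "\<theta> = (1 - \<gamma>) / \<beta>"
definition "Xn = L2norm (\<lambda>p. complex_of_real (norm (fst p) powr \<beta>) * c p)"
definition "Yn = L2norm (\<lambda>p. complex_of_real (norm (fst p) powr \<gamma>) * e p)"

definition nw :: "'a \<times> ('b \<times> real) \<Rightarrow> real" where "nw p = norm (w (fst (snd p)))"
text \<open>Where \<open>w\<close> vanishes, division by zero makes this 0; the weight with
  \<open>\<epsilon> > 0\<close> vanishes there as well.\<close>

definition r :: "'a \<times> ('b \<times> real) \<Rightarrow> real" where "r p = (fst p \<bullet> w (fst (snd p))) / (nw p)\<^sup>2"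

text \<open>The cut-off from below tames the division by \<open>nw\<close> in \<open>r\<close>, and
  the one from above bounds the power. Since \<open>nw\<close> is constant along the flow, so is the
  weight.\<close>

definition weight :: "real \<Rightarrow> real \<Rightarrow> 'a \<times> ('b \<times> real) \<Rightarrow> real" where
  "weight \<epsilon> R p = (if \<epsilon> \<le> nw p \<and> nw p \<le> R then nw p powr (2 * s) else 0)"

text \<open>What is left of the weighted product of |r| and c once |\<zeta>| to the power \<gamma>
  has been handed to e, through the bound of \<open>nw\<close> |r| by |\<zeta>|.\<close>

definition Z :: "real \<Rightarrow> real \<Rightarrow> 'a \<times> ('b \<times> real) \<Rightarrow> complex" where
  "Z \<epsilon> R p = complex_of_real (weight \<epsilon> R p * nw p powr (- \<gamma>) * \<bar>r p\<bar> powr (1 - \<gamma>)) * c p"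

lemma s_pos: "s > 0"
  unfolding s_def using \<beta> \<gamma> by (intro divide_pos_pos) auto

lemma \<theta>: "0 \<le> \<theta>" "\<theta> \<le> 1"
  unfolding \<theta>_def using \<beta> \<gamma> by auto

lemma s_\<theta>: "s * (1 + \<theta>) = 1" "\<theta> * s = 1 - s"
proof -
  have d: "1 - \<gamma> + \<beta> \<noteq> 0" "\<beta> \<noteq> 0" using \<beta> \<gamma> by auto
  then have "1 + \<theta> = (1 - \<gamma> + \<beta>) / \<beta>" by (simp add: \<theta>_def add_divide_distrib)
  with d show "s * (1 + \<theta>) = 1" by (simp add: s_def)
  then show "\<theta> * s = 1 - s" by (simp add: distrib_left mult.commute)
qed

lemma measurable_c [measurable]: "c \<in> borel_measurable borel" "e \<in> borel_measurable borel"
  using c e by auto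

lemma nw_measurable [measurable]: "nw \<in> borel_measurable borel"
  unfolding nw_def by measurable

lemma r_measurable [measurable]: "r \<in> borel_measurable borel"
  unfolding r_def by measurable

lemma weight_measurable [measurable]: "weight \<epsilon> R \<in> borel_measurable borel"
  unfolding weight_def by measurable

lemma mp_dual_flow: "measure_preserving_lborel (dual_flow w \<tau>)"
  by (rule measure_preserving_dual_flow[OF w])

lemma dual_flow_measurable [measurable]: "dual_flow w \<tau> \<in> borel_measurable borel"
  using mp_measurable[OF mp_dual_flow] .

lemma nw_dual_flow [simp]: "nw (dual_flow w \<tau> p) = nw p"
  by (simp add: nw_def dual_flow_def)

lemma weight_dual_flow [simp]: "weight \<epsilon> R (dual_flow w \<tau> p) = weight \<epsilon> R p"
  by (simp add: weight_def)

lemma r_dual_flow: "nw p \<noteq> 0 \<Longrightarrow> r (dual_flow w \<tau> p) = r p - \<tau>"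
  unfolding r_def nw_dual_flow
  by (simp add: dual_flow_def nw_def inner_diff_left power2_norm_eq_inner diff_divide_distrib)

lemma dual_flow_minus [simp]: "dual_flow w (- \<tau>) (dual_flow w \<tau> p) = p"
  by (simp add: dual_flow_def)

lemma nw_r_le: "nw p * \<bar>r p\<bar> \<le> norm (fst p)"
proof (cases "nw p = 0")
  case False
  then have pos: "nw p > 0" by (simp add: nw_def)
  have "nw p * \<bar>r p\<bar> = \<bar>fst p \<bullet> w (fst (snd p))\<bar> / nw p"
    using pos by (simp add: r_def power2_eq_square)
  also have "\<dots> \<le> (norm (fst p) * nw p) / nw p"
    using pos Cauchy_Schwarz_ineq2[of "fst p" "w (fst (snd p))"] by (intro divide_right_mono) (auto simp: nw_def)
  finally show ?thesis using pos by simp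
qed simp

lemma weight_nonneg: "weight \<epsilon> R p \<ge> 0"
  by (simp add: weight_def)

lemma weight_le: "\<epsilon> > 0 \<Longrightarrow> weight \<epsilon> R p \<le> R powr (2 * s)"
  using s_pos by (auto simp: weight_def intro!: powr_mono2)

lemma weight_r_le:
  assumes "\<epsilon> > 0"
  shows "weight \<epsilon> R p * \<bar>r p\<bar> \<le> R powr (2 * s) / \<epsilon> * norm (fst p)"
proof (cases "\<epsilon> \<le> nw p \<and> nw p \<le> R")
  case True
  have "\<epsilon> * \<bar>r p\<bar> \<le> nw p * \<bar>r p\<bar>" using True by (intro mult_right_mono) auto
  also note nw_r_le
  finally have "\<bar>r p\<bar> \<le> norm (fst p) / \<epsilon>" using assms by (simp add: field_simps)
  then have "weight \<epsilon> R p * \<bar>r p\<bar> \<le> R powr (2 * s) * (norm (fst p) / \<epsilon>)"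
    using weight_le[OF assms] weight_nonneg by (intro mult_mono) auto
  then show ?thesis by simp
qed (use assms in \<open>auto simp: weight_def\<close>)

text \<open>Here \<beta> \<ge> 1 enters: a multiplier of linear growth in |\<zeta>| is dominated by
  a combination of 1 and |\<zeta>| to the power \<beta>.\<close>

lemma L2_growth:
  assumes [measurable]: "f \<in> borel_measurable borel" and K: "\<And>p. \<bar>f p\<bar> \<le> K * (1 + norm (fst p))" "K \<ge> 0"
  shows "L2 (\<lambda>p. complex_of_real (f p) * c p)"
proof (rule L2_bound(1))
  show "L2 (\<lambda>p. 2 * c p + complex_of_real (norm (fst p) powr \<beta>) * c p)"
    by (intro L2_add L2_cmult c X)
  show "(\<lambda>p. complex_of_real (f p) * c p) \<in> borel_measurable borel" by measurable
  show "AE p in lborel. cmod (complex_of_real (f p) * c p) \<le> K * cmod (2 * c p + complex_of_real (norm (fst p) powr \<beta>) * c p)"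
  proof (rule AE_I2)
    fix p :: "'a \<times> ('b \<times> real)"
    have "norm (fst p) \<le> 1 + norm (fst p) powr \<beta>"
    proof (cases "norm (fst p) \<le> 1")
      case False
      then have "norm (fst p) powr 1 \<le> norm (fst p) powr \<beta>" using \<beta> by (intro powr_mono) auto
      then show ?thesis using False by simp
    qed (simp add: add_increasing2)
    then have "\<bar>f p\<bar> \<le> K * (2 + norm (fst p) powr \<beta>)"
      using K(1)[of p] mult_left_mono[OF _ K(2), of "1 + norm (fst p)" "2 + norm (fst p) powr \<beta>"] by linarith
    from mult_right_mono[OF this norm_ge_zero[of "c p"]]
    have "\<bar>f p\<bar> * cmod (c p) \<le> K * ((2 + norm (fst p) powr \<beta>) * cmod (c p))"
      by (simp only: mult.assoc)
    moreover have "2 * c p + complex_of_real (norm (fst p) powr \<beta>) * c p = complex_of_real (2 + norm (fst p) powr \<beta>) * c p"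
      by (simp add: distrib_right)
    moreover have "cmod (complex_of_real (2 + norm (fst p) powr \<beta>)) = 2 + norm (fst p) powr \<beta>"
      by (simp only: norm_of_real) (simp add: add_nonneg_nonneg)
    ultimately show "cmod (complex_of_real (f p) * c p) \<le> K * cmod (2 * c p + complex_of_real (norm (fst p) powr \<beta>) * c p)"
      by (simp only: norm_mult norm_of_real)
  qed
qed (rule K(2))

lemma L2_weight_r: "\<epsilon> > 0 \<Longrightarrow> L2 (\<lambda>p. complex_of_real (weight \<epsilon> R p * r p) * c p)"
proof (rule L2_growth[where K="R powr (2 * s) / \<epsilon>"])
  fix p :: "'a \<times> ('b \<times> real)" assume \<epsilon>: "\<epsilon> > 0"
  have "\<bar>weight \<epsilon> R p * r p\<bar> \<le> R powr (2 * s) / \<epsilon> * norm (fst p)"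
    using weight_r_le[OF \<epsilon>, of R p] weight_nonneg[of \<epsilon> R p] by (simp add: abs_mult)
  also have "\<dots> \<le> R powr (2 * s) / \<epsilon> * (1 + norm (fst p))"
    using \<epsilon> by (intro mult_left_mono) auto
  finally show "\<bar>weight \<epsilon> R p * r p\<bar> \<le> R powr (2 * s) / \<epsilon> * (1 + norm (fst p))" .
qed auto

text \<open>As 1 - \<gamma> lies between 0 and 1, the power of |r| is at most 1 + |r|, so the
  multiplier grows at most linearly by \<open>weight_r_le\<close>.\<close>

lemma L2_Z:
  assumes \<epsilon>: "\<epsilon> > 0"
  shows "L2 (Z \<epsilon> R)"
  unfolding Z_def
proof (rule L2_growth[where K="\<epsilon> powr (- \<gamma>) * (R powr (2 * s) + R powr (2 * s) / \<epsilon>)"])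
  fix p :: "'a \<times> ('b \<times> real)"
  show "\<bar>weight \<epsilon> R p * nw p powr (- \<gamma>) * \<bar>r p\<bar> powr (1 - \<gamma>)\<bar>
      \<le> \<epsilon> powr (- \<gamma>) * (R powr (2 * s) + R powr (2 * s) / \<epsilon>) * (1 + norm (fst p))"
  proof (cases "weight \<epsilon> R p = 0")
    case False
    then have nw: "\<epsilon> \<le> nw p" by (auto simp: weight_def split: if_splits)
    have "\<bar>r p\<bar> powr (1 - \<gamma>) \<le> 1 + \<bar>r p\<bar>"
    proof (cases "\<bar>r p\<bar> \<le> 1")
      case True
      then have "\<bar>r p\<bar> powr (1 - \<gamma>) \<le> 1" using \<gamma> by (intro powr_le1) auto
      then show ?thesis by simp
    next
      case False
      then have "\<bar>r p\<bar> powr (1 - \<gamma>) \<le> \<bar>r p\<bar> powr 1" using \<gamma> by (intro powr_mono) auto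
      then show ?thesis by simp
    qed
    then have "weight \<epsilon> R p * \<bar>r p\<bar> powr (1 - \<gamma>) \<le> weight \<epsilon> R p + weight \<epsilon> R p * \<bar>r p\<bar>"
      using mult_left_mono[OF _ weight_nonneg, of "\<bar>r p\<bar> powr (1 - \<gamma>)" "1 + \<bar>r p\<bar>" \<epsilon> R p] by (simp add: distrib_left)
    also have "\<dots> \<le> R powr (2 * s) + R powr (2 * s) / \<epsilon> * norm (fst p)"
      by (intro add_mono weight_le weight_r_le \<epsilon>)
    also have "\<dots> \<le> (R powr (2 * s) + R powr (2 * s) / \<epsilon>) * (1 + norm (fst p))"
    proof -
      have "0 \<le> R powr (2 * s) * norm (fst p)" "0 \<le> R powr (2 * s) / \<epsilon>" using \<epsilon> by auto
      then show ?thesis unfolding distrib_left distrib_right by linarith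
    qed
    finally have 1: "weight \<epsilon> R p * \<bar>r p\<bar> powr (1 - \<gamma>) \<le> (R powr (2 * s) + R powr (2 * s) / \<epsilon>) * (1 + norm (fst p))" .
    have 2: "nw p powr (- \<gamma>) \<le> \<epsilon> powr (- \<gamma>)"
      using nw \<epsilon> \<gamma> by (intro powr_mono2') auto
    have "nw p powr (- \<gamma>) * (weight \<epsilon> R p * \<bar>r p\<bar> powr (1 - \<gamma>))
        \<le> \<epsilon> powr (- \<gamma>) * ((R powr (2 * s) + R powr (2 * s) / \<epsilon>) * (1 + norm (fst p)))"
      using weight_nonneg by (intro mult_mono 1 2) auto
    then show ?thesis using weight_nonneg[of \<epsilon> R p] by (simp add: abs_mult mult_ac)
  qed (use \<epsilon> in simp)
qed (use \<epsilon> in auto)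

text \<open>\<open>gap\<close> is split by \<open>gap_abs_le_powr\<close>. The power \<gamma>,
  together with the same power of \<open>nw\<close>, goes with \<open>e\<close> and the power 1 -
  \<gamma> with \<open>c\<close>, each at its own displaced point.\<close>

lemma pairing_pointwise:
  assumes \<sigma>: "0 \<le> \<sigma>" "\<sigma> \<le> \<delta>" "0 \<le> \<sigma>'" "\<sigma>' \<le> \<delta>" and \<epsilon>: "\<epsilon> > 0"
  shows "\<bar>weight \<epsilon> R p * gap \<delta> (r p)\<bar> * cmod (e (dual_flow w \<sigma> p)) * cmod (c (dual_flow w \<sigma>' p))
    \<le> cmod (complex_of_real (norm (fst (dual_flow w \<sigma> p)) powr \<gamma>) * e (dual_flow w \<sigma> p)) * cmod (Z \<epsilon> R (dual_flow w \<sigma>' p))"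
proof (cases "weight \<epsilon> R p = 0")
  case False
  then have nw: "nw p > 0" using \<epsilon> by (auto simp: weight_def split: if_splits)
  then have r\<sigma>: "r (dual_flow w \<sigma> p) = r p - \<sigma>" "r (dual_flow w \<sigma>' p) = r p - \<sigma>'"
    by (simp_all add: r_dual_flow)
  have "nw p powr \<gamma> * \<bar>r p - \<sigma>\<bar> powr \<gamma> = (nw p * \<bar>r p - \<sigma>\<bar>) powr \<gamma>"
    using nw by (simp add: powr_mult)
  also have "\<dots> \<le> norm (fst (dual_flow w \<sigma> p)) powr \<gamma>"
    using nw_r_le[of "dual_flow w \<sigma> p"] nw \<gamma> by (intro powr_mono2) (auto simp: r\<sigma>)
  finally have 1: "nw p powr \<gamma> * \<bar>r p - \<sigma>\<bar> powr \<gamma> \<le> norm (fst (dual_flow w \<sigma> p)) powr \<gamma>" .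
  have "\<bar>weight \<epsilon> R p * gap \<delta> (r p)\<bar> \<le> weight \<epsilon> R p * (\<bar>r p - \<sigma>\<bar> powr \<gamma> * \<bar>r p - \<sigma>'\<bar> powr (1 - \<gamma>))"
    using weight_nonneg[of \<epsilon> R p] \<sigma> \<gamma> by (simp add: abs_mult mult_left_mono gap_abs_le_powr)
  also have "\<dots> = (nw p powr \<gamma> * \<bar>r p - \<sigma>\<bar> powr \<gamma>) * (weight \<epsilon> R p * nw p powr (- \<gamma>) * \<bar>r p - \<sigma>'\<bar> powr (1 - \<gamma>))"
  proof -
    have "nw p powr \<gamma> * nw p powr (- \<gamma>) = 1" using nw by (simp flip: powr_add)
    then have "weight \<epsilon> R p * (\<bar>r p - \<sigma>\<bar> powr \<gamma> * \<bar>r p - \<sigma>'\<bar> powr (1 - \<gamma>))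
      = (nw p powr \<gamma> * nw p powr (- \<gamma>)) * (weight \<epsilon> R p * (\<bar>r p - \<sigma>\<bar> powr \<gamma> * \<bar>r p - \<sigma>'\<bar> powr (1 - \<gamma>)))"
      by simp
    then show ?thesis by (simp only: mult_ac)
  qed
  also have "\<dots> \<le> norm (fst (dual_flow w \<sigma> p)) powr \<gamma> * (weight \<epsilon> R p * nw p powr (- \<gamma>) * \<bar>r p - \<sigma>'\<bar> powr (1 - \<gamma>))"
    using weight_nonneg[of \<epsilon> R p] by (intro mult_right_mono 1) auto
  finally have "\<bar>weight \<epsilon> R p * gap \<delta> (r p)\<bar> * (cmod (e (dual_flow w \<sigma> p)) * cmod (c (dual_flow w \<sigma>' p)))
    \<le> norm (fst (dual_flow w \<sigma> p)) powr \<gamma> * (weight \<epsilon> R p * nw p powr (- \<gamma>) * \<bar>r p - \<sigma>'\<bar> powr (1 - \<gamma>))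
        * (cmod (e (dual_flow w \<sigma> p)) * cmod (c (dual_flow w \<sigma>' p)))"
    by (rule mult_right_mono) simp
  then show ?thesis
    using weight_nonneg[of \<epsilon> R p] by (simp add: Z_def norm_mult r\<sigma> abs_mult mult_ac)
qed simp

text \<open>Cauchy-Schwarz; the flow preserves measure, so the displacements disappear from the
  norms.\<close>

lemma pairing:
  fixes R :: real
  assumes \<sigma>: "0 \<le> \<sigma>" "\<sigma> \<le> \<delta>" "0 \<le> \<sigma>'" "\<sigma>' \<le> \<delta>" and \<epsilon>: "\<epsilon> > 0"
  defines "f \<equiv> \<lambda>p. \<bar>weight \<epsilon> R p * gap \<delta> (r p)\<bar> * cmod (e (dual_flow w \<sigma> p)) * cmod (c (dual_flow w \<sigma>' p))"
  shows "integrable lborel f" "integral\<^sup>L lborel f \<le> Yn * L2norm (Z \<epsilon> R)"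
proof -
  define E where "E p = complex_of_real (norm (fst p) powr \<gamma>) * e p" for p
  have L2E: "L2 E" unfolding E_def using Y .
  have YnE: "L2norm E = Yn" unfolding E_def Yn_def ..
  have E: "L2 (\<lambda>p. E (dual_flow w \<sigma> p))" "L2norm (\<lambda>p. E (dual_flow w \<sigma> p)) = Yn"
    unfolding YnE[symmetric] using mp_L2[OF mp_dual_flow L2E] mp_L2norm[OF mp_dual_flow L2_measurable[OF L2E]] by blast+
  have Z: "L2 (\<lambda>p. Z \<epsilon> R (dual_flow w \<sigma>' p))" "L2norm (\<lambda>p. Z \<epsilon> R (dual_flow w \<sigma>' p)) = L2norm (Z \<epsilon> R)"
    using mp_L2[OF mp_dual_flow L2_Z[OF \<epsilon>]] mp_L2norm[OF mp_dual_flow L2_measurable[OF L2_Z[OF \<epsilon>]]] by blast+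
  let ?g = "\<lambda>p. cmod (E (dual_flow w \<sigma> p)) * cmod (Z \<epsilon> R (dual_flow w \<sigma>' p))"
  have g: "integrable lborel ?g" by (rule L2_mult_bound(3)[OF E(1) Z(1)])
  have le: "f p \<le> ?g p" for p unfolding f_def E_def by (rule pairing_pointwise[OF \<sigma> \<epsilon>])
  have nn: "f p \<ge> 0" for p unfolding f_def by simp
  have "f \<in> borel_measurable lborel" unfolding f_def by measurable
  then show "integrable lborel f"
    using le nn by (intro Bochner_Integration.integrable_bound[OF g]) (auto simp: abs_of_nonneg)
  have "integral\<^sup>L lborel f \<le> integral\<^sup>L lborel ?g"
    using le nn by (intro integral_mono' g) auto
  also have "\<dots> \<le> Yn * L2norm (Z \<epsilon> R)"
    using L2_mult_bound(2)[OF E(1) Z(1)] by (simp add: E(2) Z(2))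
  finally show "integral\<^sup>L lborel f \<le> Yn * L2norm (Z \<epsilon> R)" .
qed

section \<open>The energy inequality by finite differences along the flow\<close>

lemma integrable_weight: "\<epsilon> > 0 \<Longrightarrow> integrable lborel (\<lambda>p. weight \<epsilon> R p * (cmod (c p))\<^sup>2)"
proof (rule Bochner_Integration.integrable_bound)
  show "integrable lborel (\<lambda>p. R powr (2 * s) * (cmod (c p))\<^sup>2)" using c by (simp add: L2_def)
  assume "\<epsilon> > 0"
  then show "AE p in lborel. norm (weight \<epsilon> R p * (cmod (c p))\<^sup>2) \<le> norm (R powr (2 * s) * (cmod (c p))\<^sup>2)"
    using weight_le weight_nonneg by (auto simp: abs_mult intro!: mult_right_mono)
qed measurable

text \<open>The Duhamel bound over time \<delta> replaces differentiation. The real part of (f - c)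
  k is a (|f|^2 - |c|^2), and a change of variables turns its integral into that of weight |c|^2
  times an increment of \<open>gap\<close>, which is at least \<delta> where |r| \<ge> 2 \<delta>.
  The Duhamel bound carries the same factor \<delta>, which cancels.\<close>

lemma energy_gap:
  assumes \<delta>: "\<delta> > 0" and \<epsilon>: "\<epsilon> > 0"
  shows "(LINT p|lborel. (if \<bar>r p\<bar> \<ge> 2 * \<delta> then weight \<epsilon> R p * (cmod (c p))\<^sup>2 else 0)) \<le> 2 * Yn * L2norm (Z \<epsilon> R)"
proof -
  define a where "a p = weight \<epsilon> R p * gap \<delta> (r p)" for p
  have [measurable]: "a \<in> borel_measurable borel" unfolding a_def by measurable
  define f where "f p = c (dual_flow w \<delta> p)" for p
  have f: "L2 f" unfolding f_def by (rule mp_L2[OF mp_dual_flow c])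
  have [measurable]: "f \<in> borel_measurable borel" using f by auto
  have ac: "L2 (\<lambda>p. complex_of_real (a p) * c p)"
  proof (rule L2_bound(1)[OF L2_weight_r[OF \<epsilon>, of R], of _ 1])
    have "\<bar>a p\<bar> \<le> \<bar>weight \<epsilon> R p * r p\<bar>" for p
      using gap_abs_le[of 0 \<delta> "r p"] \<delta> by (auto simp: a_def abs_mult intro!: mult_left_mono)
    then show "AE p in lborel. cmod (complex_of_real (a p) * c p) \<le> 1 * cmod (complex_of_real (weight \<epsilon> R p * r p) * c p)"
      by (auto simp: norm_mult simp del: of_real_mult intro!: mult_right_mono)
  qed auto
  \<comment> \<open>The displaced factor needs the bound of \<open>gap\<close> by |r - \<delta>|,
    which is |r| at the displaced point, in place of the bound by |r|.\<close>
  have af: "L2 (\<lambda>p. complex_of_real (a p) * f p)"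
  proof (rule L2_bound(1)[OF mp_L2[OF mp_dual_flow[of \<delta>] L2_weight_r[OF \<epsilon>, of R]], of _ 1])
    have "\<bar>a p\<bar> \<le> \<bar>weight \<epsilon> R (dual_flow w \<delta> p) * r (dual_flow w \<delta> p)\<bar>" for p
    proof (cases "weight \<epsilon> R p = 0")
      case False
      then have "nw p \<noteq> 0" using \<epsilon> by (auto simp: weight_def split: if_splits)
      then show ?thesis using gap_abs_le[of \<delta> \<delta> "r p"] \<delta>
        by (auto simp: a_def abs_mult r_dual_flow intro!: mult_left_mono)
    qed (simp add: a_def)
    then show "AE p in lborel. cmod (complex_of_real (a p) * f p)
        \<le> 1 * cmod (complex_of_real (weight \<epsilon> R (dual_flow w \<delta> p) * r (dual_flow w \<delta> p)) * c (dual_flow w \<delta> p))"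
      by (auto simp: norm_mult f_def simp del: of_real_mult weight_dual_flow intro!: mult_right_mono)
  qed auto
  \<comment> \<open>The conjugate of the sum of the values at both ends: multiplied by their
    difference it gives a difference of squares up to an imaginary part. Its two terms are the
    origin of the factor 2.\<close>
  define k where "k p = cnj (complex_of_real (a p) * f p + complex_of_real (a p) * c p)" for p
  have k: "L2 k" unfolding k_def by (intro L2_cnj L2_add ac af)
  have [measurable]: "k \<in> borel_measurable borel" using k by auto
  have "cmod (LINT p|lborel. e (dual_flow w \<sigma> p) * k p) \<le> 2 * Yn * L2norm (Z \<epsilon> R)" if \<sigma>: "0 \<le> \<sigma>" "\<sigma> \<le> \<delta>" for \<sigma>
  proof -
    have "0 \<le> \<delta>" using \<delta> by simp
    note p1 = pairing[OF \<sigma> this order_refl \<epsilon>, of R] and p0 = pairing[OF \<sigma> order_refl this \<epsilon>, of R]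
    have c0: "dual_flow w 0 p = p" for p by (simp add: dual_flow_def)
    let ?g = "\<lambda>\<sigma>' p. \<bar>a p\<bar> * cmod (e (dual_flow w \<sigma> p)) * cmod (c (dual_flow w \<sigma>' p))"
    have "cmod (LINT p|lborel. e (dual_flow w \<sigma> p) * k p) \<le> (LINT p|lborel. cmod (e (dual_flow w \<sigma> p) * k p))"
      by (rule integral_norm_bound)
    also have "\<dots> \<le> (LINT p|lborel. ?g \<delta> p + ?g 0 p)"
    proof (rule integral_mono')
      show "integrable lborel (\<lambda>p. ?g \<delta> p + ?g 0 p)"
        using p1(1) p0(1) unfolding a_def by (rule Bochner_Integration.integrable_add)
      fix p
      have ck: "cmod (k p) \<le> \<bar>a p\<bar> * cmod (f p) + \<bar>a p\<bar> * cmod (c p)"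
        unfolding k_def complex_mod_cnj by (rule order_trans[OF norm_triangle_ineq]) (simp add: norm_mult)
      show "cmod (e (dual_flow w \<sigma> p) * k p) \<le> ?g \<delta> p + ?g 0 p"
        using mult_left_mono[OF ck norm_ge_zero[of "e (dual_flow w \<sigma> p)"]]
        by (simp add: norm_mult c0 f_def distrib_left mult_ac)
    qed auto
    also have "\<dots> = (LINT p|lborel. ?g \<delta> p) + (LINT p|lborel. ?g 0 p)"
      using p1(1) p0(1) unfolding a_def by (rule Bochner_Integration.integral_add)
    also have "\<dots> \<le> 2 * Yn * L2norm (Z \<epsilon> R)"
      using p1(2) p0(2) unfolding a_def by simp
    finally show ?thesis .
  qed
  then have main: "cmod (LINT p|lborel. (f p - c p) * k p) \<le> \<delta> * (2 * Yn * L2norm (Z \<epsilon> R))"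
    unfolding f_def using \<delta> k by (intro duhamel) auto
  have re: "Re ((f p - c p) * k p) = a p * (cmod (f p))\<^sup>2 - a p * (cmod (c p))\<^sup>2" for p
    unfolding k_def cmod_power2 by (simp add: algebra_simps power2_eq_square)
  have i: "integrable lborel (\<lambda>p. a p * (cmod (f p))\<^sup>2)" "integrable lborel (\<lambda>p. a p * (cmod (c p))\<^sup>2)"
  proof -
    have eq: "a p * (cmod z)\<^sup>2 = Re (complex_of_real (a p) * z * cnj z)" for p z
      unfolding cmod_power2 by (simp add: algebra_simps power2_eq_square)
    show "integrable lborel (\<lambda>p. a p * (cmod (f p))\<^sup>2)" "integrable lborel (\<lambda>p. a p * (cmod (c p))\<^sup>2)"
      unfolding eq by (intro integrable_Re L2_mult_bound(1) L2_cnj af ac f c)+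
  qed
  \<comment> \<open>The flow is moved from \<open>c\<close> onto the coefficient, so that both terms
    carry the same |c|^2 and the increment of \<open>gap\<close> appears.\<close>
  let ?b = "\<lambda>p. a (dual_flow w (- \<delta>) p) * (cmod (c p))\<^sup>2"
  have b: "?b (dual_flow w \<delta> p) = a p * (cmod (f p))\<^sup>2" for p by (simp add: f_def)
  have ib: "integrable lborel ?b"
    using i(1) unfolding b[symmetric] by (subst (asm) mp_integrable[OF mp_dual_flow, of ?b]) measurable
  have Ib: "(LINT p|lborel. a p * (cmod (f p))\<^sup>2) = integral\<^sup>L lborel ?b"
    unfolding b[symmetric] by (rule mp_integral[OF mp_dual_flow]) measurable
  have int_k: "integrable lborel (\<lambda>p. (f p - c p) * k p)"
    by (intro L2_mult_bound(1) L2_diff f c k)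
  have "(LINT p|lborel. \<delta> * (if \<bar>r p\<bar> \<ge> 2 * \<delta> then weight \<epsilon> R p * (cmod (c p))\<^sup>2 else 0))
      \<le> (LINT p|lborel. ?b p - a p * (cmod (c p))\<^sup>2)"
  proof (rule integral_mono)
    have "integrable lborel (\<lambda>p. if \<bar>r p\<bar> \<ge> 2 * \<delta> then weight \<epsilon> R p * (cmod (c p))\<^sup>2 else 0)"
      by (rule Bochner_Integration.integrable_bound[OF integrable_weight[OF \<epsilon>, of R]]) (auto split: if_splits)
    then show "integrable lborel (\<lambda>p. \<delta> * (if \<bar>r p\<bar> \<ge> 2 * \<delta> then weight \<epsilon> R p * (cmod (c p))\<^sup>2 else 0))"
      by (rule integrable_mult_right)
    show "integrable lborel (\<lambda>p. ?b p - a p * (cmod (c p))\<^sup>2)" using ib i(2) by (rule Bochner_Integration.integrable_diff)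
    fix p
    show "\<delta> * (if \<bar>r p\<bar> \<ge> 2 * \<delta> then weight \<epsilon> R p * (cmod (c p))\<^sup>2 else 0) \<le> ?b p - a p * (cmod (c p))\<^sup>2"
    proof (cases "weight \<epsilon> R p = 0")
      case False
      then have "nw p \<noteq> 0" using \<epsilon> by (auto simp: weight_def split: if_splits)
      then have "?b p - a p * (cmod (c p))\<^sup>2 = (weight \<epsilon> R p * (cmod (c p))\<^sup>2) * (gap \<delta> (r p + \<delta>) - gap \<delta> (r p))"
        by (simp add: a_def r_dual_flow algebra_simps)
      also have "\<dots> \<ge> (weight \<epsilon> R p * (cmod (c p))\<^sup>2) * (if \<bar>r p\<bar> \<ge> 2 * \<delta> then \<delta> else 0)"
        using gap_shift[OF \<delta>] weight_nonneg by (intro mult_left_mono) auto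
      finally show ?thesis by (simp add: mult_ac split: if_splits)
    qed (simp add: a_def)
  qed
  also have "\<dots> = (LINT p|lborel. Re ((f p - c p) * k p))"
    unfolding re using ib i Ib by simp
  also have "\<dots> = Re (LINT p|lborel. (f p - c p) * k p)"
    by (rule integral_Re[OF int_k])
  also have "\<dots> \<le> \<delta> * (2 * Yn * L2norm (Z \<epsilon> R))"
    using complex_Re_le_cmod main by (rule order_trans)
  finally show ?thesis using \<delta> by simp
qed

text \<open>For fixed \<eta> and t with w \<noteq> 0 the zeros of \<open>r\<close> form a hyperplane
  in \<zeta>, hence a null set.\<close>

lemma AE_r_nonzero: "AE p in lborel. nw p \<noteq> 0 \<longrightarrow> r p \<noteq> 0"
proof (rule AE_lborel_prodI)
  show "Measurable.pred borel (\<lambda>p. nw p \<noteq> 0 \<longrightarrow> r p \<noteq> 0)" by measurable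
  have "AE x in lborel. nw (x, z) \<noteq> 0 \<longrightarrow> r (x, z) \<noteq> 0" for z
  proof (cases "w (fst z) = 0")
    case False
    have "negligible {x. w (fst z) \<bullet> x = 0}" using False by (intro negligible_hyperplane) simp
    then have "{x. w (fst z) \<bullet> x = 0} \<in> null_sets lebesgue" by (simp add: negligible_iff_null_sets)
    moreover have "{x. w (fst z) \<bullet> x = 0} \<in> sets lborel"
      using closed_hyperplane[of "w (fst z)" 0] by (simp add: borel_closed)
    ultimately have "{x. w (fst z) \<bullet> x = 0} \<in> null_sets lborel"
      by (simp add: null_sets_completion_iff)
    from AE_not_in[OF this] show ?thesis
      by eventually_elim (simp add: r_def inner_commute)
  qed (simp add: nw_def)
  then show "AE z in lborel. AE x in lborel. nw (x, z) \<noteq> 0 \<longrightarrow> r (x, z) \<noteq> 0" by simp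
qed

text \<open>\<open>energy_gap\<close> with \<delta> tending to 0: where the weight is nonzero, the
  excluded set shrinks to the zeros of \<open>r\<close>, a null set.\<close>

lemma energy:
  assumes \<epsilon>: "\<epsilon> > 0"
  shows "(LINT p|lborel. weight \<epsilon> R p * (cmod (c p))\<^sup>2) \<le> 2 * Yn * L2norm (Z \<epsilon> R)"
proof (rule LIMSEQ_le_const2)
  let ?f = "\<lambda>n p. if \<bar>r p\<bar> \<ge> 2 * inverse (real (Suc n)) then weight \<epsilon> R p * (cmod (c p))\<^sup>2 else 0"
  show "(\<lambda>n. LINT p|lborel. ?f n p) \<longlonglongrightarrow> (LINT p|lborel. weight \<epsilon> R p * (cmod (c p))\<^sup>2)"
  proof (rule integral_dominated_convergence[where w="\<lambda>p. weight \<epsilon> R p * (cmod (c p))\<^sup>2"])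
    show "AE p in lborel. (\<lambda>n. ?f n p) \<longlonglongrightarrow> weight \<epsilon> R p * (cmod (c p))\<^sup>2"
      using AE_r_nonzero
    proof eventually_elim
      case (elim p)
      show ?case
      proof (cases "weight \<epsilon> R p = 0")
        case False
        then have "nw p \<noteq> 0" using \<epsilon> by (auto simp: weight_def split: if_splits)
        then have "\<bar>r p\<bar> > 0" using elim by simp
        moreover have "(\<lambda>n. 2 * inverse (real (Suc n))) \<longlonglongrightarrow> 0"
          by (intro tendsto_mult_right_zero LIMSEQ_inverse_real_of_nat)
        ultimately have "\<forall>\<^sub>F n in sequentially. 2 * inverse (real (Suc n)) < \<bar>r p\<bar>"
          by (rule order_tendstoD(2)[rotated])
        then have "\<forall>\<^sub>F n in sequentially. ?f n p = weight \<epsilon> R p * (cmod (c p))\<^sup>2"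
          by eventually_elim simp
        then show ?thesis by (rule tendsto_eventually)
      next
        case True
        then have "?f n p = 0" for n by simp
        then show ?thesis using True by simp
      qed
    qed
    show "AE p in lborel. norm (?f n p) \<le> weight \<epsilon> R p * (cmod (c p))\<^sup>2" for n
      using weight_nonneg by (auto simp: abs_mult)
  qed (use integrable_weight[OF \<epsilon>] in auto)
  show "\<exists>N. \<forall>n\<ge>N. (LINT p|lborel. ?f n p) \<le> 2 * Yn * L2norm (Z \<epsilon> R)"
    using energy_gap[OF _ \<epsilon>] by (intro exI[of _ 0] allI impI) simp
qed

text \<open>Young's inequality with free normalisations \<open>A\<close> and \<open>K\<close>. When
  these are the integrals of the two functions on the right, integration yields Hoelder's
  inequality.\<close>

lemma Z_pointwise:
  assumes \<epsilon>: "\<epsilon> > 0" and A: "A > 0" and K: "K > 0"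
  shows "(cmod (Z \<epsilon> R p))\<^sup>2 \<le> (A powr (1 - \<theta>) * K powr \<theta>) *
    ((1 - \<theta>) * (weight \<epsilon> R p * (cmod (c p))\<^sup>2 / A) + \<theta> * ((norm (fst p) powr \<beta> * cmod (c p))\<^sup>2 / K))"
    (is "_ \<le> ?L * ?Y")
proof -
  have Y: "?Y \<ge> 0" using A K \<theta> weight_nonneg[of \<epsilon> R p] by (intro add_nonneg_nonneg mult_nonneg_nonneg divide_nonneg_pos) auto
  show ?thesis
  proof (cases "weight \<epsilon> R p = 0 \<or> c p = 0 \<or> r p = 0")
    case True
    then have "Z \<epsilon> R p = 0" by (auto simp: Z_def)
    then show ?thesis using Y by simp
  next
    case False
    then have nw: "nw p > 0" using \<epsilon> by (auto simp: weight_def split: if_splits)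
    have weight: "weight \<epsilon> R p = nw p powr (2 * s)" using False by (auto simp: weight_def split: if_splits)
    have rp: "\<bar>r p\<bar> > 0" and cp: "cmod (c p) > 0" using False by auto
    define x where "x = nw p powr (2 * s) * (cmod (c p))\<^sup>2"
    define y where "y = ((nw p * \<bar>r p\<bar>) powr \<beta> * cmod (c p))\<^sup>2"
    have xy: "x > 0" "y > 0" unfolding x_def y_def using nw rp cp by auto
    have sq: "(u powr v)\<^sup>2 = u powr (2 * v)" for u v :: real
      by (simp add: powr_add[symmetric] power2_eq_square)
    have c2: "(cmod (c p))\<^sup>2 = (cmod (c p))\<^sup>2 powr (1 - \<theta>) * (cmod (c p))\<^sup>2 powr \<theta>"
      using cp by (simp flip: powr_add)
    \<comment> \<open>The powers of \<open>nw\<close> must match. Given \<beta> \<theta> = 1 -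
      \<gamma>, this is equivalent to s (1 + \<theta>) = 1, which is what determines
      \<open>s\<close>.\<close>
    have e1: "4 * s - 2 * \<gamma> = 2 * s * (1 - \<theta>) + 2 * \<beta> * \<theta>"
    proof -
      have "\<beta> * \<theta> = 1 - \<gamma>" using \<beta> by (simp add: \<theta>_def)
      moreover have "s * \<theta> = 1 - s" using s_\<theta>(2) by (simp add: mult.commute)
      ultimately show ?thesis by (simp add: algebra_simps)
    qed
    have e2: "2 * (1 - \<gamma>) = 2 * \<beta> * \<theta>" using \<beta> by (simp add: \<theta>_def)
    have "(cmod (Z \<epsilon> R p))\<^sup>2 = nw p powr (4 * s - 2 * \<gamma>) * \<bar>r p\<bar> powr (2 * (1 - \<gamma>)) * (cmod (c p))\<^sup>2"
      using nw by (simp add: Z_def norm_mult weight power_mult_distrib sq abs_mult flip: powr_add) 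
    also have "\<dots> = x powr (1 - \<theta>) * y powr \<theta>"
    proof -
      have "x powr (1 - \<theta>) = nw p powr (2 * s * (1 - \<theta>)) * (cmod (c p))\<^sup>2 powr (1 - \<theta>)"
        unfolding x_def using nw cp by (simp add: powr_mult powr_powr)
      moreover have "y = nw p powr (2 * \<beta>) * \<bar>r p\<bar> powr (2 * \<beta>) * (cmod (c p))\<^sup>2"
        unfolding y_def using nw rp by (simp add: power_mult_distrib powr_mult sq)
      then have "y powr \<theta> = nw p powr (2 * \<beta> * \<theta>) * \<bar>r p\<bar> powr (2 * \<beta> * \<theta>) * (cmod (c p))\<^sup>2 powr \<theta>"
        using nw rp cp by (simp add: powr_mult powr_powr)
      ultimately show ?thesis
        unfolding e1 e2 powr_add by (subst c2) (simp only: mult_ac)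
    qed
    also have "\<dots> = ?L * ((x / A) powr (1 - \<theta>) * (y / K) powr \<theta>)"
      using A K xy by (simp add: powr_divide)
    also have "\<dots> \<le> ?L * ((1 - \<theta>) * (x / A) + \<theta> * (y / K))"
      using A K xy \<theta> by (intro mult_left_mono Youngs_inequality_0) auto
    also have "\<dots> \<le> ?L * ?Y"
    proof -
      have "y \<le> (norm (fst p) powr \<beta> * cmod (c p))\<^sup>2"
        unfolding y_def using nw_r_le[of p] nw \<beta> by (intro power_mono mult_right_mono powr_mono2) auto
      then show ?thesis
        using A K \<theta> by (intro mult_left_mono add_mono) (auto simp: x_def weight intro!: mult_left_mono divide_right_mono)
    qed
    finally show ?thesis .
  qed
qed

text \<open>\<open>Z_pointwise\<close> is applied with the squares of \<open>A\<close> and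
  \<open>Xn\<close>, the integrals of the two functions, so that both quotients integrate to 1 and
  the coefficients add up to 1.\<close>

lemma Z_norm_le:
  assumes \<epsilon>: "\<epsilon> > 0" and A: "(LINT p|lborel. weight \<epsilon> R p * (cmod (c p))\<^sup>2) = A\<^sup>2" "A > 0" and X0: "Xn > 0"
  shows "L2norm (Z \<epsilon> R) \<le> A powr (1 - \<theta>) * Xn powr \<theta>"
proof (rule power2_le_imp_le)
  let ?L = "A\<^sup>2 powr (1 - \<theta>) * Xn\<^sup>2 powr \<theta>"
  have ix: "integrable lborel (\<lambda>p. (norm (fst p) powr \<beta> * cmod (c p))\<^sup>2)"
    using X by (simp add: L2_def norm_mult)
  have Xi: "(LINT p|lborel. (norm (fst p) powr \<beta> * cmod (c p))\<^sup>2) = Xn\<^sup>2"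
    unfolding Xn_def L2norm_power2 by (simp add: norm_mult)
  let ?Y = "\<lambda>p. (1 - \<theta>) * (weight \<epsilon> R p * (cmod (c p))\<^sup>2 / A\<^sup>2) + \<theta> * ((norm (fst p) powr \<beta> * cmod (c p))\<^sup>2 / Xn\<^sup>2)"
  have "(L2norm (Z \<epsilon> R))\<^sup>2 = (LINT p|lborel. (cmod (Z \<epsilon> R p))\<^sup>2)" by (rule L2norm_power2)
  also have "\<dots> \<le> (LINT p|lborel. ?L * ?Y p)"
  proof (rule integral_mono)
    show "integrable lborel (\<lambda>p. (cmod (Z \<epsilon> R p))\<^sup>2)" using L2_Z[OF \<epsilon>] by (simp add: L2_def)
    show "integrable lborel (\<lambda>p. ?L * ?Y p)"
      using integrable_weight[OF \<epsilon>, of R] ix by (intro integrable_mult_right Bochner_Integration.integrable_add integrable_divide)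
    show "(cmod (Z \<epsilon> R p))\<^sup>2 \<le> ?L * ?Y p" for p
      using A X0 by (intro Z_pointwise \<epsilon>) auto
  qed
  also have "\<dots> = ?L * ((1 - \<theta>) * (A\<^sup>2 / A\<^sup>2) + \<theta> * (Xn\<^sup>2 / Xn\<^sup>2))"
    using integrable_weight[OF \<epsilon>, of R] ix by (simp add: A(1) Xi)
  also have "\<dots> = (A powr (1 - \<theta>) * Xn powr \<theta>)\<^sup>2"
    using A(2) X0 by (simp add: power_mult_distrib power2_eq_square powr_mult)
  finally show "(L2norm (Z \<epsilon> R))\<^sup>2 \<le> (A powr (1 - \<theta>) * Xn powr \<theta>)\<^sup>2" .
qed simp

text \<open>The cut-off makes \<open>A\<close> finite, so in the case \<open>A > 0\<close> its
  powers can be collected on one side; raising the result to the power \<open>s\<close> undoes the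
  exponent 1 + \<theta>.\<close>

lemma energy_bound:
  assumes \<epsilon>: "\<epsilon> > 0"
  shows "(LINT p|lborel. weight \<epsilon> R p * (cmod (c p))\<^sup>2) \<le> (2 * rpow Xn (1 - s) * rpow Yn s)\<^sup>2"
proof -
  have nn: "(LINT p|lborel. weight \<epsilon> R p * (cmod (c p))\<^sup>2) \<ge> 0"
    using weight_nonneg by (intro integral_nonneg_AE) auto
  define A where "A = sqrt (LINT p|lborel. weight \<epsilon> R p * (cmod (c p))\<^sup>2)"
  have A2: "(LINT p|lborel. weight \<epsilon> R p * (cmod (c p))\<^sup>2) = A\<^sup>2" and A0: "A \<ge> 0"
    using nn by (simp_all add: A_def)
  have XY: "Xn \<ge> 0" "Yn \<ge> 0" by (simp_all add: Xn_def Yn_def)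
  have "A \<le> 2 * rpow Xn (1 - s) * rpow Yn s"
  proof (cases "A = 0")
    case True
    then show ?thesis using XY by (simp add: rpow_def)
  next
    case False
    then have A: "A > 0" using A0 by simp
    \<comment> \<open>If \<open>Xn\<close> were 0, then \<open>c\<close> would vanish almost
      everywhere off \<zeta> = 0. Where the weight is nonzero, \<zeta> = 0 is excluded almost
      everywhere because \<open>r\<close> is nonzero, so \<open>A\<close> would be 0.\<close>
    have "Xn \<noteq> 0"
    proof
      assume "Xn = 0"
      then have "AE p in lborel. complex_of_real (norm (fst p) powr \<beta>) * c p = 0"
        unfolding Xn_def by (rule L2norm_eq_0_AE[OF X])
      then have "AE p in lborel. weight \<epsilon> R p * (cmod (c p))\<^sup>2 = 0"
        using AE_r_nonzero
      proof eventually_elim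
        case (elim p)
        show ?case
        proof (cases "weight \<epsilon> R p = 0")
          case False
          then have "nw p \<noteq> 0" using \<epsilon> by (auto simp: weight_def split: if_splits)
          with elim have "fst p \<noteq> 0" by (auto simp: r_def)
          with elim show ?thesis by simp
        qed simp
      qed
      then have "(LINT p|lborel. weight \<epsilon> R p * (cmod (c p))\<^sup>2) = 0"
        by (rule integral_eq_zero_AE)
      with A2 A show False by simp
    qed
    then have X0: "Xn > 0" using XY by simp
    have "A\<^sup>2 \<le> 2 * Yn * L2norm (Z \<epsilon> R)" using energy[OF \<epsilon>, of R] unfolding A2 .
    also have "\<dots> \<le> 2 * Yn * (A powr (1 - \<theta>) * Xn powr \<theta>)"
      using XY by (intro mult_left_mono Z_norm_le[OF \<epsilon> A2 A X0]) auto
    finally have "A\<^sup>2 / A powr (1 - \<theta>) \<le> 2 * Yn * Xn powr \<theta>"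
      using A by (simp add: pos_divide_le_eq mult_ac)
    moreover have "A\<^sup>2 / A powr (1 - \<theta>) = A powr (1 + \<theta>)"
    proof -
      have "A\<^sup>2 = A powr 2" using A by simp
      then show ?thesis by (simp flip: powr_diff)
    qed
    ultimately have "A powr (1 + \<theta>) \<le> 2 * Yn * Xn powr \<theta>" by simp
    then have "(A powr (1 + \<theta>)) powr s \<le> (2 * Yn * Xn powr \<theta>) powr s"
      using s_pos by (intro powr_mono2) auto
    then have "A \<le> (2 * Yn * Xn powr \<theta>) powr s"
      using A s_\<theta>(1) by (simp add: powr_powr mult.commute)
    also have "\<dots> = 2 powr s * Yn powr s * Xn powr (1 - s)"
      using XY s_\<theta>(2) by (simp add: powr_mult powr_powr)
    also have "\<dots> \<le> 2 * Yn powr s * Xn powr (1 - s)"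
    proof -
      \<comment> \<open>Replacing this power by 2 keeps the constant independent of
        \<gamma>.\<close>
      have "2 powr s \<le> 2 powr (1 :: real)" using s_\<theta>(2) \<theta>(1) s_pos by (intro powr_mono) (smt (verit) mult_nonneg_nonneg)+
      then show ?thesis by (intro mult_right_mono) auto
    qed
    also have "\<dots> = 2 * rpow Xn (1 - s) * rpow Yn s"
      using X0 s_pos by (simp add: rpow_def)
    finally show ?thesis .
  qed
  then show ?thesis unfolding A2 using A0 by (intro power_mono)
qed

text \<open>The bound is uniform in the cut-off, so Fatou's lemma removes it along \<epsilon> = 1 /
  (n + 1) and R = n. Where \<open>nw\<close> is 0, every weight is 0, in agreement with the value of
  \<open>0 powr (2 * s)\<close>.\<close>

lemma energy_estimate:
  shows "L2 (\<lambda>p. complex_of_real (nw p powr s) * c p)"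
    and "L2norm (\<lambda>p. complex_of_real (nw p powr s) * c p) \<le> 2 * rpow Xn (1 - s) * rpow Yn s"
proof -
  let ?B = "2 * rpow Xn (1 - s) * rpow Yn s"
  have B: "?B \<ge> 0" by (simp add: rpow_def)
  let ?h = "\<lambda>n p. ennreal (weight (inverse (real (Suc n))) (real n) p * (cmod (c p))\<^sup>2)"
  have "(\<integral>\<^sup>+p. ennreal ((cmod (complex_of_real (nw p powr s) * c p))\<^sup>2) \<partial>lborel) = (\<integral>\<^sup>+p. liminf (\<lambda>n. ?h n p) \<partial>lborel)"
  proof (rule nn_integral_cong)
    fix p :: "'a \<times> ('b \<times> real)"
    have "(\<lambda>n. weight (inverse (real (Suc n))) (real n) p) \<longlonglongrightarrow> nw p powr (2 * s)"
    proof (cases "nw p = 0")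
      case True
      then have "weight (inverse (real (Suc n))) (real n) p = 0" for n by (simp add: weight_def)
      then show ?thesis using True by simp
    next
      case False
      then have "nw p > 0" by (simp add: nw_def)
      then have "\<forall>\<^sub>F n in sequentially. inverse (real (Suc n)) < nw p"
        using LIMSEQ_inverse_real_of_nat by (rule order_tendstoD(2)[rotated])
      moreover have "\<forall>\<^sub>F n in sequentially. nw p \<le> real n"
        using eventually_ge_at_top[of "nat \<lceil>nw p\<rceil>"] by eventually_elim linarith
      ultimately have "\<forall>\<^sub>F n in sequentially. weight (inverse (real (Suc n))) (real n) p = nw p powr (2 * s)"
        by eventually_elim (simp add: weight_def)
      then show ?thesis by (rule tendsto_eventually)
    qed
    then have "(\<lambda>n. ?h n p) \<longlonglongrightarrow> ennreal (nw p powr (2 * s) * (cmod (c p))\<^sup>2)"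
      by (intro tendsto_ennrealI tendsto_mult_right)
    from lim_imp_Liminf[OF sequentially_bot this]
    show "ennreal ((cmod (complex_of_real (nw p powr s) * c p))\<^sup>2) = liminf (\<lambda>n. ?h n p)"
      by (simp add: norm_mult power_mult_distrib power2_eq_square[of "nw p powr s"] flip: powr_add)
  qed
  also have "\<dots> \<le> liminf (\<lambda>n. \<integral>\<^sup>+p. ?h n p \<partial>lborel)"
    by (intro nn_integral_liminf) measurable
  also have "\<dots> \<le> ennreal (?B\<^sup>2)"
  proof (intro Liminf_le always_eventually allI)
    fix n
    have \<epsilon>: "inverse (real (Suc n)) > 0" by simp
    have "(\<integral>\<^sup>+p. ?h n p \<partial>lborel) = ennreal (LINT p|lborel. weight (inverse (real (Suc n))) (real n) p * (cmod (c p))\<^sup>2)"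
      using weight_nonneg by (intro nn_integral_eq_integral integrable_weight[OF \<epsilon>]) auto
    also have "\<dots> \<le> ennreal (?B\<^sup>2)" by (intro ennreal_leI energy_bound \<epsilon>)
    finally show "(\<integral>\<^sup>+p. ?h n p \<partial>lborel) \<le> ennreal (?B\<^sup>2)" .
  qed simp
  finally have le: "(\<integral>\<^sup>+p. ennreal ((cmod (complex_of_real (nw p powr s) * c p))\<^sup>2) \<partial>lborel) \<le> ennreal (?B\<^sup>2)" .
  have m: "(\<lambda>p. complex_of_real (nw p powr s) * c p) \<in> borel_measurable borel" by measurable
  show "L2 (\<lambda>p. complex_of_real (nw p powr s) * c p)" "L2norm (\<lambda>p. complex_of_real (nw p powr s) * c p) \<le> ?B"
    using L2I[OF m le B] by auto
qed

end

section \<open>Fractional Laplacians\<close>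

lemma powr_norm_locally_bounded:
  fixes f :: "'b::euclidean_space \<Rightarrow> 'a::real_normed_vector"
  assumes "q \<ge> 0" "\<And>z. norm (f z) \<le> norm z"
  shows "\<exists>C. \<forall>z. norm z \<le> R \<longrightarrow> cmod (complex_of_real (norm (f z) powr q)) \<le> C"
proof (intro exI allI impI)
  fix z :: 'b assume "norm z \<le> R"
  then have "norm (f z) \<le> R" using assms(2)[of z] by simp
  then have "norm (f z) powr q \<le> R powr q" using assms(1) by (intro powr_mono2) auto
  then show "cmod (complex_of_real (norm (f z) powr q)) \<le> R powr q" by simp
qed

text \<open>The weight depends on the block that is not transformed, so after the swap it is a
  multiplier in the sense of \<open>is_FT_multiplier\<close>.\<close>

lemma is_FT2_powr:
  fixes f :: "'a::euclidean_space \<times> ('b::euclidean_space \<times> 'c::euclidean_space) \<Rightarrow> complex"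
  assumes F: "is_FT2 f F" and q: "q \<ge> 0" and L2: "L2 (\<lambda>p. complex_of_real (norm (fst p) powr q) * f p)"
  shows "is_FT2 (\<lambda>p. complex_of_real (norm (fst p) powr q) * f p) (\<lambda>p. complex_of_real (norm (fst p) powr q) * F p)"
proof -
  have "L2 (\<lambda>p. complex_of_real (norm (fst (snd p)) powr q) * f (swap3 p))"
    using L2 L2_swap3_iff[of "\<lambda>p. complex_of_real (norm (fst p) powr q) * f p"] by simp
  then have "is_FT (\<lambda>p. complex_of_real (norm (fst (snd p)) powr q) * f (swap3 p))
      (\<lambda>p. complex_of_real (norm (fst (snd p)) powr q) * F (swap3 p))"
    using F unfolding is_FT2_def
    by (intro is_FT_multiplier[where m="\<lambda>z. complex_of_real (norm (fst z) powr q)"] powr_norm_locally_bounded q)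
       (auto simp: norm_fst_le)
  then show ?thesis by (simp add: is_FT2_def)
qed

lemma is_FT2_surj: "L2 F \<Longrightarrow> \<exists>f. is_FT2 f F"
  for F :: "'a::euclidean_space \<times> ('b::euclidean_space \<times> 'c::euclidean_space) \<Rightarrow> complex"
proof -
  assume "L2 F"
  then have "L2 (\<lambda>p. F (swap3 p))" by (simp add: L2_swap3_iff)
  then obtain f where "is_FT f (\<lambda>p. F (swap3 p))" using is_FT_surj by blast
  then have "is_FT2 (\<lambda>p. f (swap3 p)) F" by (simp add: is_FT2_def)
  then show ?thesis by blast
qed

section \<open>Reading \<open>D0\<close> and \<open>D1\<close> in split coordinates\<close>

lemma join_coords_measurable [measurable]: "join_coords \<in> borel_measurable borel"
  and split_coords_measurable [measurable]: "split_coords \<in> borel_measurable borel"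
  using mp_measurable[OF measure_preserving_join_coords] mp_measurable[OF measure_preserving_split_coords] by auto

lemma L2_join_iff: "L2 (\<lambda>p. f (join_coords p)) \<longleftrightarrow> L2 f"
  using mp_L2[OF measure_preserving_join_coords, of f] mp_L2[OF measure_preserving_split_coords, of "\<lambda>p. f (join_coords p)"] by auto

lemma L2norm_join: "L2 f \<Longrightarrow> L2norm (\<lambda>p. f (join_coords p)) = L2norm f"
  by (rule mp_L2norm[OF measure_preserving_join_coords]) auto

lemma AE_join_iff: "(AE p in lborel. P (join_coords p)) \<longleftrightarrow> (AE z in lborel. P z)"
  using mp_AE_dest[OF measure_preserving_join_coords, of P] mp_AE_dest[OF measure_preserving_split_coords, of "\<lambda>p. P (join_coords p)"] by auto

text \<open>Existence of a transform gives meaning to the choice made in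
  \<open>partial_fourier\<close>.\<close>

lemma partial_fourier_Inl:
  fixes f :: "(real ^ ('m0::finite + 'm1::finite)) \<times> real \<Rightarrow> complex"
  assumes f: "L2 f"
  shows "is_FT (\<lambda>p. f (join_coords p)) (\<lambda>p. partial_fourier (Inl :: 'm0 \<Rightarrow> 'm0 + 'm1) f (join_coords p))"
proof -
  obtain G where "is_FT (\<lambda>p. f (join_coords p)) G"
    using is_FT_ex f L2_join_iff by blast
  then have "is_partial_fourier (Inl :: 'm0 \<Rightarrow> 'm0 + 'm1) f (\<lambda>z. G (split_coords z))"
    by (simp add: is_partial_fourier_Inl[OF f])
  then show ?thesis
    unfolding is_partial_fourier_Inl[OF f, symmetric] partial_fourier_def
    by (rule someI[where P="is_partial_fourier Inl f"])
qed

lemma partial_fourier_Inr: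
  fixes f :: "(real ^ ('m0::finite + 'm1::finite)) \<times> real \<Rightarrow> complex"
  assumes f: "L2 f"
  shows "is_FT2 (\<lambda>p. f (join_coords p)) (\<lambda>p. partial_fourier (Inr :: 'm1 \<Rightarrow> 'm0 + 'm1) f (join_coords p))"
proof -
  obtain G where "is_FT2 (\<lambda>p. f (join_coords p)) G"
    using is_FT2_ex f L2_join_iff by blast
  then have "is_partial_fourier (Inr :: 'm1 \<Rightarrow> 'm0 + 'm1) f (\<lambda>z. G (split_coords z))"
    by (simp add: is_partial_fourier_Inr[OF f])
  then show ?thesis
    unfolding is_partial_fourier_Inr[OF f, symmetric] partial_fourier_def
    by (rule someI[where P="is_partial_fourier Inr f"])
qed

lemma is_frac_frac: "frac_in_L2 \<iota> q u \<Longrightarrow> is_frac \<iota> q u (frac \<iota> q u)"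
  unfolding frac_in_L2_def frac_def by (rule someI_ex[where P="is_frac \<iota> q u"])

text \<open>The choices in \<open>partial_fourier\<close> and \<open>frac\<close> are harmless,
  since transforms are unique up to null sets; Plancherel's identity carries the norm over.\<close>

lemma D0_transfer:
  fixes u :: "(real ^ ('m0::finite + 'm1::finite)) \<times> real \<Rightarrow> complex"
  assumes D: "D0_in_L2 q u" and u: "L2 u" and a: "is_FT (\<lambda>p. u (join_coords p)) a"
  shows "L2 (\<lambda>p. complex_of_real (norm (fst p) powr q) * a p)"
    and "L2norm (\<lambda>p. complex_of_real (norm (fst p) powr q) * a p) = L2norm (D0 q u)"
proof -
  let ?v = "D0 q u"
  have v: "L2 ?v" "AE z in lborel. partial_fourier (Inl :: 'm0 \<Rightarrow> 'm0 + 'm1) ?v z =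
        complex_of_real (norm (block (Inl :: 'm0 \<Rightarrow> 'm0 + 'm1) (fst z)) powr q) * partial_fourier (Inl :: 'm0 \<Rightarrow> 'm0 + 'm1) u z"
    using is_frac_frac[OF D] by (auto simp: is_frac_def)
  let ?V = "\<lambda>p. partial_fourier (Inl :: 'm0 \<Rightarrow> 'm0 + 'm1) ?v (join_coords p)"
  have V: "is_FT (\<lambda>p. ?v (join_coords p)) ?V" by (rule partial_fourier_Inl[OF v(1)])
  have "AE p in lborel. ?V p = complex_of_real (norm (fst p) powr q) * partial_fourier (Inl :: 'm0 \<Rightarrow> 'm0 + 'm1) u (join_coords p)"
    using v(2)[unfolded AE_join_iff[symmetric]] by simp
  moreover have "AE p in lborel. partial_fourier (Inl :: 'm0 \<Rightarrow> 'm0 + 'm1) u (join_coords p) = a p"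
    by (rule is_FT_unique[OF partial_fourier_Inl[OF u] a])
  ultimately have ae: "AE p in lborel. complex_of_real (norm (fst p) powr q) * a p = ?V p"
    by eventually_elim simp
  have [measurable]: "a \<in> borel_measurable borel" using is_FT_L2(2)[OF a] by auto
  have m: "(\<lambda>p. complex_of_real (norm (fst p) powr q) * a p) \<in> borel_measurable borel" by measurable
  show "L2 (\<lambda>p. complex_of_real (norm (fst p) powr q) * a p)"
    by (rule L2_cong_AE(1)[OF is_FT_L2(2)[OF V] m ae])
  have "L2norm (\<lambda>p. complex_of_real (norm (fst p) powr q) * a p) = L2norm ?V"
    by (rule L2_cong_AE(2)[OF is_FT_L2(2)[OF V] m ae])
  also have "\<dots> = L2norm (\<lambda>p. ?v (join_coords p))" by (rule is_FT_norm[OF V])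
  also have "\<dots> = L2norm ?v" by (rule L2norm_join[OF v(1)])
  finally show "L2norm (\<lambda>p. complex_of_real (norm (fst p) powr q) * a p) = L2norm ?v" .
qed

lemma D1_transfer:
  fixes u :: "(real ^ ('m0::finite + 'm1::finite)) \<times> real \<Rightarrow> complex"
  assumes u: "L2 u" and b: "is_FT2 (\<lambda>p. u (join_coords p)) b"
    and L2: "L2 (\<lambda>p. complex_of_real (norm (fst (snd p)) powr q) * b p)"
  shows "D1_in_L2 q u"
    and "L2norm (D1 q u) = L2norm (\<lambda>p. complex_of_real (norm (fst (snd p)) powr q) * b p)"
proof -
  let ?pf = "partial_fourier (Inr :: 'm1 \<Rightarrow> 'm0 + 'm1)"
  have ub: "AE p in lborel. ?pf u (join_coords p) = b p"
    by (rule is_FT2_unique[OF partial_fourier_Inr[OF u] b])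
  \<comment> \<open>For \<open>D1\<close> membership has to be produced: surjectivity of the
    transform provides a function whose transform is the weighted one.\<close>
  obtain f where f: "is_FT2 f (\<lambda>p. complex_of_real (norm (fst (snd p)) powr q) * b p)"
    using is_FT2_surj[OF L2] by blast
  define v where "v z = f (split_coords z)" for z
  have vf: "(\<lambda>p. v (join_coords p)) = f" by (simp add: v_def)
  have v: "L2 v" unfolding L2_join_iff[symmetric] vf using f by (rule is_FT2_L2)
  have "AE p in lborel. ?pf v (join_coords p) = complex_of_real (norm (fst (snd p)) powr q) * b p"
    by (rule is_FT2_unique[OF partial_fourier_Inr[OF v]]) (simp add: vf f)
  with ub have "AE p in lborel. ?pf v (join_coords p)
      = complex_of_real (norm (block (Inr :: 'm1 \<Rightarrow> 'm0 + 'm1) (fst (join_coords p :: (real ^ ('m0 + 'm1)) \<times> real))) powr q) * ?pf u (join_coords p)"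
    by eventually_elim simp
  then have "is_frac (Inr :: 'm1 \<Rightarrow> 'm0 + 'm1) q u v"
    unfolding AE_join_iff[where P="\<lambda>z. ?pf v z = complex_of_real (norm (block Inr (fst z)) powr q) * ?pf u z"]
    using v by (simp add: is_frac_def)
  then show D: "D1_in_L2 q u" unfolding frac_in_L2_def by blast
  let ?d = "D1 q u"
  have d: "L2 ?d" "AE z in lborel. ?pf ?d z = complex_of_real (norm (block (Inr :: 'm1 \<Rightarrow> 'm0 + 'm1) (fst z)) powr q) * ?pf u z"
    using is_frac_frac[OF D] by (auto simp: is_frac_def)
  let ?V = "\<lambda>p. ?pf ?d (join_coords p)"
  have V: "is_FT2 (\<lambda>p. ?d (join_coords p)) ?V" by (rule partial_fourier_Inr[OF d(1)])
  have "AE p in lborel. ?V p = complex_of_real (norm (fst (snd p)) powr q) * ?pf u (join_coords p)"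
    using d(2)[unfolded AE_join_iff[symmetric]] by simp
  with ub have ae: "AE p in lborel. ?V p = complex_of_real (norm (fst (snd p)) powr q) * b p"
    by eventually_elim simp
  have "L2norm ?d = L2norm (\<lambda>p. ?d (join_coords p))" by (rule L2norm_join[OF d(1), symmetric])
  also have "\<dots> = L2norm ?V" by (rule is_FT2_norm[OF V, symmetric])
  also have "\<dots> = L2norm (\<lambda>p. complex_of_real (norm (fst (snd p)) powr q) * b p)"
    by (rule L2_cong_AE(2)[OF L2 L2_measurable[OF is_FT2_L2(2)[OF V]] ae])
  finally show "L2norm ?d = L2norm (\<lambda>p. complex_of_real (norm (fst (snd p)) powr q) * b p)" .
qed

text \<open>The hypotheses on D0 concern the transform \<open>a\<close> in the first block alone,
  whereas \<open>c\<close> is reached through the second block first. Commutation of the transforms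
  identifies the two routes, and the weight passes through the second transform as a
  multiplier.\<close>

lemma FT_powr_commute:
  fixes U :: "'a::euclidean_space \<times> ('b::euclidean_space \<times> 'c::euclidean_space) \<Rightarrow> complex"
  assumes a: "is_FT U a" and b: "is_FT2 U b" and c: "is_FT b c" and q: "q \<ge> 0"
    and L2: "L2 (\<lambda>p. complex_of_real (norm (fst p) powr q) * a p)"
  shows "L2 (\<lambda>p. complex_of_real (norm (fst p) powr q) * c p)"
    and "L2norm (\<lambda>p. complex_of_real (norm (fst p) powr q) * c p) = L2norm (\<lambda>p. complex_of_real (norm (fst p) powr q) * a p)"
proof -
  obtain d where d: "is_FT2 a d" using is_FT2_ex is_FT_L2(2)[OF a] by blast
  have m: "is_FT2 (\<lambda>p. complex_of_real (norm (fst p) powr q) * a p) (\<lambda>p. complex_of_real (norm (fst p) powr q) * d p)"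
    by (rule is_FT2_powr[OF d q L2])
  have ae: "AE p in lborel. complex_of_real (norm (fst p) powr q) * c p = complex_of_real (norm (fst p) powr q) * d p"
    using is_FT_commute[OF a b c d] by eventually_elim simp
  have [measurable]: "c \<in> borel_measurable borel" using is_FT_L2(2)[OF c] by auto
  have mc: "(\<lambda>p. complex_of_real (norm (fst p) powr q) * c p) \<in> borel_measurable borel" by measurable
  show "L2 (\<lambda>p. complex_of_real (norm (fst p) powr q) * c p)"
    by (rule L2_cong_AE(1)[OF is_FT2_L2(2)[OF m] mc ae])
  show "L2norm (\<lambda>p. complex_of_real (norm (fst p) powr q) * c p) = L2norm (\<lambda>p. complex_of_real (norm (fst p) powr q) * a p)"
    unfolding is_FT2_norm[OF m, symmetric] by (rule L2_cong_AE(2)[OF is_FT2_L2(2)[OF m] mc ae])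
qed

text \<open>Full row rank makes the transpose injective, and an injective linear map in finite
  dimension is bounded below.\<close>

lemma full_rank_transpose_bounded_below:
  fixes B1 :: "real ^ 'm0::finite ^ 'm1::finite"
  assumes "rank B1 = CARD('m1)"
  obtains K where "K \<ge> 1" "\<And>\<eta>. norm \<eta> \<le> K * norm (transpose B1 *v \<eta>)"
proof -
  have "rank (transpose B1) = CARD('m1)" using assms by (simp add: rank_transpose)
  then have "inj ((*v) (transpose B1))" by (simp add: full_rank_injective)
  then obtain k where k: "k > 0" "\<And>\<eta>. k * norm \<eta> \<le> norm (transpose B1 *v \<eta>)"
    using linear_inj_bounded_below_pos[OF matrix_vector_mul_linear] by blast
  show ?thesis
  \<comment> \<open>The maximum with 1 secures K \<ge> 1, so that K to the power s is at most K for
    all s \<le> 1, independently of \<gamma>.\<close>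
  proof (rule that[of "max 1 (1 / k)"])
    show "norm \<eta> \<le> max 1 (1 / k) * norm (transpose B1 *v \<eta>)" for \<eta>
    proof -
      have "norm \<eta> \<le> (1 / k) * norm (transpose B1 *v \<eta>)"
        using k(1) k(2)[of \<eta>] by (simp add: pos_le_divide_eq mult.commute)
      also have "\<dots> \<le> max 1 (1 / k) * norm (transpose B1 *v \<eta>)" by (intro mult_right_mono) auto
      finally show ?thesis .
    qed
  qed simp
qed

section \<open>Assembly of the estimate\<close>

theorem theorem1p1:
  fixes B1 :: "real ^ 'm0::finite ^ 'm1::finite"
    and B :: "real ^ ('m0 + 'm1) ^ ('m0 + 'm1)"
    and \<beta> :: real
  assumes "CARD('m1) \<le> CARD('m0)"
    and "rank B1 = CARD('m1)"
    and "B = block_matrix B1"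
    and "\<beta> \<ge> 1"
  shows "\<exists>C > 0. \<forall>(\<gamma>::real) (u :: (real ^ ('m0 + 'm1)) \<times> real \<Rightarrow> complex) g.
    \<gamma> \<ge> 0 \<longrightarrow> 0 \<le> 1 - \<gamma> \<longrightarrow> 1 - \<gamma> \<le> \<beta> \<longrightarrow>
    L2 u \<longrightarrow> L2 g \<longrightarrow> solves_Y B u g \<longrightarrow>
    D0_in_L2 (max \<beta> \<gamma>) u \<longrightarrow> D0_in_L2 \<gamma> g \<longrightarrow>
    (let s = gain \<beta> \<gamma> in
      D1_in_L2 s u \<and>
      L2norm (D1 s u) \<le> C * rpow (L2norm (D0 \<beta> u)) (1 - s) * rpow (L2norm (D0 \<gamma> g)) s)"
proof -
  obtain K where K: "K \<ge> 1" "\<And>\<eta>. norm \<eta> \<le> K * norm (transpose B1 *v \<eta>)"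
    using full_rank_transpose_bounded_below[OF assms(2)] by blast
  define w where "w \<eta> = transpose B1 *v \<eta>" for \<eta>
  define A where "A x = B1 *v x" for x
  have w [measurable]: "w \<in> borel_measurable borel" and A: "A \<in> borel_measurable borel"
    unfolding w_def A_def by (intro borel_measurable_continuous_onI continuous_matrix_vector_mult continuous_on_id)+
  have adj: "w \<eta> \<bullet> x = \<eta> \<bullet> A x" for \<eta> x
    unfolding w_def A_def by (simp add: transpose_matrix_vector dot_lmul_matrix)
  show ?thesis
  \<comment> \<open>The 2 comes from \<open>energy_estimate\<close> and \<open>K\<close> from the
    full-rank bound; neither depends on \<gamma>, \<open>u\<close> or \<open>g\<close>.\<close>
  proof (intro exI[of _ "2 * K"] conjI allI impI)
    show "2 * K > 0" using K(1) by simp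
    fix \<gamma> :: real and u g :: "(real ^ ('m0 + 'm1)) \<times> real \<Rightarrow> complex"
    assume \<gamma>: "\<gamma> \<ge> 0" "0 \<le> 1 - \<gamma>" and u: "L2 u" and g: "L2 g" and sol: "solves_Y B u g"
      and Du: "D0_in_L2 (max \<beta> \<gamma>) u" and Dg: "D0_in_L2 \<gamma> g"
    \<comment> \<open>Since \<gamma> \<le> 1 \<le> \<beta>, the maximum is \<beta>.\<close>
    have Du': "D0_in_L2 \<beta> u" using Du assms(4) \<gamma> by (simp add: max_absorb1)
    let ?u = "\<lambda>p. u (join_coords p)" and ?g = "\<lambda>p. g (join_coords p)"
    obtain a where a: "is_FT ?u a" using is_FT_ex u L2_join_iff by blast
    obtain ag where ag: "is_FT ?g ag" using is_FT_ex g L2_join_iff by blast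
    obtain b where b: "is_FT2 ?u b" using is_FT2_ex u L2_join_iff by blast
    obtain bg where bg: "is_FT2 ?g bg" using is_FT2_ex g L2_join_iff by blast
    obtain c where bc: "is_FT b c" using is_FT_ex is_FT2_L2(2)[OF b] by blast
    obtain cg where cg: "is_FT bg cg" using is_FT_ex is_FT2_L2(2)[OF bg] by blast
    note Du_bound = FT_powr_commute[OF a b bc _ D0_transfer(1)[OF Du' u a], unfolded D0_transfer(2)[OF Du' u a]]
    note Dg_bound = FT_powr_commute[OF ag bg cg \<gamma>(1) D0_transfer(1)[OF Dg g ag], unfolded D0_transfer(2)[OF Dg g ag]]
    have \<beta>0: "\<beta> \<ge> 0" using assms(4) by simp
    interpret transport_pair w c cg \<beta> \<gamma>
    proof
      show "cmod (LINT p|lborel. (c (dual_flow w \<tau> p) - c p) * k p) \<le> \<tau> * M"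
        if "\<tau> \<ge> 0" "L2 k" "\<And>\<sigma>. 0 \<le> \<sigma> \<Longrightarrow> \<sigma> \<le> \<tau> \<Longrightarrow> cmod (LINT p|lborel. cg (dual_flow w \<sigma> p) * k p) \<le> M"
        for \<tau> k M
      proof (rule duhamel_bound_dual[OF b bc bg cg A w adj _ that(2,3)])
        fix h M
        assume "L2 h" "\<And>\<sigma>. 0 \<le> \<sigma> \<Longrightarrow> \<sigma> \<le> \<tau> \<Longrightarrow> cmod (LINT p|lborel. g (join_coords (block_flow A (- \<sigma>) p)) * h p) \<le> M"
        then show "cmod (LINT p|lborel. (u (join_coords (block_flow A (- \<tau>) p)) - u (join_coords p)) * h p) \<le> \<tau> * M"
          using duhamel_bound_block[OF u g _ sol[unfolded assms(3)] that(1), of h M] unfolding A_def by blast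
      qed
    qed (use w assms(4) \<gamma> Du_bound(1)[OF \<beta>0] Dg_bound(1) is_FT_L2(2)[OF bc] is_FT_L2(2)[OF cg] in auto)
    \<comment> \<open>The exceptional case of \<open>gain\<close> would require \<beta> = 0 and
      cannot occur.\<close>
    have s: "gain \<beta> \<gamma> = s" using assms(4) by (simp add: gain_def s_def)
    have s1: "s \<le> 1" using s_\<theta>(2) \<theta>(1) s_pos by (smt (verit) mult_nonneg_nonneg)
    have norms: "Xn = L2norm (D0 \<beta> u)" "Yn = L2norm (D0 \<gamma> g)"
      unfolding Xn_def Yn_def using Du_bound(2)[OF \<beta>0] Dg_bound(2) by simp_all
    let ?E = "\<lambda>p. complex_of_real (norm (fst (snd p)) powr s) * c p"
    have m: "?E \<in> borel_measurable borel" by measurable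
    have "norm \<eta> powr s \<le> K * norm (w \<eta>) powr s" for \<eta>
    proof -
      have "norm \<eta> powr s \<le> (K * norm (w \<eta>)) powr s"
        using K(2)[of \<eta>] s_pos by (intro powr_mono2) (auto simp: w_def)
      also have "\<dots> = K powr s * norm (w \<eta>) powr s" using K(1) by (simp add: powr_mult)
      also have "\<dots> \<le> K powr 1 * norm (w \<eta>) powr s"
        using K(1) s1 by (intro mult_right_mono powr_mono) auto
      finally show ?thesis using K(1) by simp
    qed
    then have "norm (fst (snd p)) powr s * cmod (c p) \<le> K * (nw p powr s * cmod (c p))" for p
      unfolding nw_def mult.assoc[symmetric] by (intro mult_right_mono) auto
    then have ae: "AE p in lborel. cmod (?E p) \<le> K * cmod (complex_of_real (nw p powr s) * c p)"
      by (auto simp: norm_mult)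
    have E: "L2 ?E" "L2norm ?E \<le> K * L2norm (\<lambda>p. complex_of_real (nw p powr s) * c p)"
      using L2_bound[OF energy_estimate(1) m ae] K(1) by auto
    \<comment> \<open>Square integrability with the weight is known for the full transform
      \<open>c\<close>. The weight depends on \<eta> only, which the transform from \<open>b\<close>
      to \<open>c\<close> leaves alone, so it returns to \<open>b\<close>, where \<open>D1\<close>
      is read off.\<close>
    have bE: "is_FT (\<lambda>p. complex_of_real (norm (fst (snd p)) powr s) * b p) ?E"
      using s_pos E(1)
      by (intro is_FT_multiplier_inverse[where m="\<lambda>z. complex_of_real (norm (fst z) powr s)"] bc powr_norm_locally_bounded)
         (auto simp: norm_fst_le)
    note D1 = D1_transfer[OF u b is_FT_L2(1)[OF bE]]
    have "L2norm (D1 s u) = L2norm ?E" unfolding D1(2) by (rule is_FT_norm[OF bE, symmetric])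
    also have "\<dots> \<le> K * (2 * rpow Xn (1 - s) * rpow Yn s)"
      using E(2) mult_left_mono[OF energy_estimate(2), of K] K(1) by linarith
    finally show "let s = gain \<beta> \<gamma> in D1_in_L2 s u \<and>
      L2norm (D1 s u) \<le> 2 * K * rpow (L2norm (D0 \<beta> u)) (1 - s) * rpow (L2norm (D0 \<gamma> g)) s"
      unfolding s Let_def norms using D1(1) by (simp add: mult_ac)
  qed
qed

end
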